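(* Consider Problem (B) with initial data $(\rho,u,E)(0,x)=(1,1,E_0)$ for $x<0$ (the piston moves toward the gas). For every $\gamma>1$ and $E_0>1/2$ (equivalently every Mach number $0<M_0<\infty$), let $\rho_1,\sigma,p_1,E_1$ be as in the context. Then the piecewise constant function $$(\rho,u,E)(t,x)=\begin{cases}(1,1,E_0), & x/t<\sigma,\\ (\rho_1,0,E_1), & \sigma<x/t\le 0,\end{cases}$$ is an integral weak solution of Problem (B), and the associated measures $\varrho=\rho\mathcal L^2$, $m=\rho u\mathcal L^2$, $n=\rho u^2\mathcal L^2$, $m^1=\rho E\mathcal L^2$, $n^1=\rho uE\mathcal L^2$, $n^2=up\mathcal L^2$, $\wp=p\mathcal L^2$, $w_p\equiv p_1$ (with $p=(\gamma-1)\rho(E-\tfrac12u^2)$) form a measure solution of Problem (B). Moreover: (Case 1) For fixed $\gamma>1$, as $E_0\downarrow 1/2$ (i.e. $M_0\to\infty$), these measure solutions converge weakly as measures (in the sense of the context) to the measure solution $\varrho=\rho\mathcal L^2$ (and corresponding $m,n,m^1,n^1,n^2,\wp$, $w_p\equiv\frac{\gamma+1}{2}$) induced by the integral weak solution of Problem (B) with $E_0=1/2$ $$(\rho,u,E)(t,x)=\begin{cases}(1,1,\tfrac12), & x/t<\frac{1-\gamma}{2},\\ \left(\frac{\gamma+1}{\gamma-1},0,\tfrac12\right), & \frac{1-\gamma}{2}<x/t< 0;\end{cases}$$ in particular there is no concentration of mass. (Case 2) For fixed $E_0>1/2$, as $\gamma\downarrow 1$ (i.e. $M_0\to\infty$,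 with $M_0$ and $\gamma$ related by $1/M_0^2=\gamma(\gamma-1)(E_0-\frac12)$), these measure solutions converge weakly as measures to $$\varrho=\mathsf I_\Omega\mathcal L^2+t\,\delta_P,\ m=\mathsf I_\Omega\mathcal L^2,\ n=\mathsf I_\Omega\mathcal L^2,\ m^1=E_0\mathsf I_\Omega\mathcal L^2+E_0t\,\delta_P,\ n^1=E_0\mathsf I_\Omega\mathcal L^2,\ n^2=0,\ \wp=0,\ w_p\equiv 1,$$ and these limiting measures constitute a (singular) measure solution of Problem (B) with $\gamma=1$, $M_0=\infty$, namely $(\varrho,u,E)=(\mathsf I_\Omega\mathcal L^2+t\delta_P,\ \mathsf I_\Omega,\ E_0)$ on the support of $\varrho$ (so $u=0$ on $P$), whose density contains a Dirac measure on the piston with weight $t$.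
   Context: Setting (coordinates moving with the piston, nondimensionalized): $\Omega=\{(t,x):x<0,\ t>0\}$, piston trajectory $P=\{(t,0):t\ge0\}$. The one-dimensional full compressible Euler system is $\partial_t\rho+\partial_x(\rho u)=0$, $\partial_t(\rho u)+\partial_x(\rho u^2+p)=0$, $\partial_t(\rho E)+\partial_x(\rho uE+up)=0$, with state relation $p=(\gamma-1)\rho(E-\frac12u^2)$, $\gamma\ge1$. Problem (B): these equations in $\Omega$, boundary condition $u=0$ on $P$, initial data $(\rho,u,E)(0,x)=(1,\pm1,E_0)$ for $x<0$ ($+1$: piston moves toward the gas; $-1$: piston recedes). The initial pressure is $p_0=(\gamma-1)(E_0-\frac12)$ and the Mach number $M_0\in(0,\infty]$ satisfies $\frac1{M_0^2}=\gamma(\gamma-1)(E_0-\frac12)$, so $p_0=\frac1{\gamma M_0^2}$, $E_0=\frac12+\frac1{\gamma(\gamma-1)M_0^2}$. Shock state (rushing case): $\rho_1=1+\dfrac{p_0+1-(\gamma-1)E_0+\sqrt{((\gamma-1)E_0-p_0-1)^2+4(\gamma-1)(E_0+p_0)}}{2(\gamma-1)(E_0+p_0)}$, $\sigma=-\frac1{\rho_1-1}$, $p_1=p_0+1+\frac1{\rho_1-1}$, $E_1=\frac1{\rho_1}\big((\rho_1-1)(E_0+p_0)+E_0\big)$. Integral weak solution: $(\rho,u,E)\in L^\infty(\Omega;\mathbb R^3)$ such that for all $\phi\in C^1_0(\mathbb R^2)$: $\int_\Omega(\rho\phi_t+\rho u\phi_x)+\int_{-\infty}^0\rho_0\phi(0,x)dx=0$;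 $\int_\Omega(\rho u\phi_t+(\rho u^2+p)\phi_x)-\int_0^\infty p(t,0)\phi(t,0)dt+\int_{-\infty}^0\rho_0u_0\phi(0,x)dx=0$; $\int_\Omega(\rho E\phi_t+(\rho uE+up)\phi_x)+\int_{-\infty}^0\rho_0E_0\phi(0,x)dx=0$; and every discontinuity in $\Omega$ satisfies the Lax entropy condition. Notation: $\mathcal L^2$ is Lebesgue measure; $\mathsf I_A$ the indicator of $A$; for a locally integrable weight $w$ on $[0,\infty)$, $w\delta_P$ is the measure $\langle w\delta_P,\phi\rangle=\int_0^\infty w(t)\phi(t,0)\,dt$; $\langle\mu,\phi\rangle=\int_{\bar\Omega}\phi\,d\mu$. Measure solution: Radon measures $\varrho,m,n,m^1,n^1,n^2,\wp$ supported on $\bar\Omega$, a function $w_p\in L^1_{loc}([0,\infty))$, and $\varrho$-measurable $u,E$ such that (i) for all $\phi\in C^1_0(\mathbb R^2)$: $\langle\varrho,\phi_t\rangle+\langle m,\phi_x\rangle+\int_{-\infty}^0\rho_0\phi(0,x)dx=0$; $\langle m,\phi_t\rangle+\langle n,\phi_x\rangle+\langle\wp,\phi_x\rangle-\langle w_p\delta_P,\phi\rangle+\int_{-\infty}^0\rho_0u_0\phi(0,x)dx=0$; $\langle m^1,\phi_t\rangle+\langle n^1,\phi_x\rangle+\langle n^2,\phi_x\rangle+\int_{-\infty}^0\rho_0E_0\phi(0,x)dx=0$; (ii) $\varrho\ge0$, $m\ll\varrho$, $n\ll m$, $m^1\ll\varrho$, $n^1\ll m^1$, $n^2\ll\wp$,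 $\wp\ll\varrho$, and $u=\frac{dm}{d\varrho}=\frac{dn}{dm}=\frac{dn^1}{dm^1}=\frac{dn^2}{d\wp}$, $E=\frac{dm^1}{d\varrho}$, with $u=E=0$ where $\varrho=0$; (iii) wherever, in an open neighborhood $\mathcal O$, $\varrho=\rho\mathcal L^2$ and $\wp=p\mathcal L^2$, one has $p=(\gamma-1)\rho(E-\frac12u^2)$ a.e. in $\mathcal O$ and the Lax entropy condition holds for discontinuities of $\rho,u,E$ there. Weak convergence as measures of measure solutions: each of the measures $\varrho_k,m_k,n_k,m^1_k,n^1_k,n^2_k,\wp_k$ converges weakly (vaguely, against $C_0(\mathbb R^2)$) to the corresponding limit measure, and $w_p^k\to w_p$ in $L^1_{loc}([0,\infty))$. *)

theory Defs
  imports "HOL-Analysis.Analysis"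
begin

section \<open>Setting: coordinates z = (t,x) :: real \<times> real\<close>

definition Omega :: "(real \<times> real) set" where
  "Omega = {z. fst z > 0 \<and> snd z < 0}"

definition test_fn :: "(real \<times> real \<Rightarrow> real) \<Rightarrow> (real \<times> real \<Rightarrow> real) \<Rightarrow> (real \<times> real \<Rightarrow> real) \<Rightarrow> bool" where
  "test_fn \<phi> \<phi>t \<phi>x \<longleftrightarrow>
     (\<forall>z. (\<phi> has_derivative (\<lambda>h. \<phi>t z * fst h + \<phi>x z * snd h)) (at z)) \<and>
     continuous_on UNIV \<phi>t \<and> continuous_on UNIV \<phi>x \<and>
     (\<exists>K. compact K \<and> (\<forall>z. z \<notin> K \<longrightarrow> \<phi> z = 0))"

definition cc_on :: "(real \<times> real) set \<Rightarrow> (real \<times> real \<Rightarrow> real) \<Rightarrow> bool" where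
  "cc_on U \<phi> \<longleftrightarrow> continuous_on UNIV \<phi> \<and> (\<exists>K. compact K \<and> K \<subseteq> U \<and> (\<forall>z. z \<notin> K \<longrightarrow> \<phi> z = 0))"

text \<open>A signed Radon measure is represented by its Jordan decomposition (positive part, negative part):
  two mutually singular, locally finite Borel measures.\<close>
type_synonym smeasure = "(real \<times> real) measure \<times> (real \<times> real) measure"

definition radon :: "(real \<times> real) measure \<Rightarrow> bool" where
  "radon M \<longleftrightarrow> sets M = sets borel \<and> (\<forall>K. compact K \<longrightarrow> emeasure M K < \<infinity>)"

definition sradon :: "smeasure \<Rightarrow> bool" where
  "sradon \<mu> \<longleftrightarrow> radon (fst \<mu>) \<and> radon (snd \<mu>) \<and>
     (\<exists>A \<in> sets borel. emeasure (fst \<mu>) A = 0 \<and> emeasure (snd \<mu>) (- A) = 0)"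

definition pair :: "smeasure \<Rightarrow> (real \<times> real \<Rightarrow> real) \<Rightarrow> real" where
  "pair \<mu> \<phi> = (\<integral>z. \<phi> z \<partial>fst \<mu>) - (\<integral>z. \<phi> z \<partial>snd \<mu>)"

definition supported_in :: "smeasure \<Rightarrow> (real \<times> real) set \<Rightarrow> bool" where
  "supported_in \<mu> S \<longleftrightarrow> emeasure (fst \<mu>) (- S) = 0 \<and> emeasure (snd \<mu>) (- S) = 0"

definition nonneg :: "smeasure \<Rightarrow> bool" where
  "nonneg \<mu> \<longleftrightarrow> (\<forall>\<phi>. cc_on UNIV \<phi> \<and> (\<forall>z. \<phi> z \<ge> 0) \<longrightarrow> pair \<mu> \<phi> \<ge> 0)"

definition abs_cont :: "smeasure \<Rightarrow> smeasure \<Rightarrow> bool" where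
  "abs_cont \<mu> \<nu> \<longleftrightarrow> (\<forall>A \<in> sets borel. emeasure (fst \<nu>) A = 0 \<and> emeasure (snd \<nu>) A = 0 \<longrightarrow>
      emeasure (fst \<mu>) A = 0 \<and> emeasure (snd \<mu>) A = 0)"

definition rn_deriv_is :: "smeasure \<Rightarrow> (real \<times> real \<Rightarrow> real) \<Rightarrow> smeasure \<Rightarrow> bool" where
  "rn_deriv_is \<mu> f \<nu> \<longleftrightarrow>
     (\<forall>K. compact K \<longrightarrow> set_integrable (fst \<nu>) K f \<and> set_integrable (snd \<nu>) K f) \<and>
     (\<forall>\<phi>. cc_on UNIV \<phi> \<longrightarrow>
        pair \<mu> \<phi> = (\<integral>z. \<phi> z * f z \<partial>fst \<nu>) - (\<integral>z. \<phi> z * f z \<partial>snd \<nu>))"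

definition vanishes_near :: "smeasure \<Rightarrow> real \<times> real \<Rightarrow> bool" where
  "vanishes_near \<mu> z \<longleftrightarrow> (\<exists>r>0. \<forall>\<phi>. cc_on (ball z r) \<phi> \<longrightarrow> pair \<mu> \<phi> = 0)"

definition lmeas :: "(real \<times> real \<Rightarrow> real) \<Rightarrow> smeasure" where
  "lmeas f = (density lborel (\<lambda>z. ennreal (indicator Omega z * f z)),
              density lborel (\<lambda>z. ennreal (- (indicator Omega z * f z))))"

definition pmeas :: "(real \<Rightarrow> real) \<Rightarrow> smeasure" where
  "pmeas w = (distr (density lborel (\<lambda>t. ennreal (indicator {0..} t * w t))) borel (\<lambda>t. (t, 0)),
              distr (density lborel (\<lambda>t. ennreal (- (indicator {0..} t * w t)))) borel (\<lambda>t. (t, 0)))"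

definition add_measure :: "(real \<times> real) measure \<Rightarrow> (real \<times> real) measure \<Rightarrow> (real \<times> real) measure" where
  "add_measure M N = measure_of UNIV (sets borel) (\<lambda>A. emeasure M A + emeasure N A)"

definition sadd :: "smeasure \<Rightarrow> smeasure \<Rightarrow> smeasure" where
  "sadd \<mu> \<nu> = (add_measure (fst \<mu>) (fst \<nu>), add_measure (snd \<mu>) (snd \<nu>))"

definition pressure :: "real \<Rightarrow> real \<Rightarrow> real \<Rightarrow> real \<Rightarrow> real" where
  "pressure \<gamma> \<rho> u E = (\<gamma> - 1) * \<rho> * (E - u^2 / 2)"

type_synonym state = "real \<times> real \<times> real"  (* (rho, u, E) *)

definition sound :: "real \<Rightarrow> state \<Rightarrow> real" where
  "sound \<gamma> U = sqrt (\<gamma> * pressure \<gamma> (fst U) (fst (snd U)) (snd (snd U)) / fst U)"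

text \<open>Lax entropy condition for a discontinuity with left state UL (smaller x), right state UR
  and speed s; characteristic speeds u - c, u, u + c.  Alternatives: 1-shock, 2-contact, 3-shock.\<close>
definition lax :: "real \<Rightarrow> state \<Rightarrow> state \<Rightarrow> real \<Rightarrow> bool" where
  "lax \<gamma> UL UR s \<longleftrightarrow>
     (let uL = fst (snd UL); uR = fst (snd UR); cL = sound \<gamma> UL; cR = sound \<gamma> UR in
       (uR - cR < s \<and> s < uL - cL \<and> s < uR) \<or>
       (uL = s \<and> uR = s) \<or>
       (uR + cR < s \<and> s < uL + cL \<and> uL < s))"

definition approx_jump :: "(real \<times> real \<Rightarrow> state) \<Rightarrow> real \<times> real \<Rightarrow> real \<Rightarrow> state \<Rightarrow> state \<Rightarrow> bool" where
  "approx_jump U z0 s UL UR \<longleftrightarrow>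
     ((\<lambda>r. (LINT z : ball z0 r \<inter> {z. snd z - snd z0 < s * (fst z - fst z0)} | lborel. norm (U z - UL)) / r^2)
        \<longlongrightarrow> 0) (at_right 0) \<and>
     ((\<lambda>r. (LINT z : ball z0 r \<inter> {z. snd z - snd z0 > s * (fst z - fst z0)} | lborel. norm (U z - UR)) / r^2)
        \<longlongrightarrow> 0) (at_right 0)"

definition lax_ok :: "real \<Rightarrow> (real \<times> real) set \<Rightarrow> (real \<times> real \<Rightarrow> real) \<Rightarrow> (real \<times> real \<Rightarrow> real) \<Rightarrow> (real \<times> real \<Rightarrow> real) \<Rightarrow> bool" where
  "lax_ok \<gamma> V \<rho> u E \<longleftrightarrow>
     (\<forall>z0 \<in> V \<inter> Omega. \<forall>s UL UR. UL \<noteq> UR \<and> approx_jump (\<lambda>z. (\<rho> z, u z, E z)) z0 s UL UR \<longrightarrow> lax \<gamma> UL UR s)"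

definition iws :: "real \<Rightarrow> real \<Rightarrow> real \<Rightarrow> real \<Rightarrow> (real \<times> real \<Rightarrow> real) \<Rightarrow> (real \<times> real \<Rightarrow> real) \<Rightarrow> (real \<times> real \<Rightarrow> real) \<Rightarrow> bool" where
  "iws \<gamma> \<rho>0 u0 E0 \<rho> u E \<longleftrightarrow>
     \<rho> \<in> borel_measurable borel \<and> u \<in> borel_measurable borel \<and> E \<in> borel_measurable borel \<and>
     (\<exists>B. AE z in lborel. z \<in> Omega \<longrightarrow> \<bar>\<rho> z\<bar> \<le> B \<and> \<bar>u z\<bar> \<le> B \<and> \<bar>E z\<bar> \<le> B) \<and>
     (\<forall>\<phi> \<phi>t \<phi>x. test_fn \<phi> \<phi>t \<phi>x \<longrightarrow>
        (LINT z : Omega | lborel. \<rho> z * \<phi>t z + \<rho> z * u z * \<phi>x z)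
          + (LINT x : {..<0} | lborel. \<rho>0 * \<phi> (0, x)) = 0 \<and>
        (LINT z : Omega | lborel. \<rho> z * u z * \<phi>t z
              + (\<rho> z * (u z)^2 + pressure \<gamma> (\<rho> z) (u z) (E z)) * \<phi>x z)
          - (LINT t : {0..} | lborel. pressure \<gamma> (\<rho> (t, 0)) (u (t, 0)) (E (t, 0)) * \<phi> (t, 0))
          + (LINT x : {..<0} | lborel. \<rho>0 * u0 * \<phi> (0, x)) = 0 \<and>
        (LINT z : Omega | lborel. \<rho> z * E z * \<phi>t z
              + (\<rho> z * u z * E z + u z * pressure \<gamma> (\<rho> z) (u z) (E z)) * \<phi>x z)
          + (LINT x : {..<0} | lborel. \<rho>0 * E0 * \<phi> (0, x)) = 0) \<and>
     lax_ok \<gamma> Omega \<rho> u E"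

record msol =
  mrho :: smeasure
  mm   :: smeasure
  mn   :: smeasure
  mm1  :: smeasure
  mn1  :: smeasure
  mn2  :: smeasure
  mp   :: smeasure
  mwp  :: "real \<Rightarrow> real"
  mu   :: "real \<times> real \<Rightarrow> real"
  mE   :: "real \<times> real \<Rightarrow> real"

definition measure_solution :: "real \<Rightarrow> real \<Rightarrow> real \<Rightarrow> real \<Rightarrow> msol \<Rightarrow> bool" where
  "measure_solution \<gamma> \<rho>0 u0 E0 S \<longleftrightarrow>
     (\<forall>\<mu> \<in> {mrho S, mm S, mn S, mm1 S, mn1 S, mn2 S, mp S}. sradon \<mu> \<and> supported_in \<mu> (closure Omega)) \<and>
     mwp S \<in> borel_measurable borel \<and> (\<forall>T\<ge>0. set_integrable lborel {0..T} (mwp S)) \<and>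
     \<comment> \<open>(i)\<close>
     (\<forall>\<phi> \<phi>t \<phi>x. test_fn \<phi> \<phi>t \<phi>x \<longrightarrow>
        pair (mrho S) \<phi>t + pair (mm S) \<phi>x + (LINT x : {..<0} | lborel. \<rho>0 * \<phi> (0, x)) = 0 \<and>
        pair (mm S) \<phi>t + pair (mn S) \<phi>x + pair (mp S) \<phi>x
          - (LINT t : {0..} | lborel. mwp S t * \<phi> (t, 0))
          + (LINT x : {..<0} | lborel. \<rho>0 * u0 * \<phi> (0, x)) = 0 \<and>
        pair (mm1 S) \<phi>t + pair (mn1 S) \<phi>x + pair (mn2 S) \<phi>x
          + (LINT x : {..<0} | lborel. \<rho>0 * E0 * \<phi> (0, x)) = 0) \<and>
     \<comment> \<open>(ii)\<close>
     nonneg (mrho S) \<and>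
     abs_cont (mm S) (mrho S) \<and> abs_cont (mn S) (mm S) \<and> abs_cont (mm1 S) (mrho S) \<and>
     abs_cont (mn1 S) (mm1 S) \<and> abs_cont (mn2 S) (mp S) \<and> abs_cont (mp S) (mrho S) \<and>
     mu S \<in> borel_measurable borel \<and> mE S \<in> borel_measurable borel \<and>
     rn_deriv_is (mm S) (mu S) (mrho S) \<and> rn_deriv_is (mn S) (mu S) (mm S) \<and>
     rn_deriv_is (mn1 S) (mu S) (mm1 S) \<and> rn_deriv_is (mn2 S) (mu S) (mp S) \<and>
     rn_deriv_is (mm1 S) (mE S) (mrho S) \<and>
     (\<forall>z. vanishes_near (mrho S) z \<longrightarrow> mu S z = 0 \<and> mE S z = 0) \<and>
     \<comment> \<open>(iii)\<close>
     (\<forall>V \<rho> p. open V \<and>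
        (\<forall>K. compact K \<and> K \<subseteq> V \<longrightarrow> set_integrable lborel K \<rho> \<and> set_integrable lborel K p) \<and>
        (\<forall>\<phi>. cc_on V \<phi> \<longrightarrow> pair (mrho S) \<phi> = (LINT z | lborel. \<rho> z * \<phi> z) \<and>
                             pair (mp S) \<phi> = (LINT z | lborel. p z * \<phi> z))
      \<longrightarrow> (AE z in lborel. z \<in> V \<longrightarrow> p z = pressure \<gamma> (\<rho> z) (mu S z) (mE S z)) \<and>
          lax_ok \<gamma> V \<rho> (mu S) (mE S))"

definition induced :: "real \<Rightarrow> (real \<times> real \<Rightarrow> real) \<Rightarrow> (real \<times> real \<Rightarrow> real) \<Rightarrow> (real \<times> real \<Rightarrow> real) \<Rightarrow> (real \<Rightarrow> real) \<Rightarrow> msol" where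
  "induced \<gamma> \<rho> u E wp =
     \<lparr> mrho = lmeas \<rho>,
       mm = lmeas (\<lambda>z. \<rho> z * u z),
       mn = lmeas (\<lambda>z. \<rho> z * (u z)^2),
       mm1 = lmeas (\<lambda>z. \<rho> z * E z),
       mn1 = lmeas (\<lambda>z. \<rho> z * u z * E z),
       mn2 = lmeas (\<lambda>z. u z * pressure \<gamma> (\<rho> z) (u z) (E z)),
       mp = lmeas (\<lambda>z. pressure \<gamma> (\<rho> z) (u z) (E z)),
       mwp = wp, mu = u, mE = E \<rparr>"

definition sconv :: "'a filter \<Rightarrow> ('a \<Rightarrow> smeasure) \<Rightarrow> smeasure \<Rightarrow> bool" where
  "sconv F \<mu>s \<mu> \<longleftrightarrow> (\<forall>\<phi>. cc_on UNIV \<phi> \<longrightarrow> ((\<lambda>k. pair (\<mu>s k) \<phi>) \<longlongrightarrow> pair \<mu> \<phi>) F)"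

definition msol_conv :: "'a filter \<Rightarrow> ('a \<Rightarrow> msol) \<Rightarrow> msol \<Rightarrow> bool" where
  "msol_conv F Ss S \<longleftrightarrow>
     sconv F (\<lambda>k. mrho (Ss k)) (mrho S) \<and> sconv F (\<lambda>k. mm (Ss k)) (mm S) \<and>
     sconv F (\<lambda>k. mn (Ss k)) (mn S) \<and> sconv F (\<lambda>k. mm1 (Ss k)) (mm1 S) \<and>
     sconv F (\<lambda>k. mn1 (Ss k)) (mn1 S) \<and> sconv F (\<lambda>k. mn2 (Ss k)) (mn2 S) \<and>
     sconv F (\<lambda>k. mp (Ss k)) (mp S) \<and>
     (\<forall>T\<ge>0. ((\<lambda>k. LINT t : {0..T} | lborel. \<bar>mwp (Ss k) t - mwp S t\<bar>) \<longlongrightarrow> 0) F)"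

definition p0 :: "real \<Rightarrow> real \<Rightarrow> real" where
  "p0 \<gamma> E0 = (\<gamma> - 1) * (E0 - 1/2)"

definition rho1 :: "real \<Rightarrow> real \<Rightarrow> real" where
  "rho1 \<gamma> E0 = 1 + (p0 \<gamma> E0 + 1 - (\<gamma> - 1) * E0
      + sqrt (((\<gamma> - 1) * E0 - p0 \<gamma> E0 - 1)^2 + 4 * (\<gamma> - 1) * (E0 + p0 \<gamma> E0)))
      / (2 * (\<gamma> - 1) * (E0 + p0 \<gamma> E0))"

definition sigma :: "real \<Rightarrow> real \<Rightarrow> real" where
  "sigma \<gamma> E0 = - 1 / (rho1 \<gamma> E0 - 1)"

definition p1 :: "real \<Rightarrow> real \<Rightarrow> real" where
  "p1 \<gamma> E0 = p0 \<gamma> E0 + 1 + 1 / (rho1 \<gamma> E0 - 1)"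

definition E1 :: "real \<Rightarrow> real \<Rightarrow> real" where
  "E1 \<gamma> E0 = (1 / rho1 \<gamma> E0) * ((rho1 \<gamma> E0 - 1) * (E0 + p0 \<gamma> E0) + E0)"

definition pw_state :: "real \<Rightarrow> state \<Rightarrow> state \<Rightarrow> real \<times> real \<Rightarrow> state" where
  "pw_state s UL UR z = (if fst z \<ge> 0 \<and> snd z \<le> 0 then (if snd z < s * fst z then UL else UR) else (0, 0, 0))"

definition shock_sol :: "real \<Rightarrow> real \<Rightarrow> real \<times> real \<Rightarrow> state" where
  "shock_sol \<gamma> E0 = pw_state (sigma \<gamma> E0) (1, 1, E0) (rho1 \<gamma> E0, 0, E1 \<gamma> E0)"

definition lim_sol :: "real \<Rightarrow> real \<times> real \<Rightarrow> state" where
  "lim_sol \<gamma> = pw_state ((1 - \<gamma>) / 2) (1, 1, 1/2) ((\<gamma> + 1) / (\<gamma> - 1), 0, 1/2)"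

definition delta_lim :: "real \<Rightarrow> msol" where
  "delta_lim E0 =
     \<lparr> mrho = sadd (lmeas (\<lambda>_. 1)) (pmeas (\<lambda>t. t)),
       mm = lmeas (\<lambda>_. 1),
       mn = lmeas (\<lambda>_. 1),
       mm1 = sadd (lmeas (\<lambda>_. E0)) (pmeas (\<lambda>t. E0 * t)),
       mn1 = lmeas (\<lambda>_. E0),
       mn2 = lmeas (\<lambda>_. 0),
       mp = lmeas (\<lambda>_. 0),
       mwp = (\<lambda>_. 1),
       mu = indicator Omega,
       mE = (\<lambda>z. E0 * indicator (closure Omega) z) \<rparr>"

end

theory Submission
  imports Defs
begin

text \<open>Write w = -sigma = 1 / (rho1 - 1). The formula for rho1 is the positive root of the quadratic
  equation expressing the Rankine--Hugoniot conditions; in terms of w and g = gamma - 1 it reads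
  w^2 + (1 - g/2) w = g/2 + gamma p0, which makes the squared sound speeds (w + 1)(w - g/2) ahead of the
  shock and w (w + 1 + g/2) behind it, so the shock is a Lax 1-shock.

  The layer between shock and piston is -w t < x < 0. Scaling x by w turns the integral of psi over it
  into w H(w), where H(w) is the integral of psi(t, w y) over the fixed region -t < y < 0; H is continuous,
  also at w = 0, where it equals the integral of t psi(t, 0). The jump of each density across the shock, times w,
  converges, which yields both limits: the delta measure arises because (rho1 - 1) w = 1 while w tends to 0.\<close>

section \<open>The shock state\<close>

text \<open>The jump computations are elementary; what shapes the proof is clause (iii) of
  \<open>measure_solution\<close>. It speaks of every open set \<open>V\<close> and every pair of
  densities that represent the measures on \<open>V\<close>, so a density must first be recovered
  almost everywhere from its integrals against continuous functions. \<open>lax_ok\<close> then asks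
  about approximate jumps of arbitrary speed and states at every point of \<open>V\<close> in
  \<open>Omega\<close>, so the points of the shock line, with the speed and states of the shock,
  have to be shown to be the only candidates. As the recovered density is known only almost
  everywhere, that uniqueness argument has to work with averages over small discs.

  The locale admits \<open>E0 = 1/2\<close>, where the pressure ahead of the shock is zero: the
  limit solution of the first case is then a member of the family and inherits both solution
  properties. At \<open>\<gamma> = 1\<close> the formula for \<open>rho1\<close> divides by zero, so
  the second limit is no such member and is verified on its own.\<close>

locale shock =
  fixes \<gamma> E0 :: real
  assumes gamma: "\<gamma> > 1" and energy: "E0 \<ge> 1/2"
begin

abbreviation "w \<equiv> 1 / (rho1 \<gamma> E0 - 1)"

lemma p0_nonneg: "p0 \<gamma> E0 \<ge> 0"
  using gamma energy by (simp add: p0_def)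

text \<open>With \<open>a > 0\<close> the polynomial \<open>a r^2 + b r - 1\<close> has roots of
  opposite sign, and \<open>rho1 - 1\<close> is the positive one: \<open>S > |b|\<close> makes the
  numerator \<open>S - b\<close> positive.\<close>

lemma rho1_gt_1: "rho1 \<gamma> E0 > 1"
  and rho1_quadratic: "(\<gamma> - 1) * (E0 + p0 \<gamma> E0) * (rho1 \<gamma> E0 - 1)^2
      + ((\<gamma> - 1) * E0 - p0 \<gamma> E0 - 1) * (rho1 \<gamma> E0 - 1) - 1 = 0"
proof -
  define a where "a = (\<gamma> - 1) * (E0 + p0 \<gamma> E0)"
  define b where "b = (\<gamma> - 1) * E0 - p0 \<gamma> E0 - 1"
  define S where "S = sqrt (b^2 + 4 * a)"
  have a: "a > 0"
    using gamma energy p0_nonneg unfolding a_def by (intro mult_pos_pos) auto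
  have S2: "S^2 = b^2 + 4 * a"
    using a by (simp add: S_def)
  have "S > \<bar>b\<bar>"
    using a by (simp add: S_def real_less_rsqrt)
  then have pos: "S - b > 0" by linarith
  have r: "rho1 \<gamma> E0 - 1 = (S - b) / (2 * a)"
    by (simp add: rho1_def a_def b_def S_def algebra_simps)
  show "rho1 \<gamma> E0 > 1"
    using r a pos by (metis diff_gt_0_iff_gt divide_pos_pos mult_pos_pos zero_less_numeral)
  have "a * (rho1 \<gamma> E0 - 1)^2 + b * (rho1 \<gamma> E0 - 1) - 1 = 0"
    unfolding r using a S2 by (simp add: field_simps power2_eq_square)
  then show "(\<gamma> - 1) * (E0 + p0 \<gamma> E0) * (rho1 \<gamma> E0 - 1)^2
      + ((\<gamma> - 1) * E0 - p0 \<gamma> E0 - 1) * (rho1 \<gamma> E0 - 1) - 1 = 0"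
    by (simp add: a_def b_def)
qed

lemma w_pos: "w > 0"
  using rho1_gt_1 by simp

lemma sigma_eq: "sigma \<gamma> E0 = - w"
  by (simp add: sigma_def)

lemma rho1_w: "rho1 \<gamma> E0 * w = 1 + w"
  using rho1_gt_1 by (simp add: field_simps)

lemma p1_eq: "p1 \<gamma> E0 = p0 \<gamma> E0 + 1 + w"
  by (simp add: p1_def)

lemma rho1_E1: "rho1 \<gamma> E0 * E1 \<gamma> E0 = (rho1 \<gamma> E0 - 1) * (E0 + p0 \<gamma> E0) + E0"
  using rho1_gt_1 by (simp add: E1_def)

lemma E1_pos: "E1 \<gamma> E0 > 0"
proof -
  have "(rho1 \<gamma> E0 - 1) * (E0 + p0 \<gamma> E0) \<ge> 0"
    using rho1_gt_1 p0_nonneg energy by simp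
  then have "rho1 \<gamma> E0 * E1 \<gamma> E0 > 0"
    using rho1_E1 energy by linarith
  then show ?thesis
    using rho1_gt_1 by (simp add: zero_less_mult_iff)
qed

text \<open>Dividing \<open>rho1_quadratic\<close> by \<open>(rho1 - 1)^2\<close> replaces
  \<open>rho1 - 1\<close> by its reciprocal. The coefficients simplify through
  \<open>(\<gamma> - 1) * E0 = p0 \<gamma> E0 + (\<gamma> - 1) / 2\<close>. In this form the
  equation still gives information when \<open>rho1\<close> grows without bound.\<close>

lemma w_quadratic: "w^2 + (1 - (\<gamma> - 1) / 2) * w = (\<gamma> - 1) / 2 + \<gamma> * p0 \<gamma> E0"
proof -
  define r where "r = rho1 \<gamma> E0 - 1"
  have r: "r > 0" using rho1_gt_1 by (simp add: r_def)
  have q: "((\<gamma> - 1) / 2 + \<gamma> * p0 \<gamma> E0) * r^2 + ((\<gamma> - 1) / 2 - 1) * r - 1 = 0"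
  proof -
    have "(\<gamma> - 1) * (E0 + p0 \<gamma> E0) = (\<gamma> - 1) / 2 + \<gamma> * p0 \<gamma> E0"
      and "(\<gamma> - 1) * E0 - p0 \<gamma> E0 - 1 = (\<gamma> - 1) / 2 - 1"
      by (simp_all add: p0_def field_simps)
    then show ?thesis
      using rho1_quadratic unfolding r_def by metis
  qed
  have "((\<gamma> - 1) / 2 + \<gamma> * p0 \<gamma> E0) * r^2 = 1 + (1 - (\<gamma> - 1) / 2) * r"
    using q by (simp add: algebra_simps)
  then have "(\<gamma> - 1) / 2 + \<gamma> * p0 \<gamma> E0 = (1 + (1 - (\<gamma> - 1) / 2) * r) / r^2"
    using r by (metis less_irrefl nonzero_mult_div_cancel_right power_not_zero)
  also have "\<dots> = (1/r)^2 + (1 - (\<gamma> - 1) / 2) * (1/r)"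
    using r by (simp add: field_simps power2_eq_square)
  finally show ?thesis by (simp add: r_def)
qed

text \<open>\<open>p1\<close> is defined by the momentum jump and \<open>E1\<close> by the energy
  jump. That these two values satisfy the state relation is not built into them; it is exactly the
  quadratic equation for \<open>rho1 - 1\<close>.\<close>

lemma p1_pressure: "p1 \<gamma> E0 = pressure \<gamma> (rho1 \<gamma> E0) 0 (E1 \<gamma> E0)"
proof -
  define r where "r = rho1 \<gamma> E0 - 1"
  have r: "r > 0" using rho1_gt_1 by (simp add: r_def)
  have q: "(\<gamma> - 1) * (E0 + p0 \<gamma> E0) * r^2 + ((\<gamma> - 1) * E0 - p0 \<gamma> E0 - 1) * r - 1 = 0"
    using rho1_quadratic unfolding r_def .
  have "pressure \<gamma> (rho1 \<gamma> E0) 0 (E1 \<gamma> E0) = (\<gamma> - 1) * (r * (E0 + p0 \<gamma> E0) + E0)"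
    using rho1_E1 by (simp add: pressure_def r_def mult.assoc)
  also have "\<dots> = p0 \<gamma> E0 + 1 + 1 / r"
  proof -
    have "((\<gamma> - 1) * (r * (E0 + p0 \<gamma> E0) + E0)) * r = (p0 \<gamma> E0 + 1 + 1 / r) * r"
      using q r by (simp add: field_simps power2_eq_square)
    then show ?thesis using r by simp
  qed
  finally show ?thesis by (simp add: p1_def r_def)
qed

text \<open>Since \<open>uL = 1\<close>, \<open>uR = 0\<close> and \<open>s = - w\<close>, the
  1-shock inequalities read \<open>cL < 1 + w\<close>, \<open>w < cR\<close> and
  \<open>- w < 0\<close>. The first two are compared through squares, where the factored sound
  speeds make them visible.\<close>

lemma lax_shock: "lax \<gamma> (1, 1, E0) (rho1 \<gamma> E0, 0, E1 \<gamma> E0) (sigma \<gamma> E0)"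
proof -
  have w: "w > 0" by (rule w_pos)
  have "x^2 + (1 - h) * x = h + c \<Longrightarrow> c = (x + 1) * (x - h)" for x h c :: real
    by (simp add: algebra_simps power2_eq_square)
  from this[OF w_quadratic]
  have c0: "\<gamma> * p0 \<gamma> E0 = (w + 1) * (w - (\<gamma> - 1) / 2)" .
  have sL: "sound \<gamma> (1, 1, E0) = sqrt (\<gamma> * p0 \<gamma> E0)"
    by (simp add: sound_def pressure_def p0_def)
  have sR: "sound \<gamma> (rho1 \<gamma> E0, 0, E1 \<gamma> E0) = sqrt (\<gamma> * p1 \<gamma> E0 / rho1 \<gamma> E0)"
    by (simp add: sound_def p1_pressure)
  have "\<gamma> * p0 \<gamma> E0 < (1 + w)^2"
  proof -
    have "(x + 1) * (x - (g - 1) / 2) < (x + 1) * (x + 1)" if "x > 0" "g > 1" for x g :: real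
      using that by (intro mult_strict_left_mono) auto
    from this[OF w gamma] show ?thesis using c0 by (simp add: power2_eq_square add.commute)
  qed
  then have l: "sqrt (\<gamma> * p0 \<gamma> E0) < 1 + w"
    using w by (intro real_less_lsqrt) auto
  have aux: "g * p = (x + 1) * (x - (g - 1) / 2) \<Longrightarrow> g * (p + 1 + x) = (x + 1) * (x + 1 + (g - 1) / 2)"
    for g p x :: real by (simp add: field_simps)
  have p1: "\<gamma> * p1 \<gamma> E0 = (w + 1) * (w + 1 + (\<gamma> - 1) / 2)"
    using aux[OF c0] unfolding p1_eq .
  have rho1: "rho1 \<gamma> E0 = (w + 1) / w"
    using rho1_w w by (metis add.commute less_irrefl nonzero_mult_div_cancel_right)
  have aux2: "x > 0 \<Longrightarrow> (x + 1) * y / ((x + 1) / x) = x * y" for x y :: real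
    by (simp add: field_simps)
  have "\<gamma> * p1 \<gamma> E0 / rho1 \<gamma> E0 = (w + 1) * (w + 1 + (\<gamma> - 1) / 2) / ((w + 1) / w)"
    by (rule arg_cong2[OF p1 rho1])
  also have "\<dots> = w * (w + 1 + (\<gamma> - 1) / 2)"
    by (rule aux2[OF w])
  also have "\<dots> > w * w"
  proof -
    have "x * x < x * (x + 1 + (g - 1) / 2)" if "x > 0" "g > 1" for x g :: real
    proof -
      have "(g - 1) / 2 > 0" using that by simp
      then have "x < x + 1 + (g - 1) / 2" by linarith
      then show ?thesis using that by (intro mult_strict_left_mono)
    qed
    from this[OF w gamma] show ?thesis .
  qed
  finally have "w < sqrt (\<gamma> * p1 \<gamma> E0 / rho1 \<gamma> E0)"
    by (intro real_less_rsqrt) (simp add: power2_eq_square)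
  then show ?thesis
    using l w unfolding lax_def Let_def sL sR sigma_eq by simp
qed

end

text \<open>At \<open>E0 = 1/2\<close> the discriminant is the perfect square
  \<open>((\<gamma> + 1) / 2)^2\<close>, so all the shock quantities become rational in
  \<open>\<gamma>\<close>.\<close>

lemma shock_state_pressureless:
  assumes "\<gamma> > 1"
  shows "rho1 \<gamma> (1/2) = (\<gamma> + 1) / (\<gamma> - 1)" "sigma \<gamma> (1/2) = (1 - \<gamma>) / 2"
    "E1 \<gamma> (1/2) = 1/2" "p1 \<gamma> (1/2) = (\<gamma> + 1) / 2"
proof -
  have "((\<gamma> - 1) * (1/2) - 0 - 1)^2 + 4 * (\<gamma> - 1) * (1/2 + 0) = ((\<gamma> + 1) / 2)^2"
    by (simp add: power2_eq_square field_simps)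
  then have "sqrt (((\<gamma> - 1) * (1/2) - 0 - 1)^2 + 4 * (\<gamma> - 1) * (1/2 + 0)) = (\<gamma> + 1) / 2"
    using assms by (simp add: real_sqrt_unique)
  moreover have "p0 \<gamma> (1/2) = 0" by (simp add: p0_def)
  ultimately have "rho1 \<gamma> (1/2) = 1 + (0 + 1 - (\<gamma> - 1) * (1/2) + (\<gamma> + 1) / 2) / (2 * (\<gamma> - 1) * (1/2 + 0))"
    unfolding rho1_def by metis
  then show r: "rho1 \<gamma> (1/2) = (\<gamma> + 1) / (\<gamma> - 1)"
    using assms by (simp add: field_simps)
  have r1: "rho1 \<gamma> (1/2) - 1 = 2 / (\<gamma> - 1)"
    using assms by (simp add: r field_simps)
  show "sigma \<gamma> (1/2) = (1 - \<gamma>) / 2" "p1 \<gamma> (1/2) = (\<gamma> + 1) / 2"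
    unfolding sigma_def p1_def r1 by (simp_all add: p0_def field_simps)
  have "rho1 \<gamma> (1/2) \<noteq> 0"
    using assms by (simp add: r)
  then show "E1 \<gamma> (1/2) = 1/2"
    by (simp add: E1_def p0_def field_simps)
qed

lemma lim_sol_eq: "\<gamma> > 1 \<Longrightarrow> lim_sol \<gamma> = shock_sol \<gamma> (1/2)"
  by (simp add: lim_sol_def shock_sol_def shock_state_pressureless)

section \<open>Test functions and the region behind the shock\<close>

lemma cc_onE:
  assumes "cc_on U \<phi>"
  obtains R B where "R > 0" "\<And>z. \<bar>\<phi> z\<bar> \<le> B" "\<And>z. norm z > R \<Longrightarrow> \<phi> z = 0"
proof -
  from assms obtain K where c: "continuous_on UNIV \<phi>" and K: "compact K" "\<And>z. z \<notin> K \<Longrightarrow> \<phi> z = 0"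
    unfolding cc_on_def by blast
  obtain R where R: "R > 0" "\<And>z. z \<in> K \<Longrightarrow> norm z \<le> R"
    using compact_imp_bounded[OF K(1)] bounded_pos by metis
  have "compact (\<phi> ` K)"
    using K(1) c continuous_on_subset by (intro compact_continuous_image) auto
  then obtain B where B: "B > 0" "\<And>z. z \<in> K \<Longrightarrow> norm (\<phi> z) \<le> B"
    using compact_imp_bounded bounded_pos by (metis imageI)
  show thesis
  proof
    show "R > 0" by fact
    show "\<bar>\<phi> z\<bar> \<le> B" for z
      using B K(2)[of z] by (cases "z \<in> K") auto
    show "norm z > R \<Longrightarrow> \<phi> z = 0" for z
      using R(2)[of z] K(2)[of z] by fastforce
  qed
qed

lemma cc_on_continuous: "cc_on U \<phi> \<Longrightarrow> continuous_on S \<phi>"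
  unfolding cc_on_def using continuous_on_subset by blast

lemma cc_on_mono: "cc_on U \<phi> \<Longrightarrow> U \<subseteq> V \<Longrightarrow> cc_on V \<phi>"
  unfolding cc_on_def by blast

lemma cc_on_measurable: "cc_on U \<phi> \<Longrightarrow> \<phi> \<in> borel_measurable borel"
  by (intro borel_measurable_continuous_onI cc_on_continuous)

lemma cc_on_integrable:
  assumes "cc_on U \<phi>" shows "integrable lborel \<phi>"
proof -
  from assms obtain K where K: "compact K" "\<And>z. z \<notin> K \<Longrightarrow> \<phi> z = 0"
    unfolding cc_on_def by blast
  have "integrable lborel (\<lambda>z. indicator K z *\<^sub>R \<phi> z)"
    using K(1) cc_on_continuous[OF assms] by (intro borel_integrable_compact)
  moreover have "(\<lambda>z. indicator K z *\<^sub>R \<phi> z) = \<phi>"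
  proof (rule ext)
    show "indicator K z *\<^sub>R \<phi> z = \<phi> z" for z
      using K(2)[of z] by (auto simp: indicator_def)
  qed
  ultimately show ?thesis by simp
qed

lemma cc_on_set_integrable: "cc_on U \<phi> \<Longrightarrow> A \<in> sets borel \<Longrightarrow> set_integrable lborel A \<phi>"
  unfolding set_integrable_def by (intro integrable_mult_indicator cc_on_integrable) auto

text \<open>The complement of \<open>K\<close> is open, so off \<open>K\<close> the function is
  locally zero and both partial derivatives vanish: one compact set serves for all three
  functions.\<close>

lemma test_fn_cc_on:
  assumes "test_fn \<phi> \<phi>t \<phi>x"
  shows "cc_on UNIV \<phi>" "cc_on UNIV \<phi>t" "cc_on UNIV \<phi>x"
proof -
  from assms obtain K where
    d: "\<And>z. (\<phi> has_derivative (\<lambda>h. \<phi>t z * fst h + \<phi>x z * snd h)) (at z)" and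
    c: "continuous_on UNIV \<phi>t" "continuous_on UNIV \<phi>x" and
    K: "compact K" "\<And>z. z \<notin> K \<Longrightarrow> \<phi> z = 0"
    unfolding test_fn_def by blast
  have "\<phi>t z = 0 \<and> \<phi>x z = 0" if "z \<notin> K" for z
  proof -
    have "((\<lambda>_. 0 :: real) has_derivative (\<lambda>_. 0)) (at z)" by simp
    then have "(\<phi> has_derivative (\<lambda>_. 0)) (at z)"
      by (rule has_derivative_transform_within_open[where s = "- K"])
         (use K that in \<open>auto simp: compact_imp_closed open_Compl\<close>)
    then have eq: "(\<lambda>h. \<phi>t z * fst h + \<phi>x z * snd h) = (\<lambda>_. 0)"
      using d has_derivative_unique by blast
    show ?thesis
      using fun_cong[OF eq, of "(1, 0)"] fun_cong[OF eq, of "(0, 1)"] by simp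
  qed
  then show "cc_on UNIV \<phi>t" "cc_on UNIV \<phi>x"
    using c K(1) unfolding cc_on_def by blast+
  have "continuous_on UNIV \<phi>"
    using d has_derivative_continuous by (simp add: continuous_on_eq_continuous_at) blast
  then show "cc_on UNIV \<phi>"
    using K unfolding cc_on_def by blast
qed

lemma test_fn_partial:
  assumes "test_fn \<phi> \<phi>t \<phi>x"
  shows "((\<lambda>t. \<phi> (t, x)) has_real_derivative \<phi>t (t, x)) (at t)"
    and "((\<lambda>x. \<phi> (t, x)) has_real_derivative \<phi>x (t, x)) (at x)"
proof -
  have d: "(\<phi> has_derivative (\<lambda>h. \<phi>t z * fst h + \<phi>x z * snd h)) (at z)" for z
    using assms unfolding test_fn_def by blast
  have "((\<lambda>t. \<phi> (t, x)) has_derivative (\<lambda>h. \<phi>t (t, x) * fst (h, 0 :: real) + \<phi>x (t, x) * snd (h, 0 :: real))) (at t)"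
    by (rule has_derivative_compose[OF _ d]) (auto intro!: derivative_eq_intros)
  then show "((\<lambda>t. \<phi> (t, x)) has_real_derivative \<phi>t (t, x)) (at t)"
    by (simp add: has_field_derivative_def)
  have "((\<lambda>x. \<phi> (t, x)) has_derivative (\<lambda>h. \<phi>t (t, x) * fst (0 :: real, h) + \<phi>x (t, x) * snd (0 :: real, h))) (at x)"
    by (rule has_derivative_compose[OF _ d]) (auto intro!: derivative_eq_intros)
  then show "((\<lambda>x. \<phi> (t, x)) has_real_derivative \<phi>x (t, x)) (at x)"
    by (simp add: has_field_derivative_def)
qed

section \<open>Integrals of derivatives on the line, and Fubini in the plane\<close>

lemma set_integral_deriv_Icc:
  fixes f f' :: "real \<Rightarrow> real"
  assumes "\<And>x. (f has_real_derivative f' x) (at x)" "continuous_on UNIV f'" "a \<le> b"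
  shows "(LINT x:{a..b}|lborel. f' x) = f b - f a"
  unfolding set_lebesgue_integral_def using assms
  by (intro integral_FTC_atLeastAtMost)
     (auto simp: has_real_derivative_iff_has_vector_derivative
       intro: has_vector_derivative_at_within continuous_on_subset)

lemma has_real_derivative_eq_0_on_open:
  fixes f f' :: "real \<Rightarrow> real"
  assumes "(f has_real_derivative f' x) (at x)" "open S" "x \<in> S" "\<And>y. y \<in> S \<Longrightarrow> f y = 0"
  shows "f' x = 0"
proof -
  have "(f has_real_derivative 0) (at x)"
    by (rule has_field_derivative_transform_within_open[where f = "\<lambda>_. 0" and S = S])
      (simp_all add: assms(2-4))
  then show ?thesis using assms(1) DERIV_unique by blast
qed

lemma set_integral_deriv_atLeast:
  fixes f f' :: "real \<Rightarrow> real"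
  assumes d: "\<And>x. (f has_real_derivative f' x) (at x)" and c: "continuous_on UNIV f'"
    and z: "\<And>x. x > R \<Longrightarrow> f x = 0"
  shows "(LINT x:{a..}|lborel. f' x) = - f a"
proof -
  \<comment> \<open>\<open>R + 1\<close> lies strictly beyond \<open>R\<close>, where
    \<open>f\<close> is known to vanish; the maximum keeps \<open>a \<le> M\<close> even if
    \<open>a\<close> is already beyond the support.\<close>
  define M where "M = max (R + 1) a"
  have "f' x = 0" if "x > R" for x
    using has_real_derivative_eq_0_on_open[OF d, where S = "{R<..}" and x = x] z that by auto
  then have "indicator {a..} x *\<^sub>R f' x = indicator {a..M} x *\<^sub>R f' x" for x
    by (auto simp: indicator_def M_def)
  then have "(LINT x:{a..}|lborel. f' x) = (LINT x:{a..M}|lborel. f' x)"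
    unfolding set_lebesgue_integral_def by presburger
  also have "\<dots> = f M - f a"
    using d c by (intro set_integral_deriv_Icc) (auto simp: M_def)
  finally show ?thesis using z[of M] by (simp add: M_def)
qed

lemma set_integral_deriv_atMost:
  fixes f f' :: "real \<Rightarrow> real"
  assumes d: "\<And>x. (f has_real_derivative f' x) (at x)" and c: "continuous_on UNIV f'"
    and z: "\<And>x. x < R \<Longrightarrow> f x = 0"
  shows "(LINT x:{..a}|lborel. f' x) = f a"
proof -
  define M where "M = min (R - 1) a"
  have "f' x = 0" if "x < R" for x
    using has_real_derivative_eq_0_on_open[OF d, where S = "{..<R}" and x = x] z that by auto
  then have "indicator {..a} x *\<^sub>R f' x = indicator {M..a} x *\<^sub>R f' x" for x
    by (auto simp: indicator_def M_def)
  then have "(LINT x:{..a}|lborel. f' x) = (LINT x:{M..a}|lborel. f' x)"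
    unfolding set_lebesgue_integral_def by presburger
  also have "\<dots> = f a - f M"
    using d c by (intro set_integral_deriv_Icc) (auto simp: M_def)
  finally show ?thesis using z[of M] by (simp add: M_def)
qed

lemma set_integral_remove_point:
  fixes f :: "real \<Rightarrow> real"
  assumes "f \<in> borel_measurable borel" "A \<in> sets borel"
  shows "(LINT x:A - {a}|lborel. f x) = (LINT x:A|lborel. f x)"
  unfolding set_lebesgue_integral_def
proof (rule integral_cong_AE)
  show "AE x in lborel. indicator (A - {a}) x *\<^sub>R f x = indicator A x *\<^sub>R f x"
    using AE_lborel_singleton[of a] by eventually_elim (auto simp: indicator_def)
qed (use assms in measurable)

lemma set_integral_greaterThan:
  fixes f :: "real \<Rightarrow> real"
  assumes "f \<in> borel_measurable borel"
  shows "(LINT x:{a<..}|lborel. f x) = (LINT x:{a..}|lborel. f x)"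
    and "(LINT x:{..<a}|lborel. f x) = (LINT x:{..a}|lborel. f x)"
proof -
  have "{a<..} = {a..} - {a}" "{..<a} = {..a} - {a}" by auto
  then show "(LINT x:{a<..}|lborel. f x) = (LINT x:{a..}|lborel. f x)"
    and "(LINT x:{..<a}|lborel. f x) = (LINT x:{..a}|lborel. f x)"
    using set_integral_remove_point[OF assms] by (metis atLeast_borel, metis atMost_borel)
qed

lemma lborel_Fubini:
  fixes f :: "real \<times> real \<Rightarrow> real"
  assumes "integrable lborel f"
  shows "integral\<^sup>L lborel f = (LINT t|lborel. LINT x|lborel. f (t, x))"
    and "integral\<^sup>L lborel f = (LINT x|lborel. LINT t|lborel. f (t, x))"
proof -
  have i: "integrable (lborel \<Otimes>\<^sub>M lborel) f"
    using assms by (simp add: lborel_prod)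
  show "integral\<^sup>L lborel f = (LINT t|lborel. LINT x|lborel. f (t, x))"
    using lborel_pair.integral_fst'[OF i] by (simp add: lborel_prod)
  have "integrable (lborel \<Otimes>\<^sub>M lborel) (case_prod (\<lambda>t x. f (t, x)))"
    using i by (simp add: case_prod_unfold)
  from lborel_pair.integral_snd[OF this]
  show "integral\<^sup>L lborel f = (LINT x|lborel. LINT t|lborel. f (t, x))"
    by (simp add: lborel_prod case_prod_unfold)
qed

section \<open>The quarter plane, the layer behind the shock, and their divergence
  identities\<close>

lemma open_Omega: "open Omega"
  unfolding Omega_def by (intro open_Collect_conj open_Collect_less continuous_intros)

lemma Omega_borel [measurable]: "Omega \<in> sets borel"
  using open_Omega by simp

text \<open>The shock line belongs to the layer because \<open>pw_state\<close> takes its right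
  state there. Splitting an integral over \<open>Omega\<close> at the shock is then a pointwise
  identity of integrands.\<close>

definition behind :: "real \<Rightarrow> (real \<times> real) set" where
  "behind w = {z. fst z > 0 \<and> - w * fst z \<le> snd z \<and> snd z < 0}"

lemma behind_borel [measurable]: "behind w \<in> sets borel"
proof -
  have "closed {z :: real \<times> real. - w * fst z \<le> snd z}"
    by (intro closed_Collect_le continuous_intros)
  then have "Omega \<inter> {z. - w * fst z \<le> snd z} \<in> sets borel"
    by (intro sets.Int Omega_borel borel_closed)
  moreover have "Omega \<inter> {z. - w * fst z \<le> snd z} = behind w"
    by (auto simp: behind_def Omega_def)
  ultimately show ?thesis by simp
qed

context
  fixes \<phi> \<phi>t \<phi>x assumes test: "test_fn \<phi> \<phi>t \<phi>x"
begin

private lemma cont: "continuous_on S \<phi>" "continuous_on S \<phi>t" "continuous_on S \<phi>x"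
  using test_fn_cc_on[OF test] cc_on_continuous by blast+

private lemma section_measurable: "continuous_on UNIV g \<Longrightarrow> (\<lambda>t. \<phi> (g t)) \<in> borel_measurable borel"
  by (intro borel_measurable_continuous_onI continuous_on_compose2[OF cont(1)[of UNIV]]) auto

private lemma vanish: obtains R where "R > 0" "\<And>t x. \<bar>t\<bar> > R \<or> \<bar>x\<bar> > R \<Longrightarrow> \<phi> (t, x) = 0"
proof -
  obtain R B where R: "R > 0" "\<And>z. norm z > R \<Longrightarrow> \<phi> z = 0"
    using cc_onE[OF test_fn_cc_on(1)[OF test]] by metis
  have "\<phi> (t, x) = 0" if "\<bar>t\<bar> > R \<or> \<bar>x\<bar> > R" for t x
    using that R(2)[of "(t, x)"] norm_fst_le[of t x] norm_snd_le[of x t] by fastforce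
  then show thesis using that R(1) by blast
qed

text \<open>The time coordinate alone bounds the support: \<open>\<phi> (t, x) = 0\<close> for
  \<open>t > R\<close> whatever \<open>x\<close> is, so the integral along any continuous curve over
  \<open>t \<ge> 0\<close> reduces to a compact interval.\<close>

lemma section_set_integrable:
  assumes "continuous_on UNIV g"
  shows "set_integrable lborel {0..} (\<lambda>t. \<phi> (t, g t))"
proof -
  obtain R where R: "R > 0" "\<And>t x. \<bar>t\<bar> > R \<or> \<bar>x\<bar> > R \<Longrightarrow> \<phi> (t, x) = 0"
    using vanish by blast
  have "continuous_on {0..R} (\<lambda>t. \<phi> (t, g t))"
    by (rule continuous_on_compose2[OF cont(1)[of UNIV]])
       (use continuous_on_subset[OF assms] in \<open>auto intro!: continuous_intros\<close>)
  then have "set_integrable lborel {0..R} (\<lambda>t. \<phi> (t, g t))"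
    by (rule borel_integrable_atLeastAtMost')
  moreover have "(\<lambda>t. indicator {0..} t *\<^sub>R \<phi> (t, g t)) = (\<lambda>t. indicator {0..R} t *\<^sub>R \<phi> (t, g t))"
    using R by (intro ext) (auto simp: indicator_def)
  ultimately show ?thesis unfolding set_integrable_def by argo
qed

private lemma slices:
  shows "(LINT t:{a..}|lborel. \<phi>t (t, x)) = - \<phi> (a, x)"
    and "(LINT x:{..<a}|lborel. \<phi>x (t, x)) = \<phi> (t, a)"
    and "(LINT t:{a<..}|lborel. \<phi>t (t, x)) = - \<phi> (a, x)"
    and "a \<le> b \<Longrightarrow> (LINT x:{a..<b}|lborel. \<phi>x (t, x)) = \<phi> (t, b) - \<phi> (t, a)"
proof -
  obtain R where R: "R > 0" "\<And>t x. \<bar>t\<bar> > R \<or> \<bar>x\<bar> > R \<Longrightarrow> \<phi> (t, x) = 0"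
    using vanish by blast
  have ct: "continuous_on UNIV (\<lambda>t. \<phi>t (t, x))" for x
    by (rule continuous_on_compose2[OF cont(2)[of UNIV]]) (auto intro!: continuous_intros)
  have cx: "continuous_on UNIV (\<lambda>x. \<phi>x (t, x))" for t
    by (rule continuous_on_compose2[OF cont(3)[of UNIV]]) (auto intro!: continuous_intros)
  show t: "(LINT t:{a..}|lborel. \<phi>t (t, x)) = - \<phi> (a, x)"
    by (rule set_integral_deriv_atLeast[where R=R, OF test_fn_partial(1)[OF test] ct]) (auto intro!: R(2))
  then show "(LINT t:{a<..}|lborel. \<phi>t (t, x)) = - \<phi> (a, x)"
    by (subst set_integral_greaterThan) (use ct in \<open>auto intro: borel_measurable_continuous_onI\<close>)
  have "(LINT x:{..a}|lborel. \<phi>x (t, x)) = \<phi> (t, a)"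
    by (rule set_integral_deriv_atMost[where R="-R", OF test_fn_partial(2)[OF test] cx])
       (use R(1) in \<open>auto intro!: R(2)\<close>)
  then show "(LINT x:{..<a}|lborel. \<phi>x (t, x)) = \<phi> (t, a)"
    by (subst set_integral_greaterThan) (use cx in \<open>auto intro: borel_measurable_continuous_onI\<close>)
  assume "a \<le> b"
  then have "(LINT x:{a..b}|lborel. \<phi>x (t, x)) = \<phi> (t, b) - \<phi> (t, a)"
    by (intro set_integral_deriv_Icc test_fn_partial[OF test] cx)
  moreover have "{a..<b} = {a..b} - {b}" by auto
  ultimately show "(LINT x:{a..<b}|lborel. \<phi>x (t, x)) = \<phi> (t, b) - \<phi> (t, a)"
    using cx by (simp add: set_integral_remove_point borel_measurable_continuous_onI)
qed

lemma integral_Omega_dx: "(LINT z:Omega|lborel. \<phi>x z) = (LINT t:{0..}|lborel. \<phi> (t, 0))"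
proof -
  have "integrable lborel (\<lambda>z. indicator Omega z *\<^sub>R \<phi>x z)"
    using cc_on_set_integrable[OF test_fn_cc_on(3)[OF test]] unfolding set_integrable_def by simp
  then have "(LINT z:Omega|lborel. \<phi>x z) = (LINT t|lborel. LINT x|lborel. indicator Omega (t, x) *\<^sub>R \<phi>x (t, x))"
    unfolding set_lebesgue_integral_def by (rule lborel_Fubini)
  also have "\<dots> = (LINT t|lborel. indicator {0<..} t *\<^sub>R (LINT x:{..<0}|lborel. \<phi>x (t, x)))"
    by (intro Bochner_Integration.integral_cong refl)
       (auto simp: set_lebesgue_integral_def Omega_def indicator_def intro!: Bochner_Integration.integral_cong)
  also have "\<dots> = (LINT t:{0<..}|lborel. \<phi> (t, 0))"
    unfolding set_lebesgue_integral_def[symmetric] slices ..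
  also have "\<dots> = (LINT t:{0..}|lborel. \<phi> (t, 0))"
    by (intro set_integral_greaterThan section_measurable continuous_intros)
  finally show ?thesis .
qed

lemma integral_Omega_dt: "(LINT z:Omega|lborel. \<phi>t z) = - (LINT x:{..<0}|lborel. \<phi> (0, x))"
proof -
  have "integrable lborel (\<lambda>z. indicator Omega z *\<^sub>R \<phi>t z)"
    using cc_on_set_integrable[OF test_fn_cc_on(2)[OF test]] unfolding set_integrable_def by simp
  then have "(LINT z:Omega|lborel. \<phi>t z) = (LINT x|lborel. LINT t|lborel. indicator Omega (t, x) *\<^sub>R \<phi>t (t, x))"
    unfolding set_lebesgue_integral_def by (rule lborel_Fubini)
  also have "\<dots> = (LINT x|lborel. indicator {..<0} x *\<^sub>R (LINT t:{0<..}|lborel. \<phi>t (t, x)))"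
    by (intro Bochner_Integration.integral_cong refl)
       (auto simp: set_lebesgue_integral_def Omega_def indicator_def intro!: Bochner_Integration.integral_cong)
  also have "\<dots> = - (LINT x:{..<0}|lborel. \<phi> (0, x))"
    unfolding slices(3) unfolding set_lebesgue_integral_def by (simp flip: Bochner_Integration.integral_minus)
  finally show ?thesis .
qed

text \<open>Integrating in \<open>x\<close> first, each time slice is the interval from the shock to
  the piston, so a boundary term survives at both ends.\<close>

lemma integral_behind_dx:
  assumes "w > 0"
  shows "(LINT z:behind w|lborel. \<phi>x z)
    = (LINT t:{0..}|lborel. \<phi> (t, 0)) - (LINT t:{0..}|lborel. \<phi> (t, - w * t))"
proof -
  have "integrable lborel (\<lambda>z. indicator (behind w) z *\<^sub>R \<phi>x z)"
    using cc_on_set_integrable[OF test_fn_cc_on(3)[OF test]] unfolding set_integrable_def by simp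
  then have "(LINT z:behind w|lborel. \<phi>x z) = (LINT t|lborel. LINT x|lborel. indicator (behind w) (t, x) *\<^sub>R \<phi>x (t, x))"
    unfolding set_lebesgue_integral_def by (rule lborel_Fubini)
  also have "\<dots> = (LINT t|lborel. indicator {0<..} t *\<^sub>R (LINT x:{- w * t..<0}|lborel. \<phi>x (t, x)))"
    by (intro Bochner_Integration.integral_cong refl)
       (auto simp: set_lebesgue_integral_def behind_def indicator_def intro!: Bochner_Integration.integral_cong)
  also have "\<dots> = (LINT t:{0<..}|lborel. \<phi> (t, 0) - \<phi> (t, - w * t))"
    unfolding set_lebesgue_integral_def[of _ "{0<..}"] using assms
    by (intro Bochner_Integration.integral_cong refl) (auto simp: indicator_def slices)
  also have "\<dots> = (LINT t:{0..}|lborel. \<phi> (t, 0) - \<phi> (t, - w * t))"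
    by (intro set_integral_greaterThan borel_measurable_diff section_measurable continuous_intros)
  also have "\<dots> = (LINT t:{0..}|lborel. \<phi> (t, 0)) - (LINT t:{0..}|lborel. \<phi> (t, - w * t))"
    by (intro set_integral_diff section_set_integrable continuous_intros)
  finally show ?thesis .
qed

text \<open>Integrating in \<open>t\<close> first, the slice at \<open>x < 0\<close> is the ray
  \<open>t \<ge> - x / w\<close>, and only its endpoint on the shock contributes. The substitution
  \<open>x = - w * t\<close> then parametrises the shock line by time, and its Jacobian is the
  factor \<open>w\<close>.\<close>

lemma integral_behind_dt:
  assumes "w > 0"
  shows "(LINT z:behind w|lborel. \<phi>t z) = - w * (LINT t:{0..}|lborel. \<phi> (t, - w * t))"
proof -
  have "integrable lborel (\<lambda>z. indicator (behind w) z *\<^sub>R \<phi>t z)"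
    using cc_on_set_integrable[OF test_fn_cc_on(2)[OF test]] unfolding set_integrable_def by simp
  then have "(LINT z:behind w|lborel. \<phi>t z) = (LINT x|lborel. LINT t|lborel. indicator (behind w) (t, x) *\<^sub>R \<phi>t (t, x))"
    unfolding set_lebesgue_integral_def by (rule lborel_Fubini)
  also have "\<dots> = (LINT x|lborel. indicator {..<0} x *\<^sub>R (LINT t:{- x / w..}|lborel. \<phi>t (t, x)))"
  proof (intro Bochner_Integration.integral_cong refl)
    fix x
    have "indicator (behind w) (t, x) = (indicator {..<0} x * indicator {- x / w..} t :: real)" for t
    proof (cases "x < 0")
      case True
      then have "0 < - x / w" using assms by (simp add: divide_neg_pos)
      moreover have "- w * t \<le> x \<longleftrightarrow> - x / w \<le> t"
        using assms by (auto simp: field_simps)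
      ultimately have "(t, x) \<in> behind w \<longleftrightarrow> - x / w \<le> t"
        using True by (auto simp: behind_def)
      then show ?thesis using True by (simp add: indicator_def)
    qed (simp add: behind_def)
    then show "(LINT t|lborel. indicator (behind w) (t, x) *\<^sub>R \<phi>t (t, x))
        = indicator {..<0} x *\<^sub>R (LINT t:{- x / w..}|lborel. \<phi>t (t, x))"
      by (simp add: set_lebesgue_integral_def mult.assoc)
  qed
  also have "\<dots> = (LINT x|lborel. indicator {..<0} x * - \<phi> (- x / w, x))"
    unfolding slices by simp
  also have "\<dots> = w * (LINT t|lborel. indicator {..<0} (- w * t) * - \<phi> (- (- w * t) / w, - w * t))"
    using assms by (subst lborel_integral_real_affine[of "- w" _ 0]) auto
  also have "\<dots> = w * (LINT t:{0<..}|lborel. - \<phi> (t, - w * t))"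
    unfolding set_lebesgue_integral_def using assms
    by (intro arg_cong[where f="\<lambda>y. w * y"] Bochner_Integration.integral_cong refl)
       (auto simp: indicator_def zero_less_mult_iff)
  also have "(LINT t:{0<..}|lborel. - \<phi> (t, - w * t)) = (LINT t:{0..}|lborel. - \<phi> (t, - w * t))"
    by (intro set_integral_greaterThan borel_measurable_uminus section_measurable continuous_intros)
  also have "w * \<dots> = - w * (LINT t:{0..}|lborel. \<phi> (t, - w * t))"
    by (simp add: set_lebesgue_integral_def)
  finally show ?thesis .
qed

end

text \<open>One dominating function works for every \<open>w\<close> at once: the support of
  \<open>\<psi>\<close> confines \<open>t\<close> to \<open>[0, R]\<close>, and in
  \<open>behind 1\<close> this forces \<open>y\<close> into \<open>[- R, 0]\<close>. The uniformity
  extends to \<open>w = 0\<close>, where the rescaled layer would otherwise offer no bound in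
  \<open>y\<close>.\<close>

lemma behind_scaled_integrable:
  assumes "cc_on UNIV \<psi>"
  shows "integrable lborel (\<lambda>z. indicator (behind 1) z * \<psi> (fst z, w * snd z))"
    and behind_scaled_bound: "\<exists>g. integrable lborel g \<and>
      (\<forall>w z. \<bar>indicator (behind 1) z * \<psi> (fst z, w * snd z)\<bar> \<le> g z)"
    and behind_scaled_measurable:
      "(\<lambda>z. indicator (behind 1) z * \<psi> (fst z, w * snd z)) \<in> borel_measurable borel"
proof -
  obtain R B where R: "R > 0" "\<And>z. \<bar>\<psi> z\<bar> \<le> B" "\<And>z. norm z > R \<Longrightarrow> \<psi> z = 0"
    using cc_onE[OF assms] by metis
  define g :: "real \<times> real \<Rightarrow> real" where "g = (\<lambda>z. indicator (cbox (0, - R) (R, 0)) z * B)"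
  have g: "integrable lborel g"
    unfolding g_def using emeasure_lborel_cbox_finite
    by (intro integrable_mult_left integrable_real_indicator) auto
  have b: "\<bar>indicator (behind 1) z * \<psi> (fst z, w * snd z)\<bar> \<le> g z" for w z
  proof (cases "z \<in> behind 1 \<and> fst z \<le> R")
    case True
    then have "z \<in> cbox (0, - R) (R, 0)"
      by (cases z) (auto simp: behind_def cbox_Pair_eq)
    then show ?thesis using R(2) True by (simp add: g_def)
  next
    case False
    have "\<psi> (fst z, w * snd z) = 0" if "fst z > R"
      using R(3)[of "(fst z, w * snd z)"] norm_fst_le[of "fst z" "w * snd z"] that by fastforce
    moreover have "g z \<ge> 0" using R(2)[of z] by (simp add: g_def)
    ultimately show ?thesis using False by (auto simp: indicator_def)
  qed
  show "\<exists>g. integrable lborel g \<and> (\<forall>w z. \<bar>indicator (behind 1) z * \<psi> (fst z, w * snd z)\<bar> \<le> g z)"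
    using g b by blast
  have "continuous_on UNIV (\<lambda>z. \<psi> (fst z, w * snd z))"
    by (rule continuous_on_compose2[OF cc_on_continuous[OF assms, of UNIV]]) (auto intro!: continuous_intros)
  then have m: "(\<lambda>z. \<psi> (fst z, w * snd z)) \<in> borel_measurable borel"
    by (rule borel_measurable_continuous_onI)
  then show mm: "(\<lambda>z. indicator (behind 1) z * \<psi> (fst z, w * snd z)) \<in> borel_measurable borel"
    by measurable
  show "integrable lborel (\<lambda>z. indicator (behind 1) z * \<psi> (fst z, w * snd z))"
    by (rule Bochner_Integration.integrable_bound[OF g]) (use mm b abs_ge_self order_trans in \<open>auto intro!: AE_I2, blast\<close>)
qed

text \<open>The function \<open>H\<close> of the overview. It is not divided by an area; the word
  mean refers to averaging \<open>\<psi>\<close> over the rescaled thickness of the layer.\<close>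

definition layer_mean :: "(real \<times> real \<Rightarrow> real) \<Rightarrow> real \<Rightarrow> real" where
  "layer_mean \<psi> w = (LINT z:behind 1|lborel. \<psi> (fst z, w * snd z))"

lemma integral_behind_eq:
  assumes "cc_on UNIV \<psi>" "w > 0"
  shows "(LINT z:behind w|lborel. \<psi> z) = w * layer_mean \<psi> w"
proof -
  have "integrable lborel (\<lambda>z. indicator (behind w) z *\<^sub>R \<psi> z)"
    using cc_on_set_integrable[OF assms(1)] unfolding set_integrable_def by simp
  then have "(LINT z:behind w|lborel. \<psi> z) = (LINT t|lborel. LINT x|lborel. indicator (behind w) (t, x) *\<^sub>R \<psi> (t, x))"
    unfolding set_lebesgue_integral_def by (rule lborel_Fubini)
  also have "\<dots> = (LINT t|lborel. w * (LINT y|lborel. indicator (behind 1) (t, y) * \<psi> (t, w * y)))"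
  proof (intro Bochner_Integration.integral_cong refl)
    fix t
    have "(LINT x|lborel. indicator (behind w) (t, x) *\<^sub>R \<psi> (t, x))
        = w * (LINT y|lborel. indicator (behind w) (t, w * y) *\<^sub>R \<psi> (t, w * y))"
      using assms(2) by (subst lborel_integral_real_affine[of w _ 0]) auto
    moreover have "indicator (behind w) (t, w * y) = (indicator (behind 1) (t, y) :: real)" for y
    proof -
      have "- w * t \<le> w * y \<longleftrightarrow> - t \<le> y"
        using assms(2) mult_le_cancel_left_pos[of w "- t" y] by simp
      then show ?thesis
        using assms(2) by (auto simp: behind_def indicator_def mult_less_0_iff)
    qed
    ultimately show "(LINT x|lborel. indicator (behind w) (t, x) *\<^sub>R \<psi> (t, x))
        = w * (LINT y|lborel. indicator (behind 1) (t, y) * \<psi> (t, w * y))" by simp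
  qed
  also have "\<dots> = w * layer_mean \<psi> w"
    unfolding layer_mean_def set_lebesgue_integral_def
    using lborel_Fubini(1)[OF behind_scaled_integrable(1)[OF assms(1), of w]] by simp
  finally show ?thesis .
qed

text \<open>At \<open>w = 0\<close> the integrand no longer depends on \<open>y\<close>, and the
  slice of \<open>behind 1\<close> at time \<open>t\<close> has length \<open>t\<close>. This is the
  origin of the weight \<open>t\<close> in the limiting Dirac measure.\<close>

lemma layer_mean_0:
  assumes "cc_on UNIV \<psi>"
  shows "layer_mean \<psi> 0 = (LINT t:{0..}|lborel. t * \<psi> (t, 0))"
proof -
  have "layer_mean \<psi> 0 = (LINT t|lborel. LINT y|lborel. indicator (behind 1) (t, y) * \<psi> (t, 0))"
    unfolding layer_mean_def set_lebesgue_integral_def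
    using lborel_Fubini(1)[OF behind_scaled_integrable(1)[OF assms(1), of 0]] by simp
  also have "\<dots> = (LINT t:{0..}|lborel. t * \<psi> (t, 0))"
    unfolding set_lebesgue_integral_def
  proof (intro Bochner_Integration.integral_cong refl)
    fix t :: real
    \<comment> \<open>At \<open>t = 0\<close> the interval \<open>{- t..<0}\<close> is empty, so the
      closed half-line may replace the condition \<open>t > 0\<close>.\<close>
    have "indicator (behind 1) (t, y) = (indicator {0..} t * indicator {- t..<0} y :: real)" for y
      by (auto simp: behind_def indicator_def)
    then have "(LINT y|lborel. indicator (behind 1) (t, y) * \<psi> (t, 0))
        = (LINT y|lborel. indicator {- t..<0} y * (indicator {0..} t * \<psi> (t, 0)))"
      by (simp add: mult_ac)
    also have "\<dots> = indicator {0..} t *\<^sub>R (t * \<psi> (t, 0))"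
      by (cases "t \<ge> 0") auto
    finally show "(LINT y|lborel. indicator (behind 1) (t, y) * \<psi> (t, 0)) = indicator {0..} t *\<^sub>R (t * \<psi> (t, 0))" .
  qed
  finally show ?thesis .
qed

lemma isCont_layer_mean:
  assumes "cc_on UNIV \<psi>"
  shows "isCont (layer_mean \<psi>) w"
  unfolding continuous_at_sequentially comp_def layer_mean_def set_lebesgue_integral_def
proof (intro allI impI)
  fix v :: "nat \<Rightarrow> real" assume v: "v \<longlonglongrightarrow> w"
  obtain g where g: "integrable lborel g"
    "\<And>w z. \<bar>indicator (behind 1) z * \<psi> (fst z, w * snd z)\<bar> \<le> g z"
    using behind_scaled_bound[OF assms] by blast
  show "(\<lambda>n. LINT z|lborel. indicator (behind 1) z *\<^sub>R \<psi> (fst z, v n * snd z))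
    \<longlonglongrightarrow> (LINT z|lborel. indicator (behind 1) z *\<^sub>R \<psi> (fst z, w * snd z))"
  proof (rule integral_dominated_convergence[OF _ _ g(1)])
    have "(\<lambda>n. \<psi> (fst z, v n * snd z)) \<longlonglongrightarrow> \<psi> (fst z, w * snd z)" for z
    proof (rule isCont_tendsto_compose[of _ \<psi>])
      show "isCont \<psi> (fst z, w * snd z)"
        using cc_on_continuous[OF assms, of UNIV] by (simp add: continuous_on_eq_continuous_at)
    qed (intro tendsto_intros v)
    then show "AE z in lborel. (\<lambda>n. indicator (behind 1) z *\<^sub>R \<psi> (fst z, v n * snd z))
        \<longlonglongrightarrow> indicator (behind 1) z *\<^sub>R \<psi> (fst z, w * snd z)"
      by (intro AE_I2 tendsto_intros)
  qed (use behind_scaled_measurable[OF assms] g(2) in auto)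
qed

section \<open>Measures on the quarter plane\<close>

lemma null_measure_borelI:
  assumes "sets M = sets borel" "emeasure M UNIV = 0"
  shows "M = null_measure borel"
proof (rule measure_eqI)
  show "emeasure M A = emeasure (null_measure borel) A" if "A \<in> sets M" for A
  proof -
    have "emeasure M A \<le> emeasure M UNIV"
      using assms(1) by (intro emeasure_mono) auto
    then show ?thesis using assms(2) by simp
  qed
qed (use assms in simp)

section \<open>The sum of two Borel measures and its integral\<close>

lemma sets_add_measure [simp]: "sets (add_measure M N) = sets borel"
  and space_add_measure [simp]: "space (add_measure M N) = UNIV"
  unfolding add_measure_def
  using sets.space_closed[of borel] sets.sigma_sets_eq[of borel]
  by (simp_all add: sets_measure_of space_measure_of)

lemma measurable_add_measure [simp]: "borel_measurable (add_measure M N) = borel_measurable borel"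
  by (rule measurable_cong_sets) auto

text \<open>\<open>measure_of\<close> realises the prescribed set function only if that function is
  a measure, and falls back to zero otherwise. Countable additivity must therefore be established
  before any value of \<open>add_measure\<close> is available.\<close>

lemma emeasure_add_measure:
  assumes "sets M = sets borel" "sets N = sets borel" "A \<in> sets borel"
  shows "emeasure (add_measure M N) A = emeasure M A + emeasure N A"
proof (rule emeasure_measure_of[OF add_measure_def])
  show "countably_additive (sets (add_measure M N)) (\<lambda>A. emeasure M A + emeasure N A)"
  proof (rule countably_additiveI)
    fix A :: "nat \<Rightarrow> (real \<times> real) set"
    assume A: "range A \<subseteq> sets (add_measure M N)" "disjoint_family A"
    then have "(\<Sum>i. emeasure M (A i)) = emeasure M (\<Union>i. A i)"
      "(\<Sum>i. emeasure N (A i)) = emeasure N (\<Union>i. A i)"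
      using assms by (auto intro!: suminf_emeasure)
    then show "(\<Sum>i. emeasure M (A i) + emeasure N (A i)) = emeasure M (\<Union>i. A i) + emeasure N (\<Union>i. A i)"
      by (simp add: suminf_add[symmetric])
  qed
qed (use assms in \<open>auto simp: positive_def\<close>)

lemma nn_integral_add_measure:
  assumes M: "sets M = sets borel" and N: "sets N = sets borel" and f: "f \<in> borel_measurable borel"
  shows "(\<integral>\<^sup>+z. f z \<partial>add_measure M N) = (\<integral>\<^sup>+z. f z \<partial>M) + (\<integral>\<^sup>+z. f z \<partial>N)"
proof -
  have [measurable_cong]: "sets M = sets borel" "sets N = sets borel" "sets (add_measure M N) = sets borel"
    using M N by simp_all
  show ?thesis
    using f
  proof (induction rule: borel_measurable_induct)
    case (cong f g)
    then have "f = g" by auto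
    then show ?case using cong by simp
  next
    case (set A)
    then show ?case by (simp add: emeasure_add_measure M N)
  next
    case (mult u c)
    note mult(2)[measurable]
    show ?case by (simp add: nn_integral_cmult mult distrib_left)
  next
    case (add u v)
    note add(1)[measurable] add(3)[measurable]
    note [measurable] = add.hyps
    show ?case by (simp add: nn_integral_add add add_ac)
  next
    case (seq U)
    note seq(1)[measurable]
    have sup: "(\<integral>\<^sup>+z. (SUP i. U i z) \<partial>L) = (SUP i. \<integral>\<^sup>+z. U i z \<partial>L)"
      if "sets L = sets borel" for L
      using seq that by (intro nn_integral_monotone_convergence_SUP) (auto cong: measurable_cong_sets)
    have mono: "incseq (\<lambda>i. \<integral>\<^sup>+z. U i z \<partial>L)" for L
      using seq by (auto simp: incseq_def le_fun_def intro!: nn_integral_mono)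
    have "(SUP i. U i) = (\<lambda>z. SUP i. U i z)" by (auto simp: image_comp)
    then show ?case
      using seq by (simp add: sup M N ennreal_SUP_add[OF mono mono, symmetric])
  qed
qed

lemma integral_add_measure:
  fixes f :: "real \<times> real \<Rightarrow> real"
  assumes M: "sets M = sets borel" and N: "sets N = sets borel"
    and f: "integrable M f" "integrable N f"
  shows "integrable (add_measure M N) f"
    and "(\<integral>z. f z \<partial>add_measure M N) = (\<integral>z. f z \<partial>M) + (\<integral>z. f z \<partial>N)"
proof -
  have [measurable]: "f \<in> borel_measurable borel"
    using borel_measurable_integrable[OF f(1)] measurable_cong_sets[OF M refl] by blast
  have *: "(\<integral>\<^sup>+z. ennreal (g z) \<partial>add_measure M N) = (\<integral>\<^sup>+z. ennreal (g z) \<partial>M) + (\<integral>\<^sup>+z. ennreal (g z) \<partial>N)"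
    if "g \<in> borel_measurable borel" for g :: "real \<times> real \<Rightarrow> real"
    using that by (intro nn_integral_add_measure M N) measurable
  show i: "integrable (add_measure M N) f"
    using f * by (simp add: integrable_iff_bounded)
  have fin: "(\<integral>\<^sup>+z. ennreal (f z) \<partial>L) < \<infinity>" "(\<integral>\<^sup>+z. ennreal (- f z) \<partial>L) < \<infinity>"
    if "integrable L f" for L
    using that real_integrable_def[of L f] by (auto simp: less_top)
  show "(\<integral>z. f z \<partial>add_measure M N) = (\<integral>z. f z \<partial>M) + (\<integral>z. f z \<partial>N)"
    using fin[OF f(1)] fin[OF f(2)]
    by (simp add: real_lebesgue_integral_def f i * enn2real_plus)
qed

text \<open>Every density in the two families of solutions is nonnegative on \<open>Omega\<close>.
  The negative Jordan part is then the null measure, and each clause about signed measures becomes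
  one about the first component.\<close>

lemma lmeas_eq:
  assumes "\<forall>z\<in>Omega. f z \<ge> 0"
  shows "lmeas f = (density lborel (\<lambda>z. ennreal (indicator Omega z * f z)), null_measure borel)"
proof -
  have "ennreal (- (indicator Omega z * f z)) = 0" for z
    using assms by (auto simp: indicator_def ennreal_neg)
  then have "density lborel (\<lambda>z. ennreal (- (indicator Omega z * f z))) = null_measure borel"
    by (intro null_measure_borelI) (simp_all add: emeasure_density)
  then show ?thesis by (simp add: lmeas_def)
qed

lemma pmeas_eq:
  assumes "\<forall>t\<ge>0. v t \<ge> 0"
  shows "pmeas v = (distr (density lborel (\<lambda>t. ennreal (indicator {0..} t * v t))) borel (\<lambda>t. (t, 0)), null_measure borel)"
proof -
  have m: "(\<lambda>t :: real. (t, 0 :: real)) \<in> borel_measurable borel"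
    by (intro borel_measurable_continuous_onI continuous_intros)
  have "ennreal (- (indicator {0..} t * v t)) = 0" for t
    using assms by (auto simp: indicator_def ennreal_neg)
  then have "distr (density lborel (\<lambda>t. ennreal (- (indicator {0..} t * v t)))) borel (\<lambda>t :: real. (t, 0 :: real)) = null_measure borel"
    by (intro null_measure_borelI) (use m in \<open>simp_all add: emeasure_density emeasure_distr\<close>)
  then show ?thesis by (simp add: pmeas_def)
qed

lemma sadd_eq:
  "sadd (M, null_measure borel) (N, null_measure borel) = (add_measure M N, null_measure borel)"
  unfolding sadd_def by (auto intro!: null_measure_borelI simp: emeasure_add_measure)

lemma pair_lmeas:
  assumes [measurable]: "f \<in> borel_measurable borel" "\<phi> \<in> borel_measurable borel"
    and "\<forall>z\<in>Omega. f z \<ge> 0"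
  shows "pair (lmeas f) \<phi> = (LINT z:Omega|lborel. f z * \<phi> z)"
proof -
  have "AE z in lborel. 0 \<le> indicator Omega z * f z"
    using assms(3) by (auto simp: indicator_def)
  then show ?thesis
    unfolding pair_def lmeas_eq[OF assms(3)] set_lebesgue_integral_def
    by (simp add: integral_density mult.assoc)
qed

text \<open>The empty set witnesses mutual singularity: the first measure gives it mass 0, and the
  null measure gives mass 0 to its complement.\<close>

lemma sradonI: "radon (fst \<mu>) \<Longrightarrow> snd \<mu> = null_measure borel \<Longrightarrow> sradon \<mu>"
  unfolding sradon_def by (auto simp: radon_def intro!: bexI[of _ "{}"])

lemma radon_density_Omega:
  assumes [measurable]: "f \<in> borel_measurable borel"
    and f: "\<forall>z\<in>Omega. f z \<le> B"
  shows "radon (density lborel (\<lambda>z. ennreal (indicator Omega z * f z)))"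
  unfolding radon_def
proof (intro conjI allI impI)
  fix K :: "(real \<times> real) set" assume K: "compact K"
  then have [measurable]: "K \<in> sets borel" by (simp add: compact_imp_closed)
  have "emeasure (density lborel (\<lambda>z. ennreal (indicator Omega z * f z))) K
      = (\<integral>\<^sup>+z. ennreal (indicator Omega z * f z) * indicator K z \<partial>lborel)"
    by (simp add: emeasure_density)
  also have "\<dots> \<le> (\<integral>\<^sup>+z. ennreal B * indicator K z \<partial>lborel)"
    using f by (intro nn_integral_mono mult_right_mono) (auto simp: indicator_def ennreal_leI)
  also have "\<dots> = ennreal B * emeasure lborel K"
    by (simp add: nn_integral_cmult)
  also have "\<dots> < \<infinity>"
    using emeasure_compact_finite[OF K] by (simp add: ennreal_mult_less_top)
  finally show "emeasure (density lborel (\<lambda>z. ennreal (indicator Omega z * f z))) K < \<infinity>" .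
qed simp

lemma sradon_lmeas:
  assumes "f \<in> borel_measurable borel" "\<forall>z\<in>Omega. 0 \<le> f z" "\<forall>z\<in>Omega. f z \<le> B"
  shows "sradon (lmeas f)"
  using radon_density_Omega[OF assms(1,3)] by (intro sradonI) (simp_all add: lmeas_eq[OF assms(2)])

lemma supported_in_lmeas:
  assumes [measurable]: "f \<in> borel_measurable borel" and "\<forall>z\<in>Omega. 0 \<le> f z"
  shows "supported_in (lmeas f) (closure Omega)"
proof -
  have "- closure Omega \<in> sets borel" by auto
  moreover have "ennreal (indicator Omega z * f z) * indicator (- closure Omega) z = 0" for z
    using closure_subset[of Omega] by (cases "z \<in> Omega") auto
  ultimately show ?thesis
    unfolding supported_in_def lmeas_eq[OF assms(2)]
    by (simp add: emeasure_density nn_integral_0_iff_AE)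
qed

lemma null_density_Omega_iff:
  assumes [measurable]: "f \<in> borel_measurable borel" "A \<in> sets borel"
    and f: "\<forall>z\<in>Omega. 0 \<le> f z"
  shows "emeasure (density lborel (\<lambda>z. ennreal (indicator Omega z * f z))) A = 0
    \<longleftrightarrow> (AE z in lborel. z \<in> A \<inter> Omega \<longrightarrow> f z = 0)"
proof -
  have "emeasure (density lborel (\<lambda>z. ennreal (indicator Omega z * f z))) A = 0
    \<longleftrightarrow> (AE z in lborel. ennreal (indicator Omega z * f z) * indicator A z = 0)"
    by (simp add: emeasure_density nn_integral_0_iff_AE)
  also have "\<dots> \<longleftrightarrow> (AE z in lborel. z \<in> A \<inter> Omega \<longrightarrow> f z = 0)"
  proof (rule AE_cong)
    fix z show "(ennreal (indicator Omega z * f z) * indicator A z = 0) = (z \<in> A \<inter> Omega \<longrightarrow> f z = 0)"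
      using f by (auto simp: indicator_def ennreal_eq_0_iff)
  qed
  finally show ?thesis .
qed

lemma abs_cont_lmeas:
  assumes "f \<in> borel_measurable borel" "g \<in> borel_measurable borel"
    and "\<forall>z\<in>Omega. 0 \<le> f z" "\<forall>z\<in>Omega. 0 \<le> g z"
    and "\<forall>z\<in>Omega. g z = 0 \<longrightarrow> f z = 0"
  shows "abs_cont (lmeas f) (lmeas g)"
  using assms(5)
  unfolding abs_cont_def lmeas_eq[OF assms(3)] lmeas_eq[OF assms(4)] fst_conv snd_conv
  by (auto simp: null_density_Omega_iff assms elim: AE_mp)

lemma set_integrable_bounded:
  fixes f :: "real \<times> real \<Rightarrow> real"
  assumes [measurable]: "f \<in> borel_measurable borel" and K: "compact K" and f: "\<And>z. \<bar>f z\<bar> \<le> B"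
  shows "set_integrable lborel K f"
  unfolding set_integrable_def
proof (rule Bochner_Integration.integrable_bound)
  have [measurable]: "K \<in> sets borel" using K by (simp add: compact_imp_closed)
  show "integrable lborel (\<lambda>z. indicator K z * B)"
    using emeasure_compact_finite[OF K] by (intro integrable_mult_left integrable_real_indicator) auto
  show "(\<lambda>z. indicator K z *\<^sub>R f z) \<in> borel_measurable lborel" by measurable
  show "AE z in lborel. norm (indicator K z *\<^sub>R f z) \<le> norm (indicator K z * B)"
    using f abs_ge_self order_trans by (intro AE_I2) (auto simp: indicator_def, blast)
qed

text \<open>Local integrability of \<open>h\<close> against the density \<open>g\<close> is local
  integrability of \<open>g * h\<close> against Lebesgue measure, hence the bound on the
  product.\<close>

lemma rn_deriv_is_lmeas:
  assumes [measurable]: "f \<in> borel_measurable borel" "g \<in> borel_measurable borel" "h \<in> borel_measurable borel"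
    and f: "\<forall>z\<in>Omega. 0 \<le> f z" and g: "\<forall>z\<in>Omega. 0 \<le> g z"
    and b: "\<And>z. \<bar>g z * h z\<bar> \<le> B"
    and eq: "\<forall>z\<in>Omega. f z = g z * h z"
  shows "rn_deriv_is (lmeas f) h (lmeas g)"
  unfolding rn_deriv_is_def
proof (intro conjI allI impI)
  have nn: "AE z in lborel. 0 \<le> indicator Omega z * g z"
    using g by (auto simp: indicator_def)
  fix K :: "(real \<times> real) set" assume K: "compact K"
  then have [measurable]: "K \<in> sets borel" by (simp add: compact_imp_closed)
  have "integrable lborel (\<lambda>z. indicator K z *\<^sub>R (indicator Omega z * (g z * h z)))"
    using b order_trans[OF abs_ge_zero b]
    by (intro set_integrable_bounded[OF _ K, unfolded set_integrable_def]) (auto simp: indicator_def)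
  then show "set_integrable (fst (lmeas g)) K h"
    unfolding lmeas_eq[OF g] set_integrable_def
    by (subst fst_conv, subst integrable_density[OF _ _ nn]) (simp_all add: mult_ac)
  show "set_integrable (snd (lmeas g)) K h"
    unfolding lmeas_eq[OF g] set_integrable_def by simp
next
  fix \<phi> assume "cc_on UNIV \<phi>"
  note cc_on_measurable[OF this, measurable]
  have "pair (lmeas g) (\<lambda>z. \<phi> z * h z) = (LINT z:Omega|lborel. g z * (\<phi> z * h z))"
    by (intro pair_lmeas g) measurable
  also have "\<dots> = pair (lmeas f) \<phi>"
    unfolding pair_lmeas[OF assms(1) \<open>\<phi> \<in> _\<close> f] by (intro set_lebesgue_integral_cong) (auto simp: eq)
  finally show "pair (lmeas f) \<phi> = (\<integral>z. \<phi> z * h z \<partial>fst (lmeas g)) - (\<integral>z. \<phi> z * h z \<partial>snd (lmeas g))"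
    by (simp add: pair_def)
qed

text \<open>The open set where \<open>\<phi>\<close> is positive contains a point of the closure of
  \<open>Omega\<close>, so it meets \<open>Omega\<close> in a nonempty open set, which has positive
  Lebesgue measure.\<close>

lemma integral_Omega_pos:
  fixes \<phi> :: "real \<times> real \<Rightarrow> real"
  assumes "z \<in> closure Omega" "\<phi> z > 0" "continuous_on UNIV \<phi>" "\<And>z. \<phi> z \<ge> 0" "integrable lborel \<phi>"
  shows "(LINT z:Omega|lborel. \<phi> z) > 0"
proof -
  define S where "S = Omega \<inter> {z. \<phi> z > 0}"
  have "open {z. \<phi> z > 0}"
    by (rule open_Collect_less[OF continuous_on_const assms(3)])
  then have "S \<noteq> {}" "open S"
    using assms(1,2) open_Omega closure_iff_nhds_not_empty[of z Omega] unfolding S_def by auto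
  then have pos: "emeasure lborel S \<noteq> 0"
    using open_not_negligible[of S] negligible_iff_null_sets[of S] null_sets_completionI[of S lborel]
    by (auto simp: null_sets_def)
  have [measurable]: "\<phi> \<in> borel_measurable borel"
    using assms(3) by (rule borel_measurable_continuous_onI)
  have i: "integrable lborel (\<lambda>z. indicator Omega z *\<^sub>R \<phi> z)"
    using assms(5) by (intro integrable_mult_indicator) auto
  have "(LINT z:Omega|lborel. \<phi> z) \<noteq> 0"
  proof
    assume "(LINT z:Omega|lborel. \<phi> z) = 0"
    then have "AE z in lborel. indicator Omega z *\<^sub>R \<phi> z = 0"
      using i assms(4) integral_nonneg_eq_0_iff_AE[of lborel "\<lambda>z. indicator Omega z *\<^sub>R \<phi> z"]
      by (simp add: set_lebesgue_integral_def)
    then have "AE z in lborel. z \<notin> S"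
      by eventually_elim (auto simp: S_def)
    then have "S \<in> null_sets lborel"
      using \<open>open S\<close> AE_iff_null_sets[of S lborel] by auto
    then show False using pos by auto
  qed
  moreover have "(LINT z:Omega|lborel. \<phi> z) \<ge> 0"
    unfolding set_lebesgue_integral_def using assms(4) by simp
  ultimately show ?thesis by simp
qed

section \<open>Determination of densities and one-sided limits\<close>

text \<open>Inner regularity: if the positive part of \<open>h\<close> has no mass on compact
  subsets of the set where \<open>h\<close> is positive, it has no mass on that set. A single
  application gives only the upper bound \<open>h z \<le> 0\<close>; equality comes from using the
  lemma for both signs.\<close>

lemma zero_AE_from_compact_integrals:
  fixes h :: "real \<times> real \<Rightarrow> real"
  assumes C: "compact C" and h: "set_integrable lborel C h"
    and K: "\<And>K. compact K \<Longrightarrow> K \<subseteq> C \<Longrightarrow> (LINT z:K|lborel. h z) = 0"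
  shows "AE z in lborel. z \<in> C \<longrightarrow> h z \<le> 0"
proof -
  define g where "g = (\<lambda>z. indicator C z * h z)"
  have C' [measurable]: "C \<in> sets borel" using C by (simp add: compact_imp_closed)
  have g: "integrable lborel g" using h by (simp add: g_def set_integrable_def)
  have [measurable]: "g \<in> borel_measurable borel"
    using borel_measurable_integrable[OF g] by simp
  \<comment> \<open>\<open>ennreal\<close> sends negative values to 0, so the density of
    \<open>M\<close> is the positive part of \<open>g\<close>.\<close>
  define M where "M = density lborel (\<lambda>z. ennreal (g z))"
  define P where "P = {z. g z > 0}"
  have P [measurable]: "P \<in> sets borel" unfolding P_def by measurable
  have "emeasure M K = 0" if "compact K" "K \<subseteq> P" for K
  proof -
    have KC: "K \<subseteq> C"
    proof
      fix z assume "z \<in> K"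
      then have "g z > 0" using that(2) by (auto simp: P_def)
      then show "z \<in> C" by (cases "z \<in> C") (auto simp: g_def)
    qed
    have [measurable]: "K \<in> sets borel" using that(1) by (simp add: compact_imp_closed)
    have i: "integrable lborel (\<lambda>z. indicator K z * g z)"
      using integrable_mult_indicator[OF _ g, of K] by simp
    have nn: "indicator K z * g z \<ge> 0" for z
      using that(2) by (auto simp: P_def indicator_def less_imp_le)
    have "emeasure M K = (\<integral>\<^sup>+z. ennreal (g z) * indicator K z \<partial>lborel)"
      unfolding M_def by (simp add: emeasure_density)
    also have "\<dots> = (\<integral>\<^sup>+z. ennreal (indicator K z * g z) \<partial>lborel)"
      by (intro nn_integral_cong) (auto simp: indicator_def)
    also have "\<dots> = ennreal (LINT z|lborel. indicator K z * g z)"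
      using i nn by (intro nn_integral_eq_integral) auto
    also have "(LINT z|lborel. indicator K z * g z) = (LINT z:K|lborel. h z)"
      unfolding set_lebesgue_integral_def using KC
      by (intro Bochner_Integration.integral_cong) (auto simp: g_def indicator_def)
    finally show ?thesis using K[OF that(1) KC] by simp
  qed
  moreover have "emeasure M (space M) \<noteq> \<infinity>"
  proof -
    have "emeasure M (space M) = (\<integral>\<^sup>+z. ennreal (g z) \<partial>lborel)"
      unfolding M_def by (simp add: emeasure_density)
    also have "\<dots> \<noteq> \<infinity>" using g unfolding real_integrable_def by simp
    finally show ?thesis .
  qed
  then have "emeasure M P = (SUP K \<in> {K. K \<subseteq> P \<and> compact K}. emeasure M K)"
    by (intro inner_regular P) (simp add: M_def)
  ultimately have "emeasure M P = 0"
    by (simp add: SUP_eq_iff) (auto intro!: SUP_eq_const simp: bot_ennreal)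
  then have "AE z in lborel. ennreal (g z) * indicator P z = 0"
    unfolding M_def by (simp add: emeasure_density nn_integral_0_iff_AE)
  then show ?thesis
    by eventually_elim (auto simp: P_def g_def indicator_def ennreal_eq_0_iff split: if_splits)
qed

text \<open>The indicator of \<open>K\<close> is the pointwise limit of cutoff functions whose
  supports lie in one compact neighbourhood \<open>L\<close> of \<open>K\<close> inside
  \<open>V\<close>. There \<open>h\<close> is integrable, so dominated convergence carries the
  vanishing integrals over to \<open>K\<close>.\<close>

lemma compact_integral_from_cc_on:
  fixes h :: "real \<times> real \<Rightarrow> real"
  assumes V: "open V" and int: "\<And>K. compact K \<Longrightarrow> K \<subseteq> V \<Longrightarrow> set_integrable lborel K h"
    and test: "\<And>\<phi>. cc_on V \<phi> \<Longrightarrow> (LINT z|lborel. h z * \<phi> z) = 0"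
    and K: "compact K" "K \<subseteq> V"
  shows "(LINT z:K|lborel. h z) = 0"
\<comment> \<open>The empty set is separated because \<open>infdist\<close> to it is 0 by
  convention, so that the cutoff functions would be constantly 1.\<close>
proof (cases "K = {}")
  case False
  obtain \<epsilon> where e: "\<epsilon> > 0" "{x. infdist x K \<le> \<epsilon>} \<subseteq> V"
    using compact_in_open_separated[OF False K(1) V K(2)] by blast
  define L where "L = {x. infdist x K \<le> \<epsilon>}"
  have L: "compact L" "L \<subseteq> V" "K \<subseteq> L"
    using compact_infdist_le[OF False K(1) e(1)] e unfolding L_def by auto
  \<comment> \<open>The slope \<open>Suc n / \<epsilon>\<close> is at least
    \<open>1 / \<epsilon>\<close>, which makes every member vanish outside \<open>L\<close>; with
    \<open>n\<close> in place of \<open>Suc n\<close> the member for 0 would be constantly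
    1.\<close>
  define f :: "nat \<Rightarrow> real \<times> real \<Rightarrow> real" where "f n z = max 0 (1 - real (Suc n) / \<epsilon> * infdist z K)" for n z
  have f01: "0 \<le> f n z" "f n z \<le> 1" for n z
    using e(1) infdist_nonneg[of z K] by (auto simp: f_def)
  have fc: "continuous_on UNIV (f n)" for n
    unfolding f_def by (intro continuous_intros)
  have fL: "f n z = 0" if "z \<notin> L" for n z
  proof -
    have "1 < infdist z K / \<epsilon>" using that e(1) by (simp add: L_def)
    also have "\<dots> \<le> real (Suc n) * (infdist z K / \<epsilon>)"
      using e(1) infdist_nonneg[of z K] mult_right_mono[of 1 "real (Suc n)" "infdist z K / \<epsilon>"] by simp
    finally show ?thesis by (simp add: f_def)
  qed
  have "cc_on V (f n)" for n
    unfolding cc_on_def using fc L fL by blast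
  then have z: "(LINT z|lborel. h z * f n z) = 0" for n by (rule test)
  have eq: "h z * f n z = (indicator L z * h z) * f n z" for n z
    using fL[of z n] by (auto simp: indicator_def)
  have hL: "integrable lborel (\<lambda>z. indicator L z * h z)"
    using int[OF L(1,2)] by (simp add: set_integrable_def)
  then have hLm [measurable]: "(\<lambda>z. indicator L z * h z) \<in> borel_measurable lborel" by simp
  have Kb [measurable]: "K \<in> sets borel" using K(1) by (simp add: compact_imp_closed)
  have lim: "(\<lambda>n. f n z) \<longlonglongrightarrow> indicator K z" for z
  proof (cases "z \<in> K")
    case True then show ?thesis by (simp add: f_def)
  next
    case False
    then have d: "infdist z K > 0"
      using \<open>K \<noteq> {}\<close> K(1) in_closed_iff_infdist_zero[of K z] infdist_nonneg[of z K] compact_imp_closed by fastforce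
    obtain N where N: "real N > \<epsilon> / infdist z K" using reals_Archimedean2 by blast
    have "f n z = 0" if "n \<ge> N" for n
    proof -
      have "\<epsilon> / infdist z K < real (Suc n)" using N that by simp
      then have "1 < real (Suc n) / \<epsilon> * infdist z K"
        using d e(1) by (simp add: field_simps)
      then show ?thesis by (simp add: f_def)
    qed
    then have "eventually (\<lambda>n. f n z = indicator K z) sequentially"
      using False by (auto intro: eventually_sequentiallyI[of N])
    then show ?thesis by (rule tendsto_eventually)
  qed
  have fm [measurable]: "f n \<in> borel_measurable borel" for n
    using fc by (rule borel_measurable_continuous_onI)
  have "(\<lambda>n. LINT z|lborel. (indicator L z * h z) * f n z) \<longlonglongrightarrow> (LINT z|lborel. (indicator L z * h z) * indicator K z)"
  proof (rule integral_dominated_convergence[OF _ _ integrable_norm[OF hL]])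
    show "AE z in lborel. (\<lambda>n. (indicator L z * h z) * f n z) \<longlonglongrightarrow> (indicator L z * h z) * indicator K z"
      by (intro AE_I2 tendsto_intros lim)
    show "AE z in lborel. norm ((indicator L z * h z) * f n z) \<le> norm (indicator L z * h z)" for n
      using f01[of n] by (intro AE_I2) (simp add: abs_mult mult_left_le)
  qed measurable
  moreover have "(LINT z|lborel. (indicator L z * h z) * f n z) = 0" for n
    using z[of n] eq by simp
  ultimately have "(LINT z|lborel. (indicator L z * h z) * indicator K z) = 0"
    by (simp add: LIMSEQ_const_iff)
  moreover have "(indicator L z * h z) * indicator K z = indicator K z * h z" for z
    using L(3) by (auto simp: indicator_def)
  ultimately show ?thesis by (simp add: set_lebesgue_integral_def)
qed (simp add: set_lebesgue_integral_def)

text \<open>The fundamental lemma of the calculus of variations on an open set. \<open>V\<close> is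
  a countable union of closed boxes, on each of which \<open>f - g\<close> and \<open>g - f\<close>
  are nonpositive almost everywhere; countability keeps the union of the exceptional sets null. The
  global bound on \<open>g\<close> supplies its local integrability.\<close>

lemma AE_eq_from_cc_on:
  fixes f g :: "real \<times> real \<Rightarrow> real"
  assumes V: "open V" and f: "\<And>K. compact K \<Longrightarrow> K \<subseteq> V \<Longrightarrow> set_integrable lborel K f"
    and g: "g \<in> borel_measurable borel" "\<And>z. \<bar>g z\<bar> \<le> B"
    and test: "\<And>\<phi>. cc_on V \<phi> \<Longrightarrow> (LINT z|lborel. f z * \<phi> z) = (LINT z|lborel. g z * \<phi> z)"
  shows "AE z in lborel. z \<in> V \<longrightarrow> f z = g z"
proof -
  have g': "set_integrable lborel K g" if "compact K" for K
    using set_integrable_bounded[OF g(1) that g(2)] .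
  have mult: "integrable lborel (\<lambda>z. h z * \<phi> z)"
    if h: "\<And>K. compact K \<Longrightarrow> K \<subseteq> V \<Longrightarrow> set_integrable lborel K h" and cc: "cc_on V \<phi>"
    for h \<phi> :: "real \<times> real \<Rightarrow> real"
  proof -
    obtain K where K: "compact K" "K \<subseteq> V" "\<And>z. z \<notin> K \<Longrightarrow> \<phi> z = 0"
      using cc unfolding cc_on_def by blast
    obtain R C where C: "\<And>z. \<bar>\<phi> z\<bar> \<le> C" using cc_onE[OF cc] by metis
    have i: "integrable lborel (\<lambda>z. indicator K z * h z)"
      using h[OF K(1,2)] by (simp add: set_integrable_def)
    note m = borel_measurable_integrable[OF i] cc_on_measurable[OF cc]
    have eq: "(\<lambda>z. h z * \<phi> z) = (\<lambda>z. indicator K z * h z * \<phi> z)"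
      using K(3) by (intro ext) (metis indicator_simps(1,2) mult.left_neutral mult_zero_right)
    have "integrable lborel (\<lambda>z. indicator K z * h z * \<phi> z)"
    proof (rule Bochner_Integration.integrable_bound[OF integrable_mult_left[OF i, of C]])
      show "(\<lambda>z. indicator K z * h z * \<phi> z) \<in> borel_measurable lborel"
        using m(2) by (intro borel_measurable_times[OF m(1)]) simp
      have "\<bar>indicator K z * h z\<bar> * \<bar>\<phi> z\<bar> \<le> \<bar>indicator K z * h z\<bar> * \<bar>C\<bar>" for z
        using C[of z] by (intro mult_left_mono) auto
      then show "AE z in lborel. norm (indicator K z * h z * \<phi> z) \<le> norm (indicator K z * h z * C)"
        by (intro AE_I2) (simp add: abs_mult)
    qed
    then show ?thesis by (simp only: eq)
  qed
  have diff: "AE z in lborel. z \<in> V \<longrightarrow> h z \<le> 0"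
    if h: "\<And>K. compact K \<Longrightarrow> K \<subseteq> V \<Longrightarrow> set_integrable lborel K h"
      and h0: "\<And>\<phi>. cc_on V \<phi> \<Longrightarrow> (LINT z|lborel. h z * \<phi> z) = 0" for h
  proof -
    obtain D where D: "countable D" "D \<subseteq> Pow V" "\<And>X. X \<in> D \<Longrightarrow> \<exists>a b. X = cbox a b" "\<Union>D = V"
      using open_countable_Union_open_cbox[OF V] by blast
    have "AE z in lborel. z \<in> C \<longrightarrow> h z \<le> 0" if "C \<in> D" for C
    proof (rule zero_AE_from_compact_integrals)
      show C: "compact C" using D(3)[OF that] by auto
      show "set_integrable lborel C h" using D(2) that h[OF C] by auto
      show "(LINT z:K|lborel. h z) = 0" if "compact K" "K \<subseteq> C" for K
        using D(2) \<open>C \<in> D\<close> that by (intro compact_integral_from_cc_on[OF V h h0]) auto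
    qed
    then have "AE z in lborel. \<forall>C\<in>D. z \<in> C \<longrightarrow> h z \<le> 0"
      using D(1) by (subst AE_ball_countable) auto
    then show ?thesis using D(4) by (auto elim!: AE_mp)
  qed
  have "AE z in lborel. z \<in> V \<longrightarrow> f z - g z \<le> 0"
  proof (rule diff)
    show "set_integrable lborel K (\<lambda>z. f z - g z)" if "compact K" "K \<subseteq> V" for K
      using f[OF that] g'[OF that(1)] by (rule set_integral_diff)
    show "(LINT z|lborel. (f z - g z) * \<phi> z) = 0" if "cc_on V \<phi>" for \<phi>
      using test[OF that] mult[OF f that] mult[OF g' that] by (simp add: left_diff_distrib)
  qed
  moreover have "AE z in lborel. z \<in> V \<longrightarrow> g z - f z \<le> 0"
  proof (rule diff)
    show "set_integrable lborel K (\<lambda>z. g z - f z)" if "compact K" "K \<subseteq> V" for K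
      using g'[OF that(1)] f[OF that] by (rule set_integral_diff)
    show "(LINT z|lborel. (g z - f z) * \<phi> z) = 0" if "cc_on V \<phi>" for \<phi>
      using test[OF that] mult[OF f that] mult[OF g' that] by (simp add: left_diff_distrib)
  qed
  ultimately show ?thesis by eventually_elim auto
qed

text \<open>A homogeneous open cone contains balls of radius proportional to the distance from its apex, so
  a state attained on such a cone must be the approximate one-sided limit.\<close>

lemma approx_limit_eq_cone_state:
  fixes U :: "real \<times> real \<Rightarrow> state" and v :: "real \<times> real"
  assumes lim: "((\<lambda>r. (LINT z : ball z0 r \<inter> H | lborel. norm (U z - UL)) / r^2) \<longlongrightarrow> 0) (at_right 0)"
    and int: "set_integrable lborel (ball z0 R) (\<lambda>z. norm (U z - UL))" and R: "R > 0"
    and H: "H \<in> sets borel"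
    and v: "v \<in> Q" and Q: "open Q" "\<And>h c. h \<in> Q \<Longrightarrow> c > 0 \<Longrightarrow> c *\<^sub>R h \<in> Q"
    and QH: "\<And>h. h \<in> Q \<Longrightarrow> z0 + h \<in> H"
    and state: "AE z in lborel. z - z0 \<in> Q \<and> z \<in> ball z0 R \<longrightarrow> U z = A"
  shows "UL = A"
proof (rule ccontr)
  assume ne: "UL \<noteq> A"
  \<comment> \<open>A norm below \<open>1/2\<close> together with a radius
    \<open>k \<le> 1/2\<close> keeps the disc around \<open>v'\<close> in the unit disc. Scaled by
    \<open>r\<close> and moved to \<open>z0\<close>, it stays in \<open>ball z0 r\<close>.\<close>
  define v' where "v' = (1 / (2 * norm v + 1)) *\<^sub>R v"
  have np: "2 * norm v + 1 > 0" using norm_ge_zero[of v] by linarith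
  have v': "v' \<in> Q" using Q(2)[OF v] np by (simp add: v'_def)
  have nv': "norm v' < 1/2"
    using np by (simp add: v'_def field_simps)
  obtain k0 where k0: "k0 > 0" "ball v' k0 \<subseteq> Q"
    using Q(1) v' open_contains_ball by blast
  define k where "k = min k0 (1/2)"
  have k: "k > 0" "k \<le> 1/2" "ball v' k \<subseteq> Q" using k0 by (auto simp: k_def)
  \<comment> \<open>This is \<open>norm (A - UL)\<close> times the area of a disc of radius
    \<open>k\<close>. The scaled disc has radius \<open>r * k\<close>, so after division by
    \<open>r^2\<close> its contribution is \<open>c\<close> for every small \<open>r\<close>, which
    contradicts the limit 0.\<close>
  define c where "c = norm (A - UL) * (k^2 * measure lborel (ball (0 :: real \<times> real) 1))"
  have "measure lborel (ball (0 :: real \<times> real) 1) > 0" by (rule content_ball_pos) simp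
  then have c: "c > 0" using ne k(1) by (simp add: c_def)
  have bound: "c \<le> (LINT z : ball z0 r \<inter> H | lborel. norm (U z - UL)) / r^2" if r: "0 < r" "r < R" for r
  proof -
    define B where "B = ball (z0 + r *\<^sub>R v') (r * k)"
    have B: "z - z0 \<in> Q \<and> z \<in> ball z0 r \<and> z \<in> H" if "z \<in> B" for z
    proof -
      define h where "h = (1 / r) *\<^sub>R (z - z0)"
      have z: "z = z0 + r *\<^sub>R h" using r by (simp add: h_def)
      have "dist (z0 + r *\<^sub>R v') z = r * dist v' h"
        using r unfolding z dist_norm by (simp flip: scaleR_right_diff_distrib)
      then have hd: "dist v' h < k" using that r by (simp add: B_def)
      then have hQ: "h \<in> Q" using k(3) by auto
      then have 1: "z - z0 \<in> Q" using Q(2)[OF hQ r(1)] by (simp add: z)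
      have "norm h \<le> norm v' + dist v' h"
        by (metis add.commute dist_norm norm_minus_commute norm_triangle_sub)
      then have "norm h < 1" using hd nv' k(2) by linarith
      then have "z \<in> ball z0 r" using r by (simp add: z dist_norm)
      then show ?thesis using 1 QH[OF 1] by simp
    qed
    have Bb: "B \<in> sets borel" by (simp add: B_def)
    have i: "set_integrable lborel (ball z0 r \<inter> H) (\<lambda>z. norm (U z - UL))"
      using H r by (intro set_integrable_subset[OF int]) auto
    have "AE z in lborel. indicator B z *\<^sub>R norm (A - UL) \<le> indicator (ball z0 r \<inter> H) z *\<^sub>R norm (U z - UL)"
      using state
    proof eventually_elim
      case (elim z)
      then show ?case using B[of z] r by (auto simp: indicator_def)
    qed
    moreover have iB: "integrable lborel (\<lambda>z. indicator B z *\<^sub>R norm (A - UL))"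
      using Bb emeasure_lborel_ball_finite unfolding B_def
      by (intro integrable_scaleR_left integrable_real_indicator) auto
    ultimately have "(LINT z|lborel. indicator B z *\<^sub>R norm (A - UL)) \<le> (LINT z : ball z0 r \<inter> H | lborel. norm (U z - UL))"
      using i unfolding set_lebesgue_integral_def set_integrable_def by (intro integral_mono_AE)
    moreover have "(LINT z|lborel. indicator B z *\<^sub>R norm (A - UL)) = measure lborel B * norm (A - UL)"
      using Bb by simp
    moreover have "measure lborel B = (r * k)^2 * measure lborel (ball (0 :: real \<times> real) 1)"
      unfolding B_def using r k(1) by (subst content_ball_conv_unit_ball) (auto simp: power2_eq_square)
    ultimately show ?thesis
      using r by (simp add: c_def field_simps power_mult_distrib)
  qed
  have "eventually (\<lambda>r. c \<le> (LINT z : ball z0 r \<inter> H | lborel. norm (U z - UL)) / r^2) (at_right 0)"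
    using R bound by (auto simp: eventually_at_right_field)
  from tendsto_lowerbound[OF lim this] c show False by simp
qed

section \<open>Piecewise constant states\<close>

text \<open>Away from the line of slope \<open>s\<close> the profile is locally constant, so both
  one-sided limits agree, contrary to \<open>UL \<noteq> UR\<close>. On the line, a jump direction
  other than \<open>s\<close> would leave a wedge between the two lines, and that wedge forces one
  state on both sides.\<close>

lemma approx_jump_pw_state:
  assumes V: "open V" "z0 \<in> V \<inter> Omega"
    and int: "\<And>K. compact K \<Longrightarrow> K \<subseteq> V \<Longrightarrow> set_integrable lborel K U"
    and state: "AE z in lborel. z \<in> V \<inter> Omega \<longrightarrow> U z = pw_state s A1 A2 z"
    and jump: "approx_jump U z0 s' UL UR" and ne: "UL \<noteq> UR"
  shows "s' = s \<and> UL = A1 \<and> UR = A2"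
proof -
  have oV: "open (V \<inter> Omega)"
    using V(1) by (intro open_Int open_Omega)
  let ?L = "{z. snd z - snd z0 < s' * (fst z - fst z0)}"
  let ?R = "{z. snd z - snd z0 > s' * (fst z - fst z0)}"
  have oH: "open ?L" "open ?R"
    by (intro open_Collect_less continuous_intros)+
  have lim: "((\<lambda>r. (LINT z : ball z0 r \<inter> ?L | lborel. norm (U z - UL)) / r^2) \<longlongrightarrow> 0) (at_right 0)"
    "((\<lambda>r. (LINT z : ball z0 r \<inter> ?R | lborel. norm (U z - UR)) / r^2) \<longlongrightarrow> 0) (at_right 0)"
    using jump by (simp_all add: approx_jump_def)
  \<comment> \<open>Suppose that near \<open>z0\<close> the profile has the single value
    \<open>A\<close> along an open cone \<open>P\<close> of directions. Then \<open>A\<close> is the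
    one-sided limit on each side of the line of slope \<open>s'\<close> that \<open>P\<close>
    reaches. \<open>W\<close> localises in the cases off the shock line, \<open>P\<close> in the
    case on it.\<close>
  have cone: "(v \<in> {h. snd h < s' * fst h} \<longrightarrow> UL = A) \<and> (v \<in> {h. snd h > s' * fst h} \<longrightarrow> UR = A)"
    if W: "open W" "z0 \<in> W" and v: "v \<in> P" and P: "open P" "\<And>h c. h \<in> P \<Longrightarrow> c > 0 \<Longrightarrow> c *\<^sub>R h \<in> P"
      and A: "\<And>z. z \<in> V \<inter> Omega \<inter> W \<Longrightarrow> z - z0 \<in> P \<Longrightarrow> pw_state s A1 A2 z = A" for W P v A
  proof -
    have "open (V \<inter> Omega \<inter> W)" using oV W(1) by (rule open_Int)
    then obtain R where R: "R > 0" "cball z0 R \<subseteq> V \<inter> Omega \<inter> W"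
      using V(2) W(2) open_contains_cball by blast
    have U: "set_integrable lborel (ball z0 R) U"
    proof (rule set_integrable_subset)
      show "set_integrable lborel (cball z0 R) U" using R(2) by (intro int) auto
    qed auto
    have c: "set_integrable lborel (ball z0 R) (\<lambda>_. C)" for C :: state
      unfolding set_integrable_def using emeasure_lborel_ball_finite
      by (intro integrable_scaleR_left integrable_real_indicator) auto
    have N: "set_integrable lborel (ball z0 R) (\<lambda>z. norm (U z - C))" for C
      using set_integrable_norm[OF set_integral_diff(1)[OF U c]] .
    have st: "AE z in lborel. z - z0 \<in> P \<inter> S \<and> z \<in> ball z0 R \<longrightarrow> U z = A" for S
      using state
    proof eventually_elim
      case (elim z)
      have "z \<in> V \<inter> Omega \<inter> W" if "z \<in> ball z0 R" using that R(2) by auto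
      then show ?case using elim A[of z] by auto
    qed
    show ?thesis
    proof (intro conjI impI)
      assume "v \<in> {h. snd h < s' * fst h}"
      then show "UL = A"
        using v P oH
        by (intro approx_limit_eq_cone_state[where Q = "P \<inter> {h. snd h < s' * fst h}",
              OF lim(1) N R(1) _ _ _ _ _ st])
           (auto intro!: open_Int open_Collect_less continuous_intros simp: mult.left_commute)
    next
      assume "v \<in> {h. snd h > s' * fst h}"
      then show "UR = A"
        using v P oH
        by (intro approx_limit_eq_cone_state[where Q = "P \<inter> {h. snd h > s' * fst h}",
              OF lim(2) N R(1) _ _ _ _ _ st])
           (auto intro!: open_Int open_Collect_less continuous_intros simp: mult.left_commute)
    qed
  qed
  have below: "open {z. snd z < s * fst z}" and above: "open {z. snd z > s * fst z}"
    by (intro open_Collect_less continuous_intros)+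
  have scale: "h \<in> {h. snd h < s * fst h} \<Longrightarrow> c > 0 \<Longrightarrow> c *\<^sub>R h \<in> {h. snd h < s * fst h}"
    "h \<in> {h. snd h > s * fst h} \<Longrightarrow> c > 0 \<Longrightarrow> c *\<^sub>R h \<in> {h. snd h > s * fst h}" for h :: "real \<times> real" and c :: real
    by (auto simp: mult.left_commute)
  consider "snd z0 < s * fst z0" | "snd z0 > s * fst z0" | "snd z0 = s * fst z0" by linarith
  then show ?thesis
  proof cases
    case 1
    have "(v \<in> {h. snd h < s' * fst h} \<longrightarrow> UL = A1) \<and> (v \<in> {h. snd h > s' * fst h} \<longrightarrow> UR = A1)" for v
      by (rule cone[of "{z. snd z < s * fst z}" v UNIV])
         (use 1 below in \<open>auto simp: Omega_def pw_state_def\<close>)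
    \<comment> \<open>The purely spatial directions lie strictly on the two sides of a line of any
      slope, so they probe both limits without knowledge of \<open>s'\<close>.\<close>
    from this[of "(0, -1)"] this[of "(0, 1)"] ne show ?thesis by simp
  next
    case 2
    have "(v \<in> {h. snd h < s' * fst h} \<longrightarrow> UL = A2) \<and> (v \<in> {h. snd h > s' * fst h} \<longrightarrow> UR = A2)" for v
      by (rule cone[of "{z. snd z > s * fst z}" v UNIV])
         (use 2 above in \<open>auto simp: Omega_def pw_state_def\<close>)
    from this[of "(0, -1)"] this[of "(0, 1)"] ne show ?thesis by simp
  next
    case 3
    have b: "(v \<in> {h. snd h < s' * fst h} \<longrightarrow> UL = A1) \<and> (v \<in> {h. snd h > s' * fst h} \<longrightarrow> UR = A1)"
      if "v \<in> {h. snd h < s * fst h}" for v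
      by (rule cone[of UNIV v "{h. snd h < s * fst h}"])
         (use 3 below that scale in \<open>auto simp: Omega_def pw_state_def algebra_simps\<close>)
    have a: "(v \<in> {h. snd h < s' * fst h} \<longrightarrow> UL = A2) \<and> (v \<in> {h. snd h > s' * fst h} \<longrightarrow> UR = A2)"
      if "v \<in> {h. snd h > s * fst h}" for v
      by (rule cone[of UNIV v "{h. snd h > s * fst h}"])
         (use 3 above that scale in \<open>auto simp: Omega_def pw_state_def algebra_simps\<close>)
    have L: "UL = A1" using b[of "(0, -1)"] by simp
    have R: "UR = A2" using a[of "(0, 1)"] by simp
    have "s' = s"
    proof (rule ccontr)
      assume "s' \<noteq> s"
      then consider "s' > s" | "s' < s" by linarith
      \<comment> \<open>The witness has the mean of the two slopes and lies in the wedge above the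
        line of slope \<open>s\<close> and below that of slope \<open>s'\<close>. The wedge opens
        forward in time if \<open>s' > s\<close> and backward if \<open>s' < s\<close>.\<close>
      then have "UL = A2"
      proof cases
        case 1 then show ?thesis using a[of "(1, (s + s') / 2)"] by simp
      next
        case 2 then show ?thesis using a[of "(-1, - (s + s') / 2)"] by simp
      qed
      then show False using R ne by simp
    qed
    then show ?thesis using L R by simp
  qed
qed

section \<open>Scalar two-valued profiles and their conservation laws\<close>

lemma set_integrable_Pair:
  fixes f :: "'a \<Rightarrow> 'b :: {banach, second_countable_topology}" and g :: "'a \<Rightarrow> 'c :: {banach, second_countable_topology}"
  assumes "set_integrable M K f" "set_integrable M K g"
  shows "set_integrable M K (\<lambda>z. (f z, g z))"
proof -
  have "integrable M (\<lambda>z. (indicator K z *\<^sub>R f z, 0 :: 'c))" "integrable M (\<lambda>z. (0 :: 'b, indicator K z *\<^sub>R g z))"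
    using assms unfolding set_integrable_def
    by (auto intro: integrable_bounded_linear[OF bounded_linear_Pair[OF bounded_linear_ident bounded_linear_zero]]
      integrable_bounded_linear[OF bounded_linear_Pair[OF bounded_linear_zero bounded_linear_ident]])
  from Bochner_Integration.integrable_add[OF this] show ?thesis
    by (simp add: set_integrable_def scaleR_Pair)
qed

text \<open>One component of \<open>pw_state\<close>. For fixed \<open>s\<close> these functions are
  closed under products and under \<open>pressure\<close>, the value 0 outside the closed quarter
  plane included, so all seven densities of a shock solution have this form.\<close>

definition two_state :: "real \<Rightarrow> real \<Rightarrow> real \<Rightarrow> real \<times> real \<Rightarrow> real" where
  "two_state s a b z = (if fst z \<ge> 0 \<and> snd z \<le> 0 then (if snd z < s * fst z then a else b) else 0)"

lemma two_state_measurable [measurable]: "two_state s a b \<in> borel_measurable borel"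
proof -
  have 1: "closed {z :: real \<times> real. fst z \<ge> 0 \<and> snd z \<le> 0}" "open {z. snd z < s * fst z}"
    by (intro closed_Collect_conj closed_Collect_le open_Collect_less continuous_intros)+
  then have [measurable]: "{z :: real \<times> real. fst z \<ge> 0 \<and> snd z \<le> 0} \<in> sets borel"
    "{z. snd z < s * fst z} \<in> sets borel" by auto
  have "two_state s a b = (\<lambda>z. indicator {z. fst z \<ge> 0 \<and> snd z \<le> 0} z
      * (indicator {z. snd z < s * fst z} z * a + (1 - indicator {z. snd z < s * fst z} z) * b))"
    by (auto simp: two_state_def indicator_def fun_eq_iff)
  then show ?thesis by simp
qed

lemma two_state_nonneg: "a \<ge> 0 \<Longrightarrow> b \<ge> 0 \<Longrightarrow> two_state s a b z \<ge> 0"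
  by (simp add: two_state_def)

lemma abs_two_state_le: "\<bar>two_state s a b z\<bar> \<le> \<bar>a\<bar> + \<bar>b\<bar>"
  by (simp add: two_state_def)

lemma two_state_le: "two_state s a b z \<le> \<bar>a\<bar> + \<bar>b\<bar>"
  using abs_two_state_le[of s a b z] by linarith

lemma two_state_mult: "two_state s a b z * two_state s c d z = two_state s (a * c) (b * d) z"
  by (simp add: two_state_def)

lemma two_state_pressure:
  "pressure \<gamma> (two_state s a b z) (two_state s c d z) (two_state s e f z)
    = two_state s (pressure \<gamma> a c e) (pressure \<gamma> b d f) z"
  by (simp add: two_state_def pressure_def)

lemma pw_state_two_state:
  "pw_state s (a, c, e) (b, d, f) z = (two_state s a b z, two_state s c d z, two_state s e f z)"
  by (simp add: pw_state_def two_state_def)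

lemma set_integral_two_state:
  assumes "cc_on UNIV \<phi>"
  shows "set_integrable lborel Omega (\<lambda>z. two_state s a b z * \<phi> z)"
    and "(LINT z:Omega|lborel. two_state s a b z * \<phi> z)
      = a * (LINT z:Omega|lborel. \<phi> z) + (b - a) * (LINT z:behind (- s)|lborel. \<phi> z)"
proof -
  have eq: "indicator Omega z *\<^sub>R (two_state s a b z * \<phi> z)
    = a * (indicator Omega z *\<^sub>R \<phi> z) + (b - a) * (indicator (behind (- s)) z *\<^sub>R \<phi> z)" for z
    by (auto simp: two_state_def Omega_def behind_def indicator_def algebra_simps)
  have i: "integrable lborel (\<lambda>z. indicator Omega z *\<^sub>R \<phi> z)"
    "integrable lborel (\<lambda>z. indicator (behind (- s)) z *\<^sub>R \<phi> z)"
    using cc_on_set_integrable[OF assms] unfolding set_integrable_def by simp_all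
  show "set_integrable lborel Omega (\<lambda>z. two_state s a b z * \<phi> z)"
    unfolding set_integrable_def eq using i by simp
  show "(LINT z:Omega|lborel. two_state s a b z * \<phi> z)
      = a * (LINT z:Omega|lborel. \<phi> z) + (b - a) * (LINT z:behind (- s)|lborel. \<phi> z)"
    unfolding set_lebesgue_integral_def eq using i by simp
qed

lemma pair_two_state:
  assumes "cc_on UNIV \<phi>" "a \<ge> 0" "b \<ge> 0"
  shows "pair (lmeas (two_state s a b)) \<phi>
    = a * (LINT z:Omega|lborel. \<phi> z) + (b - a) * (LINT z:behind (- s)|lborel. \<phi> z)"
  using assms cc_on_measurable[OF assms(1)]
  by (subst pair_lmeas) (simp_all add: set_integral_two_state two_state_nonneg)

text \<open>The hypothesis is the Rankine--Hugoniot condition for a jump of speed s.\<close>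

lemma two_state_conservation_law:
  assumes "test_fn \<phi> \<phi>t \<phi>x" "s < 0" "(b - a) * s = d - c"
  shows "a * (LINT z:Omega|lborel. \<phi>t z) + (b - a) * (LINT z:behind (- s)|lborel. \<phi>t z)
      + (c * (LINT z:Omega|lborel. \<phi>x z) + (d - c) * (LINT z:behind (- s)|lborel. \<phi>x z))
    = d * (LINT t:{0..}|lborel. \<phi> (t, 0)) - a * (LINT x:{..<0}|lborel. \<phi> (0, x))"
proof -
  have d: "d = c + (b - a) * s"
    using assms(3) by simp
  have behind: "(LINT z:behind (- s)|lborel. \<phi>x z) = (LINT t:{0..}|lborel. \<phi> (t, 0)) - (LINT t:{0..}|lborel. \<phi> (t, s * t))"
    "(LINT z:behind (- s)|lborel. \<phi>t z) = s * (LINT t:{0..}|lborel. \<phi> (t, s * t))"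
    using assms(2) integral_behind_dx[OF assms(1), of "- s"] integral_behind_dt[OF assms(1), of "- s"]
    by simp_all
  show ?thesis
    unfolding d behind integral_Omega_dx[OF assms(1)] integral_Omega_dt[OF assms(1)]
    by (simp add: algebra_simps)
qed

lemma closure_Omega: "closure Omega = {z. fst z \<ge> 0 \<and> snd z \<le> 0}"
proof
  have "closed {z :: real \<times> real. fst z \<ge> 0 \<and> snd z \<le> 0}"
    by (intro closed_Collect_conj closed_Collect_le continuous_intros)
  then show "closure Omega \<subseteq> {z. fst z \<ge> 0 \<and> snd z \<le> 0}"
    by (intro closure_minimal) (auto simp: Omega_def)
  show "{z. fst z \<ge> 0 \<and> snd z \<le> 0} \<subseteq> closure Omega"
  proof
    fix z :: "real \<times> real" assume z: "z \<in> {z. fst z \<ge> 0 \<and> snd z \<le> 0}"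
    have "(\<lambda>n. z + (1 / real (Suc n)) *\<^sub>R (1, -1)) \<longlonglongrightarrow> z + 0 *\<^sub>R (1, -1)"
      by (intro tendsto_intros LIMSEQ_inverse_real_of_nat[unfolded inverse_eq_divide])
    moreover have "z + (1 / real (Suc n)) *\<^sub>R (1, -1) \<in> Omega" for n
      using z by (auto simp: Omega_def intro: add_nonneg_pos le_less_trans[of _ 0])
    ultimately show "z \<in> closure Omega"
      unfolding closure_sequential by (intro exI[of _ "\<lambda>n. z + (1 / real (Suc n)) *\<^sub>R (1, -1)"])
        (simp flip: zero_prod_def)
  qed
qed

text \<open>A tent function at a point of the closed quarter plane has positive integral over
  \<open>Omega\<close>, and \<open>\<mu>\<close> dominates that integral. For such a mass measure,
  the demand that \<open>u\<close> and \<open>E\<close> vanish where the mass does concerns only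
  points outside the closed quarter plane.\<close>

lemma not_vanishes_near:
  assumes "\<And>\<phi>. cc_on UNIV \<phi> \<Longrightarrow> (\<And>z. \<phi> z \<ge> 0) \<Longrightarrow> pair \<mu> \<phi> \<ge> (LINT z:Omega|lborel. \<phi> z)"
    and "z \<in> closure Omega"
  shows "\<not> vanishes_near \<mu> z"
proof
  assume "vanishes_near \<mu> z"
  then obtain r where r: "r > 0" "\<And>\<phi>. cc_on (ball z r) \<phi> \<Longrightarrow> pair \<mu> \<phi> = 0"
    unfolding vanishes_near_def by blast
  \<comment> \<open>The radius \<open>r / 2\<close> leaves room for a closed disc, hence a compact
    support, inside the open ball of radius \<open>r\<close>.\<close>
  define \<phi> where "\<phi> = (\<lambda>y. max 0 (r / 2 - dist z y))"
  have cont: "continuous_on UNIV \<phi>"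
    unfolding \<phi>_def by (intro continuous_intros)
  have cc: "cc_on (ball z r) \<phi>"
    unfolding cc_on_def
    by (intro conjI exI[of _ "cball z (r / 2)"] cont) (use r(1) in \<open>auto simp: \<phi>_def\<close>)
  then have cc': "cc_on UNIV \<phi>" by (rule cc_on_mono) simp
  have "(LINT z:Omega|lborel. \<phi> z) > 0"
    by (rule integral_Omega_pos[OF assms(2) _ cont _ cc_on_integrable[OF cc]]) (use r(1) in \<open>auto simp: \<phi>_def\<close>)
  moreover have "pair \<mu> \<phi> \<ge> (LINT z:Omega|lborel. \<phi> z)"
    by (rule assms(1)[OF cc']) (simp add: \<phi>_def)
  ultimately show False using r(2)[OF cc] by simp
qed

section \<open>The shock solution\<close>

context shock
begin

abbreviation "s \<equiv> sigma \<gamma> E0"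
abbreviation "r1 \<equiv> rho1 \<gamma> E0"
abbreviation "e1 \<equiv> E1 \<gamma> E0"
abbreviation "q0 \<equiv> p0 \<gamma> E0"
abbreviation "q1 \<equiv> p1 \<gamma> E0"

lemma sigma_neg: "s < 0"
  using w_pos sigma_eq by linarith

text \<open>Mass and momentum hold by the choice of \<open>sigma\<close> and \<open>p1\<close>.
  Energy reduces to mass, because \<open>E1\<close> is chosen so that the energy jump is the mass
  jump times \<open>E0 + p0\<close>. The differences such as \<open>0 - 1\<close> are kept in the
  shape \<open>(b - a) * s = d - c\<close> of the conservation law.\<close>

lemma rankine_hugoniot:
  "(r1 - 1) * s = 0 - 1" "(0 - 1) * s = q1 - (1 + q0)" "(r1 * e1 - E0) * s = 0 - (E0 + q0)"
proof -
  show 1: "(r1 - 1) * s = 0 - 1"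
    using rho1_gt_1 by (simp add: sigma_def)
  show "(0 - 1) * s = q1 - (1 + q0)"
    by (simp add: p1_def sigma_def)
  have "(r1 * e1 - E0) * s = (r1 - 1) * s * (E0 + q0)"
    unfolding rho1_E1 by (simp add: algebra_simps)
  then show "(r1 * e1 - E0) * s = 0 - (E0 + q0)"
    unfolding 1 by simp
qed

lemma q1_pos: "q1 > 0"
  using p1_eq p0_nonneg w_pos by linarith

lemma state_pos: "r1 \<ge> 0" "e1 \<ge> 0" "q0 \<ge> 0" "q1 \<ge> 0" "r1 * e1 \<ge> 0" "E0 \<ge> 0"
  using rho1_gt_1 E1_pos p0_nonneg q1_pos energy by simp_all

lemma state_pressure: "pressure \<gamma> 1 1 E0 = q0" "pressure \<gamma> r1 0 e1 = q1"
  using p1_pressure by (simp_all add: pressure_def p0_def)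

lemma shock_sol_two_state:
  "fst (shock_sol \<gamma> E0 z) = two_state s 1 r1 z"
  "fst (snd (shock_sol \<gamma> E0 z)) = two_state s 1 0 z"
  "snd (snd (shock_sol \<gamma> E0 z)) = two_state s E0 e1 z"
  by (simp_all add: shock_sol_def pw_state_two_state)

lemma induced_shock_sol:
  "induced \<gamma> (\<lambda>z. fst (shock_sol \<gamma> E0 z)) (\<lambda>z. fst (snd (shock_sol \<gamma> E0 z)))
      (\<lambda>z. snd (snd (shock_sol \<gamma> E0 z))) wp =
    \<lparr> mrho = lmeas (two_state s 1 r1), mm = lmeas (two_state s 1 0), mn = lmeas (two_state s 1 0),
      mm1 = lmeas (two_state s E0 (r1 * e1)), mn1 = lmeas (two_state s E0 0),
      mn2 = lmeas (two_state s q0 0), mp = lmeas (two_state s q0 q1), mwp = wp,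
      mu = two_state s 1 0, mE = two_state s E0 e1 \<rparr>"
  unfolding induced_def shock_sol_two_state power2_eq_square two_state_pressure two_state_mult state_pressure
  by simp

text \<open>Velocity and energy are given as functions, whereas in clause (iii) the density is any
  representative of a measure; equality almost everywhere is all that can be assumed of it.
  Uniqueness of approximate jumps then leaves only the shock to be tested.\<close>

lemma lax_ok_shock_sol:
  assumes V: "open V" and int: "\<And>K. compact K \<Longrightarrow> K \<subseteq> V \<Longrightarrow> set_integrable lborel K \<rho>"
    and state: "AE z in lborel. z \<in> V \<inter> Omega \<longrightarrow> \<rho> z = two_state s 1 r1 z"
  shows "lax_ok \<gamma> V \<rho> (two_state s 1 0) (two_state s E0 e1)"
  unfolding lax_ok_def
proof (intro ballI allI impI)
  fix z0 s' UL UR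
  assume z0: "z0 \<in> V \<inter> Omega" and
    j: "UL \<noteq> UR \<and> approx_jump (\<lambda>z. (\<rho> z, two_state s 1 0 z, two_state s E0 e1 z)) z0 s' UL UR"
  have "s' = s \<and> UL = (1, 1, E0) \<and> UR = (r1, 0, e1)"
  proof (rule approx_jump_pw_state[OF V z0 _ _ conjunct2[OF j] conjunct1[OF j]])
    fix K assume K: "compact K" "K \<subseteq> V"
    have t: "set_integrable lborel K (two_state s a b)" for a b
      using set_integrable_bounded[OF two_state_measurable K(1) abs_two_state_le] .
    show "set_integrable lborel K (\<lambda>z. (\<rho> z, two_state s 1 0 z, two_state s E0 e1 z))"
      using int[OF K] t by (intro set_integrable_Pair)
  next
    show "AE z in lborel. z \<in> V \<inter> Omega \<longrightarrow>
        (\<rho> z, two_state s 1 0 z, two_state s E0 e1 z) = pw_state s (1, 1, E0) (r1, 0, e1) z"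
      using state by eventually_elim (simp add: pw_state_two_state)
  qed
  then show "lax \<gamma> UL UR s'" using lax_shock by simp
qed

context
  fixes \<phi> \<phi>t \<phi>x assumes test: "test_fn \<phi> \<phi>t \<phi>x"
begin

private lemma law:
  assumes "(b - a) * s = d - c"
  shows "a * (LINT z:Omega|lborel. \<phi>t z) + (b - a) * (LINT z:behind (- s)|lborel. \<phi>t z)
      + (c * (LINT z:Omega|lborel. \<phi>x z) + (d - c) * (LINT z:behind (- s)|lborel. \<phi>x z))
    = d * (LINT t:{0..}|lborel. \<phi> (t, 0)) - a * (LINT x:{..<0}|lborel. \<phi> (0, x))"
  by (rule two_state_conservation_law[OF test sigma_neg assms])

private lemma cc: "cc_on UNIV \<phi>t" "cc_on UNIV \<phi>x"
  using test_fn_cc_on[OF test] by simp_all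

private lemma weak_law:
  assumes "(b - a) * s = d - c"
  shows "(LINT z:Omega|lborel. two_state s a b z * \<phi>t z + two_state s c d z * \<phi>x z)
    = d * (LINT t:{0..}|lborel. \<phi> (t, 0)) - a * (LINT x:{..<0}|lborel. \<phi> (0, x))"
  using law[OF assms] set_integral_two_state[OF cc(1), of s a b] set_integral_two_state[OF cc(2), of s c d]
  by (simp add: set_integral_add)

lemma shock_sol_weak:
  "(LINT z:Omega|lborel. two_state s 1 r1 z * \<phi>t z + two_state s 1 r1 z * two_state s 1 0 z * \<phi>x z)
      + (LINT x:{..<0}|lborel. 1 * \<phi> (0, x)) = 0"
  "(LINT z:Omega|lborel. two_state s 1 r1 z * two_state s 1 0 z * \<phi>t z
      + (two_state s 1 r1 z * (two_state s 1 0 z)^2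
         + pressure \<gamma> (two_state s 1 r1 z) (two_state s 1 0 z) (two_state s E0 e1 z)) * \<phi>x z)
    - (LINT t:{0..}|lborel. pressure \<gamma> (two_state s 1 r1 (t, 0)) (two_state s 1 0 (t, 0)) (two_state s E0 e1 (t, 0)) * \<phi> (t, 0))
    + (LINT x:{..<0}|lborel. 1 * 1 * \<phi> (0, x)) = 0"
  "(LINT z:Omega|lborel. two_state s 1 r1 z * two_state s E0 e1 z * \<phi>t z
      + (two_state s 1 r1 z * two_state s 1 0 z * two_state s E0 e1 z
         + two_state s 1 0 z * pressure \<gamma> (two_state s 1 r1 z) (two_state s 1 0 z) (two_state s E0 e1 z)) * \<phi>x z)
    + (LINT x:{..<0}|lborel. 1 * E0 * \<phi> (0, x)) = 0"
proof -
  have add: "two_state s a b z + two_state s c d z = two_state s (a + c) (b + d) z" for a b c d z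
    by (simp add: two_state_def)
  \<comment> \<open>For \<open>t \<ge> 0\<close> the point \<open>(t, 0)\<close> satisfies
    \<open>0 \<ge> s * t\<close>, so it lies behind the shock, and the trace of the pressure on the
    piston is \<open>q1\<close>, even at \<open>t = 0\<close>.\<close>
  have bd: "(LINT t:{0..}|lborel. pressure \<gamma> (two_state s 1 r1 (t, 0)) (two_state s 1 0 (t, 0)) (two_state s E0 e1 (t, 0)) * \<phi> (t, 0))
      = q1 * (LINT t:{0..}|lborel. \<phi> (t, 0))"
    unfolding two_state_pressure state_pressure set_integral_mult_right[symmetric]
    using sigma_neg
    by (intro set_lebesgue_integral_cong) (auto simp: two_state_def mult_less_0_iff zero_less_mult_iff)
  note eq = power2_eq_square two_state_pressure two_state_mult state_pressure add
  show "(LINT z:Omega|lborel. two_state s 1 r1 z * \<phi>t z + two_state s 1 r1 z * two_state s 1 0 z * \<phi>x z)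
      + (LINT x:{..<0}|lborel. 1 * \<phi> (0, x)) = 0"
    unfolding eq using weak_law[OF rankine_hugoniot(1)] by simp
  show "(LINT z:Omega|lborel. two_state s 1 r1 z * two_state s 1 0 z * \<phi>t z
      + (two_state s 1 r1 z * (two_state s 1 0 z)^2
         + pressure \<gamma> (two_state s 1 r1 z) (two_state s 1 0 z) (two_state s E0 e1 z)) * \<phi>x z)
    - (LINT t:{0..}|lborel. pressure \<gamma> (two_state s 1 r1 (t, 0)) (two_state s 1 0 (t, 0)) (two_state s E0 e1 (t, 0)) * \<phi> (t, 0))
    + (LINT x:{..<0}|lborel. 1 * 1 * \<phi> (0, x)) = 0"
    unfolding bd unfolding eq using weak_law[OF rankine_hugoniot(2)] by simp
  show "(LINT z:Omega|lborel. two_state s 1 r1 z * two_state s E0 e1 z * \<phi>t z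
      + (two_state s 1 r1 z * two_state s 1 0 z * two_state s E0 e1 z
         + two_state s 1 0 z * pressure \<gamma> (two_state s 1 r1 z) (two_state s 1 0 z) (two_state s E0 e1 z)) * \<phi>x z)
    + (LINT x:{..<0}|lborel. 1 * E0 * \<phi> (0, x)) = 0"
    unfolding eq using weak_law[OF rankine_hugoniot(3)] by simp
qed

lemma shock_sol_measure_law:
  "pair (lmeas (two_state s 1 r1)) \<phi>t + pair (lmeas (two_state s 1 0)) \<phi>x
      + (LINT x:{..<0}|lborel. 1 * \<phi> (0, x)) = 0"
  "pair (lmeas (two_state s 1 0)) \<phi>t + pair (lmeas (two_state s 1 0)) \<phi>x + pair (lmeas (two_state s q0 q1)) \<phi>x
      - (LINT t:{0..}|lborel. q1 * \<phi> (t, 0)) + (LINT x:{..<0}|lborel. 1 * 1 * \<phi> (0, x)) = 0"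
  "pair (lmeas (two_state s E0 (r1 * e1))) \<phi>t + pair (lmeas (two_state s E0 0)) \<phi>x + pair (lmeas (two_state s q0 0)) \<phi>x
      + (LINT x:{..<0}|lborel. 1 * E0 * \<phi> (0, x)) = 0"
  using law[OF rankine_hugoniot(1)] law[OF rankine_hugoniot(2)] law[OF rankine_hugoniot(3)]
  by (simp_all add: pair_two_state cc state_pos algebra_simps)

end

theorem iws_shock_sol:
  "iws \<gamma> 1 1 E0 (\<lambda>z. fst (shock_sol \<gamma> E0 z)) (\<lambda>z. fst (snd (shock_sol \<gamma> E0 z)))
                    (\<lambda>z. snd (snd (shock_sol \<gamma> E0 z)))"
  unfolding iws_def shock_sol_two_state
proof (intro conjI allI impI)
  have "\<bar>two_state s a b z\<bar> \<le> B" if "\<bar>a\<bar> + \<bar>b\<bar> \<le> B" for a b z B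
    using abs_two_state_le that by (rule order_trans)
  then have "\<bar>two_state s 1 r1 z\<bar> \<le> 1 + r1 + E0 + e1 \<and> \<bar>two_state s 1 0 z\<bar> \<le> 1 + r1 + E0 + e1
      \<and> \<bar>two_state s E0 e1 z\<bar> \<le> 1 + r1 + E0 + e1" for z
    using state_pos by simp
  then show "\<exists>B. AE z in lborel. z \<in> Omega \<longrightarrow> \<bar>two_state s 1 r1 z\<bar> \<le> B \<and> \<bar>two_state s 1 0 z\<bar> \<le> B \<and> \<bar>two_state s E0 e1 z\<bar> \<le> B"
    by (intro exI[of _ "1 + r1 + E0 + e1"] AE_I2) blast
  show "lax_ok \<gamma> Omega (two_state s 1 r1) (two_state s 1 0) (two_state s E0 e1)"
    by (rule lax_ok_shock_sol[OF open_Omega])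
       (auto intro: set_integrable_bounded[OF two_state_measurable _ abs_two_state_le])
qed (rule two_state_measurable shock_sol_weak; assumption)+

theorem measure_solution_shock_sol:
  "measure_solution \<gamma> 1 1 E0
    (induced \<gamma> (\<lambda>z. fst (shock_sol \<gamma> E0 z)) (\<lambda>z. fst (snd (shock_sol \<gamma> E0 z)))
      (\<lambda>z. snd (snd (shock_sol \<gamma> E0 z))) (\<lambda>_. q1))"
proof -
  have sradon: "sradon (lmeas (two_state s a b)) \<and> supported_in (lmeas (two_state s a b)) (closure Omega)"
    if "a \<ge> 0" "b \<ge> 0" for a b
    using that
    by (intro conjI sradon_lmeas[OF _ _ ballI[OF two_state_le]] supported_in_lmeas ballI two_state_nonneg
        two_state_measurable)
  have ac: "abs_cont (lmeas (two_state s a b)) (lmeas (two_state s c d))"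
    if "a \<ge> 0" "b \<ge> 0" "c \<ge> 0" "d \<ge> 0" "c = 0 \<longrightarrow> a = 0" "d = 0 \<longrightarrow> b = 0" for a b c d
    using that by (intro abs_cont_lmeas) (auto simp: two_state_nonneg, auto simp: two_state_def Omega_def split: if_splits)
  have rn: "rn_deriv_is (lmeas (two_state s a b)) (two_state s c d) (lmeas (two_state s e f))"
    if "a \<ge> 0" "b \<ge> 0" "e \<ge> 0" "f \<ge> 0" "a = e * c" "b = f * d" for a b c d e f
  proof (rule rn_deriv_is_lmeas)
    show "\<bar>two_state s e f z * two_state s c d z\<bar> \<le> \<bar>e * c\<bar> + \<bar>f * d\<bar>" for z
      unfolding two_state_mult by (rule abs_two_state_le)
  qed (use that in \<open>simp_all add: two_state_nonneg two_state_mult\<close>)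
  have nn: "nonneg (lmeas (two_state s 1 r1))"
    using state_pos unfolding nonneg_def pair_def lmeas_eq[OF ballI[OF two_state_nonneg[OF zero_le_one state_pos(1)]]]
    by (auto intro!: Bochner_Integration.integral_nonneg)
  have vn: "two_state s 1 0 z = 0 \<and> two_state s E0 e1 z = 0" if "vanishes_near (lmeas (two_state s 1 r1)) z" for z
  proof (cases "z \<in> closure Omega")
    case True
    have "pair (lmeas (two_state s 1 r1)) \<phi> \<ge> (LINT z:Omega|lborel. \<phi> z)"
      if "cc_on UNIV \<phi>" "\<And>z. \<phi> z \<ge> 0" for \<phi>
    proof -
      have "(LINT z:behind (- s)|lborel. \<phi> z) \<ge> 0"
        unfolding set_lebesgue_integral_def using that(2) by simp
      then show ?thesis
        using that(1) state_pos rho1_gt_1 by (simp add: pair_two_state)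
    qed
    from not_vanishes_near[OF this True] that show ?thesis by blast
  next
    case False
    then show ?thesis by (auto simp: closure_Omega two_state_def)
  qed
  have law: "(AE z in lborel. z \<in> V \<longrightarrow> p z = pressure \<gamma> (\<rho> z) (two_state s 1 0 z) (two_state s E0 e1 z))
      \<and> lax_ok \<gamma> V \<rho> (two_state s 1 0) (two_state s E0 e1)"
    if V: "open V"
      and int: "\<forall>K. compact K \<and> K \<subseteq> V \<longrightarrow> set_integrable lborel K \<rho> \<and> set_integrable lborel K p"
      and pr: "\<forall>\<phi>. cc_on V \<phi> \<longrightarrow> pair (lmeas (two_state s 1 r1)) \<phi> = (LINT z|lborel. \<rho> z * \<phi> z) \<and>
        pair (lmeas (two_state s q0 q1)) \<phi> = (LINT z|lborel. p z * \<phi> z)" for V \<rho> p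
  proof -
    have ae: "AE z in lborel. z \<in> V \<longrightarrow> f z = indicator Omega z * two_state s a b z"
      if "\<And>K. compact K \<Longrightarrow> K \<subseteq> V \<Longrightarrow> set_integrable lborel K f" "a \<ge> 0" "b \<ge> 0"
        "\<And>\<phi>. cc_on V \<phi> \<Longrightarrow> pair (lmeas (two_state s a b)) \<phi> = (LINT z|lborel. f z * \<phi> z)" for f a b
    proof (rule AE_eq_from_cc_on[OF V that(1)])
      show "\<bar>indicator Omega z * two_state s a b z\<bar> \<le> \<bar>a\<bar> + \<bar>b\<bar>" for z
        using abs_two_state_le by (auto simp: indicator_def)
      fix \<phi> assume cc: "cc_on V \<phi>"
      have "pair (lmeas (two_state s a b)) \<phi> = (LINT z:Omega|lborel. two_state s a b z * \<phi> z)"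
        using that(2,3) by (intro pair_lmeas cc_on_measurable[OF cc]) (auto simp: two_state_nonneg)
      then show "(LINT z|lborel. f z * \<phi> z) = (LINT z|lborel. indicator Omega z * two_state s a b z * \<phi> z)"
        using that(4)[OF cc] by (simp add: set_lebesgue_integral_def mult.assoc)
    qed measurable
    have \<rho>: "AE z in lborel. z \<in> V \<longrightarrow> \<rho> z = indicator Omega z * two_state s 1 r1 z"
      using int pr state_pos by (intro ae) auto
    have p: "AE z in lborel. z \<in> V \<longrightarrow> p z = indicator Omega z * two_state s q0 q1 z"
      using int pr state_pos by (intro ae) auto
    have "AE z in lborel. z \<in> V \<longrightarrow> p z = pressure \<gamma> (\<rho> z) (two_state s 1 0 z) (two_state s E0 e1 z)"
      using \<rho> p
    proof eventually_elim
      case (elim z)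
      \<comment> \<open>\<open>V\<close> may reach beyond \<open>Omega\<close>. There both recovered
        densities are 0, and so is the pressure of a state of zero density.\<close>
      then show ?case
        by (cases "z \<in> Omega") (auto simp: two_state_pressure state_pressure, simp add: pressure_def)
    qed
    moreover have "lax_ok \<gamma> V \<rho> (two_state s 1 0) (two_state s E0 e1)"
    proof (rule lax_ok_shock_sol[OF V])
      show "set_integrable lborel K \<rho>" if "compact K" "K \<subseteq> V" for K using int that by blast
      show "AE z in lborel. z \<in> V \<inter> Omega \<longrightarrow> \<rho> z = two_state s 1 r1 z"
        using \<rho> by eventually_elim auto
    qed
    ultimately show ?thesis by blast
  qed
  have wp: "set_integrable lborel {0..T} (\<lambda>_. q1)" for T :: real
    by (intro borel_integrable_atLeastAtMost' continuous_intros)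
  show ?thesis
    unfolding measure_solution_def induced_shock_sol msol.simps
    using state_pos q1_pos rho1_gt_1 E1_pos energy
    by (intro conjI allI impI shock_sol_measure_law two_state_measurable wp nn)
       (auto intro!: sradon[THEN conjunct1] sradon[THEN conjunct2] ac rn dest: vn law)
qed

end

section \<open>The delta solution\<close>

text \<open>The common shape of the limiting mass (\<open>c = 1\<close>) and energy
  (\<open>c = E0\<close>); the two are proportional.\<close>

definition layer_measure :: "real \<Rightarrow> smeasure" where
  "layer_measure c = sadd (lmeas (\<lambda>_. c)) (pmeas (\<lambda>t. c * t))"

context
  fixes c :: real assumes c: "c \<ge> 0"
begin

private abbreviation "bulk \<equiv> density lborel (\<lambda>z. ennreal (indicator Omega z * c))"
private abbreviation "wall \<equiv> distr (density lborel (\<lambda>t. ennreal (indicator {0..} t * (c * t)))) borel (\<lambda>t. (t, 0 :: real))"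

private lemma wall_map [measurable]: "(\<lambda>t :: real. (t, 0 :: real)) \<in> borel_measurable borel"
  by (intro borel_measurable_continuous_onI continuous_intros)

lemma layer_measure_eq: "layer_measure c = (add_measure bulk wall, null_measure borel)"
  unfolding layer_measure_def using c by (simp add: lmeas_eq pmeas_eq sadd_eq)

text \<open>Boundedness and bounded support, in place of continuity, let the formula cover
  indicators of compact sets, for the Radon property, and products of test functions with the
  discontinuous \<open>u\<close> and \<open>E\<close>.\<close>

lemma integral_layer_measure:
  assumes g [measurable]: "g \<in> borel_measurable borel" and B: "\<And>z. \<bar>g z\<bar> \<le> B" "\<And>z. norm z > R \<Longrightarrow> g z = 0"
  shows "integrable (fst (layer_measure c)) g"
    and "(\<integral>z. g z \<partial>fst (layer_measure c)) = c * (LINT z:Omega|lborel. g z) + (LINT t:{0..}|lborel. c * t * g (t, 0))"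
proof -
  have nn: "AE z in lborel. 0 \<le> indicator Omega z * c" "AE t :: real in lborel. 0 \<le> indicator {0..} t * (c * t)"
    using c by (auto simp: indicator_def)
  have g0 [measurable]: "(\<lambda>t. g (t, 0)) \<in> borel_measurable borel" by measurable
  have cb: "set_integrable lborel (cball 0 R) g"
    by (rule set_integrable_bounded[OF g _ B(1)]) simp
  have "indicator (cball 0 R) z *\<^sub>R g z = g z" for z
    using B(2)[of z] by (auto simp: indicator_def)
  then have "(\<lambda>z. indicator (cball 0 R) z *\<^sub>R g z) = g" by (rule ext)
  then have gi: "integrable lborel g" using cb by (simp only: set_integrable_def)
  have i1: "integrable bulk g"
    using integrable_mult_indicator[OF _ gi, of Omega]
    by (subst integrable_density[OF _ _ nn(1)]) (simp_all add: mult.commute mult.left_commute)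
  have z: "g (t, 0) = 0" if "\<bar>t\<bar> > R" for t
    using B(2)[of "(t, 0)"] norm_fst_le[of t "0 :: real"] that by simp
  have w: "integrable lborel (\<lambda>t. indicator {0..} t * (c * t) * g (t, 0))"
  proof (rule Bochner_Integration.integrable_bound)
    show "integrable lborel (\<lambda>t. indicator {0..R} t * (c * R * B))"
      by (intro integrable_mult_left integrable_real_indicator) (auto simp: emeasure_lborel_Icc_eq)
    show "AE t in lborel. norm (indicator {0..} t * (c * t) * g (t, 0)) \<le> norm (indicator {0..R} t * (c * R * B))"
    proof (rule AE_I2)
      fix t
      show "norm (indicator {0..} t * (c * t) * g (t, 0)) \<le> norm (indicator {0..R} t * (c * R * B))"
      proof (cases "t \<in> {0..R}")
        case True
        have "\<bar>c * t\<bar> * \<bar>g (t, 0)\<bar> \<le> \<bar>c * R\<bar> * \<bar>B\<bar>"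
          using True c B(1)[of "(t, 0)"] by (intro mult_mono) (auto simp: abs_mult mult_left_mono)
        then show ?thesis using True by (simp add: abs_mult)
      next
        case False
        then show ?thesis using z[of t] by (auto simp: indicator_def)
      qed
    qed
  qed measurable
  have i2: "integrable wall g"
    by (subst integrable_distr_eq; (subst integrable_density[OF _ _ nn(2)])?) (use w in simp_all)
  have "integral\<^sup>L bulk g = c * (LINT z:Omega|lborel. g z)"
    by (subst integral_density[OF _ _ nn(1)])
       (simp_all add: set_lebesgue_integral_def mult.commute mult.left_commute)
  moreover have "integral\<^sup>L wall g = (LINT t:{0..}|lborel. c * t * g (t, 0))"
    by (subst integral_distr; (subst integral_density[OF _ _ nn(2)])?)
       (simp_all add: set_lebesgue_integral_def mult.assoc mult.left_commute)
  ultimately show "(\<integral>z. g z \<partial>fst (layer_measure c)) = c * (LINT z:Omega|lborel. g z) + (LINT t:{0..}|lborel. c * t * g (t, 0))"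
    using integral_add_measure(2)[OF _ _ i1 i2] by (simp add: layer_measure_eq)
  show "integrable (fst (layer_measure c)) g"
    using integral_add_measure(1)[OF _ _ i1 i2] by (simp add: layer_measure_eq)
qed

text \<open>With \<open>c\<close> factored out it is plain that the null sets are the same for all
  \<open>c > 0\<close>; absolute continuity between the limiting mass and energy follows from
  this.\<close>

lemma emeasure_layer_measure:
  assumes [measurable]: "A \<in> sets borel"
  shows "emeasure (fst (layer_measure c)) A = ennreal c *
    (emeasure lborel (Omega \<inter> A) + (\<integral>\<^sup>+t. ennreal (indicator {0..} t * t) * indicator A (t, 0) \<partial>lborel))"
proof -
  have "emeasure bulk A = (\<integral>\<^sup>+z. ennreal c * indicator (Omega \<inter> A) z \<partial>lborel)"
    by (subst emeasure_density) (auto simp: indicator_def intro!: nn_integral_cong)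
  also have "\<dots> = ennreal c * emeasure lborel (Omega \<inter> A)"
    by (simp add: nn_integral_cmult)
  finally have 1: "emeasure bulk A = ennreal c * emeasure lborel (Omega \<inter> A)" .
  have m: "(\<lambda>t. indicator A (t, 0 :: real) :: ennreal) \<in> borel_measurable borel" by measurable
  have S: "(\<lambda>t. (t, 0)) -` A \<in> sets (borel :: real measure)"
    using measurable_sets[OF wall_map assms] by simp
  have "emeasure wall A = emeasure (density lborel (\<lambda>t. ennreal (indicator {0..} t * (c * t)))) ((\<lambda>t. (t, 0)) -` A)"
    by (subst emeasure_distr) auto
  also have "\<dots> = (\<integral>\<^sup>+t. ennreal c * (ennreal (indicator {0..} t * t) * indicator A (t, 0)) \<partial>lborel)"
    using c S by (subst emeasure_density) (auto simp: indicator_def ennreal_mult intro!: nn_integral_cong)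
  also have "\<dots> = ennreal c * (\<integral>\<^sup>+t. ennreal (indicator {0..} t * t) * indicator A (t, 0) \<partial>lborel)"
    using m by (intro nn_integral_cmult) simp
  finally show ?thesis
    using 1 by (simp add: layer_measure_eq emeasure_add_measure distrib_left)
qed

lemma snd_layer_measure: "snd (layer_measure c) = null_measure borel"
  by (simp add: layer_measure_eq)

lemma sradon_layer_measure: "sradon (layer_measure c)"
proof (rule sradonI)
  show "radon (fst (layer_measure c))"
    unfolding radon_def
  proof (intro conjI allI impI)
    fix K :: "(real \<times> real) set" assume K: "compact K"
    then obtain R where R: "\<And>z. z \<in> K \<Longrightarrow> norm z \<le> R"
      using compact_imp_bounded bounded_iff by metis
    have [measurable]: "K \<in> sets borel" using K by (simp add: compact_imp_closed)
    have "integrable (fst (layer_measure c)) (indicator K :: _ \<Rightarrow> real)"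
      by (rule integral_layer_measure(1)[of _ 1 R]) (use R in \<open>auto simp: indicator_def\<close>, fastforce)
    then show "emeasure (fst (layer_measure c)) K < \<infinity>"
      by (simp add: integrable_indicator_iff layer_measure_eq)
  qed (simp add: layer_measure_eq)
qed (rule snd_layer_measure)

lemma supported_in_layer_measure: "supported_in (layer_measure c) (closure Omega)"
proof -
  have "Omega \<inter> - closure Omega = {}" using closure_subset[of Omega] by auto
  moreover have "(\<integral>\<^sup>+t. ennreal (indicator {0..} t * t) * indicator (- closure Omega) (t, 0) \<partial>lborel)
      = (\<integral>\<^sup>+t. 0 \<partial>(lborel :: real measure))"
    by (intro nn_integral_cong) (auto simp: closure_Omega indicator_def)
  ultimately show ?thesis
    unfolding supported_in_def by (simp add: emeasure_layer_measure snd_layer_measure)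
qed

lemma pair_layer_measure:
  assumes "cc_on UNIV \<phi>"
  shows "pair (layer_measure c) \<phi> = c * (LINT z:Omega|lborel. \<phi> z) + c * (LINT t:{0..}|lborel. t * \<phi> (t, 0))"
proof -
  obtain R B where "\<And>z. \<bar>\<phi> z\<bar> \<le> B" "\<And>z. norm z > R \<Longrightarrow> \<phi> z = 0"
    using cc_onE[OF assms] by metis
  from integral_layer_measure(2)[OF cc_on_measurable[OF assms] this] show ?thesis
    by (simp add: pair_def snd_layer_measure mult.assoc)
qed

end

lemma layer_measure_null_iff:
  assumes "c > 0" "A \<in> sets borel"
  shows "emeasure (fst (layer_measure c)) A = 0 \<longleftrightarrow> emeasure lborel (Omega \<inter> A) = 0
    \<and> (\<integral>\<^sup>+t. ennreal (indicator {0..} t * t) * indicator A (t, 0) \<partial>lborel) = 0"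
  using assms by (simp add: emeasure_layer_measure)

lemma emeasure_lmeas_const:
  assumes "c \<ge> 0" "A \<in> sets borel"
  shows "emeasure (fst (lmeas (\<lambda>_. c))) A = ennreal c * emeasure lborel (Omega \<inter> A)"
    "emeasure (snd (lmeas (\<lambda>_. c))) A = 0"
proof -
  have "(\<integral>\<^sup>+z. ennreal (indicator Omega z * c) * indicator A z \<partial>lborel) = (\<integral>\<^sup>+z. ennreal c * indicator (Omega \<inter> A) z \<partial>lborel)"
    by (auto simp: indicator_def intro!: nn_integral_cong)
  then show "emeasure (fst (lmeas (\<lambda>_. c))) A = ennreal c * emeasure lborel (Omega \<inter> A)"
    "emeasure (snd (lmeas (\<lambda>_. c))) A = 0"
    using assms by (simp_all add: lmeas_eq emeasure_density nn_integral_cmult)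
qed

lemma abs_cont_layer:
  assumes "c \<ge> 0" "d > 0"
  shows "abs_cont (layer_measure c) (layer_measure d)" "abs_cont (lmeas (\<lambda>_. c)) (layer_measure d)"
    "abs_cont (lmeas (\<lambda>_. c)) (lmeas (\<lambda>_. d))"
  using assms unfolding abs_cont_def
  by (auto simp: layer_measure_null_iff emeasure_layer_measure[of c] emeasure_lmeas_const snd_layer_measure)

lemma rn_deriv_is_layer:
  assumes "c \<ge> 0" "h \<in> borel_measurable borel" and hB: "\<And>z. \<bar>h z\<bar> \<le> B"
    and eq: "\<And>\<phi>. cc_on UNIV \<phi> \<Longrightarrow> pair \<mu> \<phi>
      = c * (LINT z:Omega|lborel. \<phi> z * h z) + (LINT t:{0..}|lborel. c * t * (\<phi> (t, 0) * h (t, 0)))"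
  shows "rn_deriv_is \<mu> h (layer_measure c)"
  unfolding rn_deriv_is_def
proof (intro conjI allI impI)
  note [measurable] = assms(2)
  fix K :: "(real \<times> real) set" assume K: "compact K"
  then obtain R where R: "\<And>z. z \<in> K \<Longrightarrow> norm z \<le> R"
    using compact_imp_bounded bounded_iff by metis
  have [measurable]: "K \<in> sets borel" using K by (simp add: compact_imp_closed)
  have B0: "B \<ge> 0" using hB[of 0] by linarith
  show "set_integrable (fst (layer_measure c)) K h"
    unfolding set_integrable_def
    by (rule integral_layer_measure(1)[OF assms(1), of _ B R])
       (use R hB B0 in \<open>auto simp: indicator_def dest: not_less[THEN iffD2]\<close>)
  show "set_integrable (snd (layer_measure c)) K h"
    unfolding set_integrable_def by (simp add: snd_layer_measure assms(1))
next
  note [measurable] = assms(2)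
  fix \<phi> assume cc: "cc_on UNIV \<phi>"
  note [measurable] = cc_on_measurable[OF cc]
  obtain R C where C: "\<And>z. \<bar>\<phi> z\<bar> \<le> C" "\<And>z. norm z > R \<Longrightarrow> \<phi> z = 0"
    using cc_onE[OF cc] by metis
  have "\<bar>\<phi> z * h z\<bar> \<le> C * B" for z
    using C(1)[of z] hB[of z] unfolding abs_mult by (intro mult_mono) auto
  then have "(\<integral>z. \<phi> z * h z \<partial>fst (layer_measure c))
      = c * (LINT z:Omega|lborel. \<phi> z * h z) + (LINT t:{0..}|lborel. c * t * (\<phi> (t, 0) * h (t, 0)))"
    using C(2) by (intro integral_layer_measure(2)[OF assms(1), where B = "C * B" and R = R]) auto
  then show "pair \<mu> \<phi> = (\<integral>z. \<phi> z * h z \<partial>fst (layer_measure c)) - (\<integral>z. \<phi> z * h z \<partial>snd (layer_measure c))"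
    using eq[OF cc] by (simp add: snd_layer_measure assms(1))
qed

lemma delta_lim_layer:
  "delta_lim E0 =
     \<lparr> mrho = layer_measure 1, mm = lmeas (\<lambda>_. 1), mn = lmeas (\<lambda>_. 1), mm1 = layer_measure E0,
       mn1 = lmeas (\<lambda>_. E0), mn2 = lmeas (\<lambda>_. 0), mp = lmeas (\<lambda>_. 0), mwp = (\<lambda>_. 1),
       mu = indicator Omega, mE = (\<lambda>z. E0 * indicator (closure Omega) z) \<rparr>"
  by (simp add: delta_lim_def layer_measure_def)

lemma pair_lmeas_const:
  assumes "cc_on U \<phi>" "c \<ge> 0"
  shows "pair (lmeas (\<lambda>_. c)) \<phi> = c * (LINT z:Omega|lborel. \<phi> z)"
  using assms cc_on_measurable[OF assms(1)] by (subst pair_lmeas) simp_all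

text \<open>At \<open>\<gamma> = 1\<close> the pressure function is identically 0, so the state
  relation reduces to \<open>p = 0\<close>, and the energy law is \<open>E0\<close> times the mass
  law. What remains is the balance at the piston: the incoming mass stays on the wall, and its
  momentum is absorbed by the force \<open>w_p = 1\<close>.\<close>

theorem measure_solution_delta_lim:
  assumes "E0 > 0"
  shows "measure_solution 1 1 1 E0 (delta_lim E0)"
proof -
  have [measurable]: "closure Omega \<in> sets borel" by simp
  have sr: "sradon (lmeas (\<lambda>_. a)) \<and> supported_in (lmeas (\<lambda>_. a)) (closure Omega)"
    "sradon (layer_measure a) \<and> supported_in (layer_measure a) (closure Omega)" if "a \<ge> 0" for a
    using that by (auto intro: sradon_lmeas[where B = a] supported_in_lmeas
        sradon_layer_measure supported_in_layer_measure)
  have on_Omega: "indicator (closure Omega) z = (1 :: real)" if "z \<in> Omega" for z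
    using that closure_subset[of Omega] by auto
  have law: "pair (layer_measure c) \<phi>t + pair (lmeas (\<lambda>_. c)) \<phi>x + c * (LINT x:{..<0}|lborel. \<phi> (0, x)) = 0"
    "pair (lmeas (\<lambda>_. 1)) \<phi>t + pair (lmeas (\<lambda>_. 1)) \<phi>x - (LINT t:{0..}|lborel. \<phi> (t, 0)) + (LINT x:{..<0}|lborel. \<phi> (0, x)) = 0"
    if test: "test_fn \<phi> \<phi>t \<phi>x" and c: "c \<ge> 0" for \<phi> \<phi>t \<phi>x c
  proof -
    note cc = test_fn_cc_on[OF test]
    obtain R where R: "R > 0" "\<And>z. norm z > R \<Longrightarrow> \<phi> z = 0"
      using cc_onE[OF cc(1)] by metis
    have z: "\<phi> (t, 0) = 0" if "\<bar>t\<bar> > R" for t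
      using R(2)[of "(t, 0)"] norm_fst_le[of t "0 :: real"] that by simp
    have ct: "continuous_on UNIV (\<lambda>t. \<phi> (t, 0))" "continuous_on UNIV (\<lambda>t. \<phi>t (t, 0))"
      by (rule continuous_on_compose2[OF cc_on_continuous[OF cc(1), of UNIV]] 
            continuous_on_compose2[OF cc_on_continuous[OF cc(2), of UNIV]]; auto intro!: continuous_intros)+
    \<comment> \<open>The integrand is the derivative of \<open>t * \<phi> (t, 0)\<close>, whose
      boundary value at 0 vanishes. The wall mass \<open>t\<close> thus grows at rate 1, which is
      the mass flux \<open>\<rho> u\<close> of the gas arriving at the piston.\<close>
    have "(LINT t:{0..}|lborel. \<phi> (t, 0) + t * \<phi>t (t, 0)) = - (0 * \<phi> (0, 0))"
    proof (rule set_integral_deriv_atLeast[where R = R and f = "\<lambda>t. t * \<phi> (t, 0)"])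
      show "((\<lambda>t. t * \<phi> (t, 0)) has_real_derivative \<phi> (t, 0) + t * \<phi>t (t, 0)) (at t)" for t
        by (auto intro!: derivative_eq_intros test_fn_partial(1)[OF test])
      show "t * \<phi> (t, 0) = 0" if "t > R" for t using z that by simp
    qed (intro continuous_intros ct)
    moreover have "set_integrable lborel {0..} (\<lambda>t. t * \<phi>t (t, 0))"
    proof -
      obtain R where R: "R > 0" "\<And>z. norm z > R \<Longrightarrow> \<phi>t z = 0"
        using cc_onE[OF cc(2)] by metis
      have "set_integrable lborel {0..R} (\<lambda>t. t * \<phi>t (t, 0))"
        using ct by (intro borel_integrable_atLeastAtMost' continuous_intros) (auto intro: continuous_on_subset)
      moreover have "(\<lambda>t. indicator {0..} t *\<^sub>R (t * \<phi>t (t, 0))) = (\<lambda>t. indicator {0..R} t *\<^sub>R (t * \<phi>t (t, 0)))"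
      proof
        fix t :: real
        have "\<phi>t (t, 0) = 0" if "\<bar>t\<bar> > R"
          using R(2)[of "(t, 0)"] norm_fst_le[of t "0 :: real"] that by simp
        then show "indicator {0..} t *\<^sub>R (t * \<phi>t (t, 0)) = indicator {0..R} t *\<^sub>R (t * \<phi>t (t, 0))"
          by (auto simp: indicator_def)
      qed
      ultimately show ?thesis unfolding set_integrable_def by argo
    qed
    moreover have "set_integrable lborel {0..} (\<lambda>t. \<phi> (t, 0))"
      by (rule section_set_integrable[OF test]) (intro continuous_intros)
    ultimately have "(LINT t:{0..}|lborel. t * \<phi>t (t, 0)) = - (LINT t:{0..}|lborel. \<phi> (t, 0))"
      by (simp add: set_integral_add)
    then show "pair (layer_measure c) \<phi>t + pair (lmeas (\<lambda>_. c)) \<phi>x + c * (LINT x:{..<0}|lborel. \<phi> (0, x)) = 0"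
      using c by (simp add: pair_layer_measure pair_lmeas_const[OF cc(2)] pair_lmeas_const[OF cc(3)] cc integral_Omega_dt[OF test] integral_Omega_dx[OF test])
    show "pair (lmeas (\<lambda>_. 1)) \<phi>t + pair (lmeas (\<lambda>_. 1)) \<phi>x - (LINT t:{0..}|lborel. \<phi> (t, 0)) + (LINT x:{..<0}|lborel. \<phi> (0, x)) = 0"
      by (simp add: pair_lmeas_const[OF cc(2)] pair_lmeas_const[OF cc(3)] cc integral_Omega_dt[OF test] integral_Omega_dx[OF test])
  qed
  have zero: "pair (lmeas (\<lambda>_. 0)) \<phi> = 0" for \<phi>
    by (simp add: pair_def lmeas_def)
  have laws: "pair (layer_measure 1) \<phi>t + pair (lmeas (\<lambda>_. 1)) \<phi>x + (LINT x:{..<0}|lborel. 1 * \<phi> (0, x)) = 0 \<and>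
      pair (lmeas (\<lambda>_. 1)) \<phi>t + pair (lmeas (\<lambda>_. 1)) \<phi>x + pair (lmeas (\<lambda>_. 0)) \<phi>x
        - (LINT t:{0..}|lborel. 1 * \<phi> (t, 0)) + (LINT x:{..<0}|lborel. 1 * 1 * \<phi> (0, x)) = 0 \<and>
      pair (layer_measure E0) \<phi>t + pair (lmeas (\<lambda>_. E0)) \<phi>x + pair (lmeas (\<lambda>_. 0)) \<phi>x
        + (LINT x:{..<0}|lborel. 1 * E0 * \<phi> (0, x)) = 0"
    if "test_fn \<phi> \<phi>t \<phi>x" for \<phi> \<phi>t \<phi>x
    using law(1)[OF that, of 1] law(1)[OF that, of E0] law(2)[OF that order_refl] assms by (simp add: zero)
  have ge: "pair (layer_measure 1) \<phi> \<ge> (LINT z:Omega|lborel. \<phi> z)" if "cc_on UNIV \<phi>" "\<And>z. \<phi> z \<ge> 0" for \<phi>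
  proof -
    have "(LINT t:{0..}|lborel. t * \<phi> (t, 0)) \<ge> 0"
      unfolding set_lebesgue_integral_def using that(2) by (intro integral_nonneg_AE AE_I2) (simp add: indicator_def)
    then show ?thesis using that(1) by (simp add: pair_layer_measure)
  qed
  have nn: "nonneg (layer_measure 1)"
    unfolding nonneg_def
  proof (intro allI impI)
    fix \<phi> assume \<phi>: "cc_on UNIV \<phi> \<and> (\<forall>z. \<phi> z \<ge> 0)"
    then have "(LINT z:Omega|lborel. \<phi> z) \<ge> 0"
      unfolding set_lebesgue_integral_def by (auto intro!: Bochner_Integration.integral_nonneg)
    then show "pair (layer_measure 1) \<phi> \<ge> 0" using ge[of \<phi>] \<phi> by simp
  qed
  have vn: "indicator Omega z = (0 :: real) \<and> E0 * indicator (closure Omega) z = 0"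
    if "vanishes_near (layer_measure 1) z" for z
  proof -
    have "z \<notin> closure Omega" using not_vanishes_near[OF ge] that by blast
    then show ?thesis using closure_subset[of Omega] by (auto simp: indicator_def)
  qed
  have rn: "rn_deriv_is (lmeas (\<lambda>_. 1)) (indicator Omega) (layer_measure 1)"
    "rn_deriv_is (lmeas (\<lambda>_. 1)) (indicator Omega) (lmeas (\<lambda>_. 1))"
    "rn_deriv_is (lmeas (\<lambda>_. E0)) (indicator Omega) (layer_measure E0)"
    "rn_deriv_is (lmeas (\<lambda>_. 0)) (indicator Omega) (lmeas (\<lambda>_. 0))"
    "rn_deriv_is (layer_measure E0) (\<lambda>z. E0 * indicator (closure Omega) z) (layer_measure 1)"
  proof -
    \<comment> \<open>The velocity is the indicator of the open quarter plane and vanishes on the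
      piston; the energy is carried by the closed one. Hence the wall mass contributes to energy but
      neither to momentum nor to energy flux.\<close>
    have wall: "(t, 0) \<notin> Omega" "t \<ge> 0 \<Longrightarrow> (t, 0) \<in> closure Omega" for t :: real
      by (simp add: Omega_def, simp add: closure_Omega)
    have u: "rn_deriv_is (lmeas (\<lambda>_. a)) (indicator Omega) (layer_measure a)" if "a \<ge> 0" for a
    proof (rule rn_deriv_is_layer[OF that, where B = 1])
      fix \<phi> assume cc: "cc_on UNIV \<phi>"
      have "(LINT z:Omega|lborel. \<phi> z * indicator Omega z) = (LINT z:Omega|lborel. \<phi> z)"
        by (intro set_lebesgue_integral_cong) auto
      then show "pair (lmeas (\<lambda>_. a)) \<phi> = a * (LINT z:Omega|lborel. \<phi> z * indicator Omega z)
          + (LINT t:{0..}|lborel. a * t * (\<phi> (t, 0) * indicator Omega (t, 0)))"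
        using that wall by (simp add: pair_lmeas_const[OF cc] set_lebesgue_integral_def)
    qed (auto simp: indicator_def)
    show "rn_deriv_is (lmeas (\<lambda>_. 1)) (indicator Omega) (layer_measure 1)"
      "rn_deriv_is (lmeas (\<lambda>_. E0)) (indicator Omega) (layer_measure E0)"
      using assms by (auto intro: u)
    show "rn_deriv_is (lmeas (\<lambda>_. 1)) (indicator Omega) (lmeas (\<lambda>_. 1))"
      "rn_deriv_is (lmeas (\<lambda>_. 0)) (indicator Omega) (lmeas (\<lambda>_. 0))"
      by (rule rn_deriv_is_lmeas[where B = 1]; auto simp: indicator_def)+
    show "rn_deriv_is (layer_measure E0) (\<lambda>z. E0 * indicator (closure Omega) z) (layer_measure 1)"
    proof (rule rn_deriv_is_layer[where B = E0])
      fix \<phi> assume cc: "cc_on UNIV \<phi>"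
      have "(LINT z:Omega|lborel. \<phi> z * (E0 * indicator (closure Omega) z)) = (LINT z:Omega|lborel. E0 * \<phi> z)"
        by (intro set_lebesgue_integral_cong) (auto simp: on_Omega)
      moreover have "(LINT t:{0..}|lborel. 1 * t * (\<phi> (t, 0) * (E0 * indicator (closure Omega) (t, 0))))
          = (LINT t:{0..}|lborel. E0 * (t * \<phi> (t, 0)))"
        by (intro set_lebesgue_integral_cong) (auto simp: wall)
      ultimately show "pair (layer_measure E0) \<phi> = 1 * (LINT z:Omega|lborel. \<phi> z * (E0 * indicator (closure Omega) z))
          + (LINT t:{0..}|lborel. 1 * t * (\<phi> (t, 0) * (E0 * indicator (closure Omega) (t, 0))))"
        using assms cc by (simp add: pair_layer_measure)
    qed (use assms in \<open>auto simp: indicator_def\<close>)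
  qed
  have iii: "(AE z in lborel. z \<in> V \<longrightarrow> p z = pressure 1 (\<rho> z) (indicator Omega z) (E0 * indicator (closure Omega) z))
      \<and> lax_ok 1 V \<rho> (indicator Omega) (\<lambda>z. E0 * indicator (closure Omega) z)"
    if V: "open V"
      and int: "\<forall>K. compact K \<and> K \<subseteq> V \<longrightarrow> set_integrable lborel K \<rho> \<and> set_integrable lborel K p"
      and pr: "\<forall>\<phi>. cc_on V \<phi> \<longrightarrow> pair (layer_measure 1) \<phi> = (LINT z|lborel. \<rho> z * \<phi> z) \<and>
        pair (lmeas (\<lambda>_. 0)) \<phi> = (LINT z|lborel. p z * \<phi> z)" for V \<rho> p
  proof
    have "AE z in lborel. z \<in> V \<longrightarrow> p z = 0"
      using int pr by (intro AE_eq_from_cc_on[OF V, where B = 0]) (auto simp: zero)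
    then show "AE z in lborel. z \<in> V \<longrightarrow> p z = pressure 1 (\<rho> z) (indicator Omega z) (E0 * indicator (closure Omega) z)"
      by (simp add: pressure_def)
    \<comment> \<open>\<open>lax_ok\<close> inspects only points of \<open>Omega\<close>, and a test
      function supported there does not see the Dirac part, so the density is identified on
      \<open>V\<close> intersected with \<open>Omega\<close>.\<close>
    have W: "open (V \<inter> Omega)" using V open_Omega by (rule open_Int)
    have \<rho>: "AE z in lborel. z \<in> V \<inter> Omega \<longrightarrow> \<rho> z = 1"
    proof (rule AE_eq_from_cc_on[OF W, where B = 1])
      show "set_integrable lborel K \<rho>" if "compact K" "K \<subseteq> V \<inter> Omega" for K
        using int that by auto
      fix \<phi> assume cc: "cc_on (V \<inter> Omega) \<phi>"
      then have 0: "\<phi> z = 0" if "z \<notin> Omega" for z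
        using that unfolding cc_on_def by blast
      have "cc_on V \<phi>" and cc': "cc_on UNIV \<phi>" using cc by (auto elim: cc_on_mono)
      then have "(LINT z|lborel. \<rho> z * \<phi> z) = pair (layer_measure 1) \<phi>" using pr by simp
      also have "\<dots> = (LINT z:Omega|lborel. \<phi> z) + (LINT t:{0..}|lborel. t * \<phi> (t, 0))"
        using cc' by (simp add: pair_layer_measure)
      also have "(LINT t:{0..}|lborel. t * \<phi> (t, 0)) = 0"
        using 0 by (simp add: Omega_def)
      also have "(LINT z:Omega|lborel. \<phi> z) = (LINT z|lborel. 1 * \<phi> z)"
        unfolding set_lebesgue_integral_def
        using 0 by (intro Bochner_Integration.integral_cong) (auto simp: indicator_def)
      finally show "(LINT z|lborel. \<rho> z * \<phi> z) = (LINT z|lborel. 1 * \<phi> z)" by simp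
    qed auto
    show "lax_ok 1 V \<rho> (indicator Omega) (\<lambda>z. E0 * indicator (closure Omega) z)"
      unfolding lax_ok_def
    proof (intro ballI allI impI)
      fix z0 s' UL UR
      assume z0: "z0 \<in> V \<inter> Omega" and j: "UL \<noteq> UR \<and>
        approx_jump (\<lambda>z. (\<rho> z, indicator Omega z, E0 * indicator (closure Omega) z)) z0 s' UL UR"
      \<comment> \<open>The constant state is read as a profile with equal values on both sides of
        the line of slope 0, an arbitrary choice. The resulting \<open>UL = UR\<close> contradicts
        the assumption, so the interior carries no approximate jump at all.\<close>
      have "s' = 0 \<and> UL = (1, 1, E0) \<and> UR = (1, 1, E0)"
      proof (rule approx_jump_pw_state[OF V z0 _ _ conjunct2[OF j] conjunct1[OF j]])
        show "set_integrable lborel K (\<lambda>z. (\<rho> z, indicator Omega z :: real, E0 * indicator (closure Omega) z))"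
          if "compact K" "K \<subseteq> V" for K
        proof (intro set_integrable_Pair)
          show "set_integrable lborel K \<rho>" using int that by blast
          show "set_integrable lborel K (indicator Omega :: _ \<Rightarrow> real)"
            by (rule set_integrable_bounded[OF _ that(1), of _ 1]) (auto simp: indicator_def)
          show "set_integrable lborel K (\<lambda>z. E0 * indicator (closure Omega) z)"
            by (rule set_integrable_bounded[OF _ that(1), of _ E0]) (use assms in \<open>auto simp: indicator_def\<close>)
        qed
        show "AE z in lborel. z \<in> V \<inter> Omega \<longrightarrow>
          (\<rho> z, indicator Omega z, E0 * indicator (closure Omega) z) = pw_state 0 (1, 1, E0) (1, 1, E0) z"
          using \<rho> by eventually_elim (auto simp: on_Omega pw_state_def, auto simp: Omega_def)
      qed
      then show "lax 1 UL UR s'" using j by simp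
    qed
  qed
  have ac0: "abs_cont (lmeas (\<lambda>_. 0)) \<mu>" for \<mu>
    unfolding abs_cont_def by (simp add: emeasure_lmeas_const)
  have wp: "set_integrable lborel {0..T} (\<lambda>_. 1 :: real)" for T :: real
    by (intro borel_integrable_atLeastAtMost' continuous_intros)
  have meas: "(indicator Omega :: _ \<Rightarrow> real) \<in> borel_measurable borel"
    "(\<lambda>z. E0 * indicator (closure Omega) z) \<in> borel_measurable borel" by measurable
  show ?thesis
    unfolding measure_solution_def delta_lim_layer msol.simps
    using assms
    by (intro conjI allI impI nn rn wp meas ac0 abs_cont_layer)
       (auto intro!: sr[THEN conjunct1] sr[THEN conjunct2] dest: vn iii laws)
qed

section \<open>Vanishing-pressure limits\<close>

lemma pair_two_state_layer_mean:
  assumes "cc_on UNIV \<phi>" "a \<ge> 0" "b \<ge> 0" "s < 0"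
  shows "pair (lmeas (two_state s a b)) \<phi>
    = a * (LINT z:Omega|lborel. \<phi> z) + (b - a) * (- s) * layer_mean \<phi> (- s)"
  using assms by (simp add: pair_two_state integral_behind_eq)

text \<open>No limit is asked of the right value \<open>b\<close> itself. Only the jump multiplied
  by the width of the layer has to converge, which admits a density that blows up in a layer that
  collapses.\<close>

lemma sconv_two_state:
  assumes a: "(a \<longlongrightarrow> a0) F" and s: "(s \<longlongrightarrow> s0) F" and m: "((\<lambda>k. (b k - a k) * (- s k)) \<longlongrightarrow> m0) F"
    and ev: "eventually (\<lambda>k. s k < 0 \<and> a k \<ge> 0 \<and> b k \<ge> 0) F"
    and \<mu>: "\<And>\<phi>. cc_on UNIV \<phi> \<Longrightarrow> pair \<mu> \<phi> = a0 * (LINT z:Omega|lborel. \<phi> z) + m0 * layer_mean \<phi> (- s0)"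
  shows "sconv F (\<lambda>k. lmeas (two_state (s k) (a k) (b k))) \<mu>"
  unfolding sconv_def
proof (intro allI impI)
  fix \<phi> assume cc: "cc_on UNIV \<phi>"
  have "((\<lambda>k. a k * (LINT z:Omega|lborel. \<phi> z) + (b k - a k) * (- s k) * layer_mean \<phi> (- s k))
    \<longlongrightarrow> a0 * (LINT z:Omega|lborel. \<phi> z) + m0 * layer_mean \<phi> (- s0)) F"
    by (intro tendsto_intros a m isCont_tendsto_compose[OF isCont_layer_mean[OF cc]] s)
  then show "((\<lambda>k. pair (lmeas (two_state (s k) (a k) (b k))) \<phi>) \<longlongrightarrow> pair \<mu> \<phi>) F"
    unfolding \<mu>[OF cc]
    by (rule Lim_transform_eventually) (use ev in eventually_elim, simp add: pair_two_state_layer_mean cc)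
qed

text \<open>The closed form of the induced measures is available only for admissible parameters,
  hence only eventually along the filter.\<close>

lemma msol_conv_cong:
  assumes ev: "eventually (\<lambda>k. N k = M k) F" and conv: "msol_conv F M S"
  shows "msol_conv F N S"
proof -
  have c: "((\<lambda>k. f (N k)) \<longlongrightarrow> l) F \<longleftrightarrow> ((\<lambda>k. f (M k)) \<longlongrightarrow> l) F" for f :: "msol \<Rightarrow> real" and l
    by (rule tendsto_cong) (use ev in eventually_elim, simp)
  note cs = c[of "\<lambda>X. pair (mrho X) \<phi>" for \<phi>] c[of "\<lambda>X. pair (mm X) \<phi>" for \<phi>]
    c[of "\<lambda>X. pair (mn X) \<phi>" for \<phi>] c[of "\<lambda>X. pair (mm1 X) \<phi>" for \<phi>]
    c[of "\<lambda>X. pair (mn1 X) \<phi>" for \<phi>] c[of "\<lambda>X. pair (mn2 X) \<phi>" for \<phi>]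
    c[of "\<lambda>X. pair (mp X) \<phi>" for \<phi>] c[of "\<lambda>X. LINT t:{0..T}|lborel. \<bar>mwp X t - mwp S t\<bar>" for T]
  show ?thesis
    using conv unfolding msol_conv_def sconv_def cs .
qed

lemma set_integral_const_Icc:
  "T \<ge> 0 \<Longrightarrow> (LINT t:{0..T}|lborel. c) = T * c" for T c :: real
  by (simp add: set_lebesgue_integral_def)

text \<open>The Rankine--Hugoniot conditions turn each jump times \<open>- sigma\<close> into a flux
  difference: 1 for mass and \<open>E0 + p0\<close> for energy. These converge whatever
  \<open>rho1\<close> does, so convergence of \<open>E0\<close>, \<open>p0\<close> and
  \<open>sigma\<close> suffices, and one statement serves both limits.\<close>

lemma msol_conv_two_state:
  assumes state: "eventually (\<lambda>k. shock (\<gamma> k) (E0 k)) F"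
    and E0: "(E0 \<longlongrightarrow> e) F" and q0: "((\<lambda>k. p0 (\<gamma> k) (E0 k)) \<longlongrightarrow> q) F"
    and s: "((\<lambda>k. sigma (\<gamma> k) (E0 k)) \<longlongrightarrow> s0) F"
    and S: "mwp S = (\<lambda>_. q + 1 - s0)"
      "\<And>\<phi>. cc_on UNIV \<phi> \<Longrightarrow> pair (mrho S) \<phi> = (LINT z:Omega|lborel. \<phi> z) + layer_mean \<phi> (- s0)"
      "\<And>\<phi>. cc_on UNIV \<phi> \<Longrightarrow> pair (mm S) \<phi> = (LINT z:Omega|lborel. \<phi> z) + s0 * layer_mean \<phi> (- s0)"
      "\<And>\<phi>. cc_on UNIV \<phi> \<Longrightarrow> pair (mn S) \<phi> = (LINT z:Omega|lborel. \<phi> z) + s0 * layer_mean \<phi> (- s0)"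
      "\<And>\<phi>. cc_on UNIV \<phi> \<Longrightarrow> pair (mm1 S) \<phi> = e * (LINT z:Omega|lborel. \<phi> z) + (e + q) * layer_mean \<phi> (- s0)"
      "\<And>\<phi>. cc_on UNIV \<phi> \<Longrightarrow> pair (mn1 S) \<phi> = e * (LINT z:Omega|lborel. \<phi> z) + e * s0 * layer_mean \<phi> (- s0)"
      "\<And>\<phi>. cc_on UNIV \<phi> \<Longrightarrow> pair (mn2 S) \<phi> = q * (LINT z:Omega|lborel. \<phi> z) + q * s0 * layer_mean \<phi> (- s0)"
      "\<And>\<phi>. cc_on UNIV \<phi> \<Longrightarrow> pair (mp S) \<phi> = q * (LINT z:Omega|lborel. \<phi> z) + (1 - s0) * (- s0) * layer_mean \<phi> (- s0)"
  shows "msol_conv F (\<lambda>k. induced (\<gamma> k) (\<lambda>z. fst (shock_sol (\<gamma> k) (E0 k) z)) (\<lambda>z. fst (snd (shock_sol (\<gamma> k) (E0 k) z)))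
      (\<lambda>z. snd (snd (shock_sol (\<gamma> k) (E0 k) z))) (\<lambda>_. p1 (\<gamma> k) (E0 k))) S"
proof -
  define M where "M k = \<lparr> mrho = lmeas (two_state (sigma (\<gamma> k) (E0 k)) 1 (rho1 (\<gamma> k) (E0 k))),
      mm = lmeas (two_state (sigma (\<gamma> k) (E0 k)) 1 0), mn = lmeas (two_state (sigma (\<gamma> k) (E0 k)) 1 0),
      mm1 = lmeas (two_state (sigma (\<gamma> k) (E0 k)) (E0 k) (rho1 (\<gamma> k) (E0 k) * E1 (\<gamma> k) (E0 k))),
      mn1 = lmeas (two_state (sigma (\<gamma> k) (E0 k)) (E0 k) 0),
      mn2 = lmeas (two_state (sigma (\<gamma> k) (E0 k)) (p0 (\<gamma> k) (E0 k)) 0),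
      mp = lmeas (two_state (sigma (\<gamma> k) (E0 k)) (p0 (\<gamma> k) (E0 k)) (p1 (\<gamma> k) (E0 k))),
      mwp = (\<lambda>_. p1 (\<gamma> k) (E0 k)), mu = two_state (sigma (\<gamma> k) (E0 k)) 1 0,
      mE = two_state (sigma (\<gamma> k) (E0 k)) (E0 k) (E1 (\<gamma> k) (E0 k)) \<rparr>" for k
  have p1_eq: "p1 (\<gamma> k) (E0 k) = p0 (\<gamma> k) (E0 k) + 1 - sigma (\<gamma> k) (E0 k)" for k
    by (simp add: p1_def sigma_def)
  have p1: "((\<lambda>k. p1 (\<gamma> k) (E0 k)) \<longlongrightarrow> q + 1 - s0) F"
    unfolding p1_eq by (intro tendsto_intros q0 s)
  have sg: "eventually (\<lambda>k. sigma (\<gamma> k) (E0 k) < 0) F"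
    using state by eventually_elim (rule shock.sigma_neg)
  have pos: "eventually (\<lambda>k. 0 \<le> rho1 (\<gamma> k) (E0 k) \<and> 0 \<le> E0 k \<and> 0 \<le> rho1 (\<gamma> k) (E0 k) * E1 (\<gamma> k) (E0 k)
      \<and> 0 \<le> p0 (\<gamma> k) (E0 k) \<and> 0 \<le> p1 (\<gamma> k) (E0 k)) F"
    using state by eventually_elim (auto dest: shock.state_pos)
  have ev: "eventually (\<lambda>k. sigma (\<gamma> k) (E0 k) < 0 \<and> 0 \<le> a k \<and> 0 \<le> b k) F"
    if "eventually (\<lambda>k. 0 \<le> a k \<and> 0 \<le> b k) F" for a b :: "'a \<Rightarrow> real"
    using sg that by eventually_elim simp
  have rh: "eventually (\<lambda>k. (rho1 (\<gamma> k) (E0 k) - 1) * - sigma (\<gamma> k) (E0 k) = 1 \<and>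
      (rho1 (\<gamma> k) (E0 k) * E1 (\<gamma> k) (E0 k) - E0 k) * - sigma (\<gamma> k) (E0 k) = E0 k + p0 (\<gamma> k) (E0 k)) F"
    using state
  proof eventually_elim
    case (elim k)
    show ?case using shock.rankine_hugoniot(1,3)[OF elim] by simp
  qed
  have m1: "((\<lambda>k. (rho1 (\<gamma> k) (E0 k) - 1) * - sigma (\<gamma> k) (E0 k)) \<longlongrightarrow> 1) F"
    by (rule tendsto_eventually) (use rh in eventually_elim, simp)
  have m2: "((\<lambda>k. (rho1 (\<gamma> k) (E0 k) * E1 (\<gamma> k) (E0 k) - E0 k) * - sigma (\<gamma> k) (E0 k)) \<longlongrightarrow> e + q) F"
    by (rule Lim_transform_eventually[OF tendsto_add[OF E0 q0]]) (use rh in eventually_elim, simp)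
  have m3: "((\<lambda>k. (0 - f k) * - sigma (\<gamma> k) (E0 k)) \<longlongrightarrow> l * s0) F" if "(f \<longlongrightarrow> l) F" for f l
    using tendsto_mult[OF that s] by simp
  have m4: "((\<lambda>k. (p1 (\<gamma> k) (E0 k) - p0 (\<gamma> k) (E0 k)) * - sigma (\<gamma> k) (E0 k)) \<longlongrightarrow> (1 - s0) * (- s0)) F"
    unfolding p1_eq using tendsto_mult[OF tendsto_diff[OF tendsto_const[of 1] s] tendsto_minus[OF s]] by simp
  have wp: "((\<lambda>k. LINT t:{0..T}|lborel. \<bar>p1 (\<gamma> k) (E0 k) - (q + 1 - s0)\<bar>) \<longlongrightarrow> 0) F" if "T \<ge> 0" for T :: real
  proof -
    have "((\<lambda>k. T * \<bar>p1 (\<gamma> k) (E0 k) - (q + 1 - s0)\<bar>) \<longlongrightarrow> T * \<bar>(q + 1 - s0) - (q + 1 - s0)\<bar>) F"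
      by (intro tendsto_intros p1)
    then show ?thesis using that by (simp add: set_integral_const_Icc)
  qed
  have "msol_conv F M S"
    unfolding msol_conv_def M_def msol.simps S(1)
  proof (intro conjI allI impI wp)
    show "sconv F (\<lambda>k. lmeas (two_state (sigma (\<gamma> k) (E0 k)) 1 (rho1 (\<gamma> k) (E0 k)))) (mrho S)"
      by (rule sconv_two_state[OF tendsto_const s m1 ev[OF eventually_mono[OF pos]]]) (auto simp: S)
    show "sconv F (\<lambda>k. lmeas (two_state (sigma (\<gamma> k) (E0 k)) 1 0)) (mm S)"
      by (rule sconv_two_state[OF tendsto_const s m3[OF tendsto_const] ev[OF always_eventually]]) (auto simp: S)
    show "sconv F (\<lambda>k. lmeas (two_state (sigma (\<gamma> k) (E0 k)) 1 0)) (mn S)"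
      by (rule sconv_two_state[OF tendsto_const s m3[OF tendsto_const] ev[OF always_eventually]]) (auto simp: S)
    show "sconv F (\<lambda>k. lmeas (two_state (sigma (\<gamma> k) (E0 k)) (E0 k) (rho1 (\<gamma> k) (E0 k) * E1 (\<gamma> k) (E0 k)))) (mm1 S)"
      by (rule sconv_two_state[OF E0 s m2 ev[OF eventually_mono[OF pos]]]) (auto simp: S)
    show "sconv F (\<lambda>k. lmeas (two_state (sigma (\<gamma> k) (E0 k)) (E0 k) 0)) (mn1 S)"
      by (rule sconv_two_state[OF E0 s m3[OF E0] ev[OF eventually_mono[OF pos]]]) (auto simp: S)
    show "sconv F (\<lambda>k. lmeas (two_state (sigma (\<gamma> k) (E0 k)) (p0 (\<gamma> k) (E0 k)) 0)) (mn2 S)"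
      by (rule sconv_two_state[OF q0 s m3[OF q0] ev[OF eventually_mono[OF pos]]]) (auto simp: S)
    show "sconv F (\<lambda>k. lmeas (two_state (sigma (\<gamma> k) (E0 k)) (p0 (\<gamma> k) (E0 k)) (p1 (\<gamma> k) (E0 k)))) (mp S)"
      by (rule sconv_two_state[OF q0 s m4 ev[OF eventually_mono[OF pos]]]) (auto simp: S)
  qed
  moreover have "eventually (\<lambda>k. induced (\<gamma> k) (\<lambda>z. fst (shock_sol (\<gamma> k) (E0 k) z)) (\<lambda>z. fst (snd (shock_sol (\<gamma> k) (E0 k) z)))
      (\<lambda>z. snd (snd (shock_sol (\<gamma> k) (E0 k) z))) (\<lambda>_. p1 (\<gamma> k) (E0 k)) = M k) F" (is "eventually (\<lambda>k. ?N k = _) F")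
    using state by eventually_elim (simp only: shock.induced_shock_sol M_def)
  ultimately show ?thesis
    by (rule msol_conv_cong[rotated])
qed

lemma tendsto_shock_sigma:
  assumes "\<gamma> > 1"
  shows "((\<lambda>E0. sigma \<gamma> E0) \<longlongrightarrow> sigma \<gamma> (1/2)) (at_right (1/2))"
proof -
  interpret shock \<gamma> "1/2" using assms by unfold_locales auto
  have q0: "((\<lambda>E0. p0 \<gamma> E0) \<longlongrightarrow> p0 \<gamma> (1/2)) (at_right (1/2))"
    unfolding p0_def by (intro tendsto_intros)
  have "2 * (\<gamma> - 1) * (1/2 + p0 \<gamma> (1/2)) \<noteq> 0"
    using assms by (simp add: p0_def)
  then have "((\<lambda>E0. rho1 \<gamma> E0) \<longlongrightarrow> rho1 \<gamma> (1/2)) (at_right (1/2))"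
    unfolding rho1_def by (intro tendsto_intros q0) auto
  moreover have "rho1 \<gamma> (1/2) - 1 \<noteq> 0" using rho1_gt_1 by simp
  ultimately show ?thesis unfolding sigma_def by (intro tendsto_intros)
qed

text \<open>For gamma close to 1 the quadratic equation for the shock speed gives
  -sigma / 2 < sigma^2 + (1 - (gamma - 1) / 2) (-sigma), which is of order gamma - 1.\<close>

lemma tendsto_sigma_0:
  assumes "E0 > 1/2"
  shows "((\<lambda>\<gamma>. sigma \<gamma> E0) \<longlongrightarrow> 0) (at_right 1)"
proof (rule tendsto_sandwich)
  \<comment> \<open>The bound \<open>\<gamma> < 2\<close> makes the linear coefficient
    \<open>1 - (\<gamma> - 1) / 2\<close> exceed \<open>1/2\<close>.\<close>
  have ev: "eventually (\<lambda>\<gamma>. 1 < \<gamma> \<and> \<gamma> < 2) (at_right (1 :: real))"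
    by (auto simp: eventually_at_right_field intro!: exI[of _ 2])
  show "eventually (\<lambda>\<gamma>. sigma \<gamma> E0 \<le> 0) (at_right 1)"
    using ev
  proof eventually_elim
    case (elim \<gamma>)
    then interpret shock \<gamma> E0 using assms by unfold_locales auto
    show ?case using sigma_neg by simp
  qed
  show "eventually (\<lambda>\<gamma>. - 2 * ((\<gamma> - 1) / 2 + \<gamma> * p0 \<gamma> E0) \<le> sigma \<gamma> E0) (at_right 1)"
    using ev
  proof eventually_elim
    case (elim \<gamma>)
    then interpret shock \<gamma> E0 using assms by unfold_locales auto
    define v where "v = - sigma \<gamma> E0"
    have "v^2 + (1 - (\<gamma> - 1) / 2) * v = (\<gamma> - 1) / 2 + \<gamma> * p0 \<gamma> E0"
      using w_quadratic unfolding v_def sigma_eq minus_minus .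
    moreover have "(1/2) * v \<le> (1 - (\<gamma> - 1) / 2) * v"
      using sigma_neg elim by (intro mult_right_mono) (auto simp: v_def)
    moreover have "v^2 \<ge> 0" by simp
    moreover have "X + Y = Z \<Longrightarrow> (1/2) * v \<le> Y \<Longrightarrow> X \<ge> 0 \<Longrightarrow> - 2 * Z \<le> - v" for X Y Z
      by linarith
    ultimately have "- 2 * ((\<gamma> - 1) / 2 + \<gamma> * p0 \<gamma> E0) \<le> - v" by blast
    then show ?case by (simp only: v_def minus_minus)
  qed
  have "((\<lambda>\<gamma>. - 2 * ((\<gamma> - 1) / 2 + \<gamma> * p0 \<gamma> E0)) \<longlongrightarrow> - 2 * ((1 - 1) / 2 + 1 * p0 1 E0)) (at_right 1)"
    unfolding p0_def by (intro tendsto_intros) auto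
  then show "((\<lambda>\<gamma>. - 2 * ((\<gamma> - 1) / 2 + \<gamma> * p0 \<gamma> E0)) \<longlongrightarrow> 0) (at_right 1)"
    by (simp add: p0_def)
qed (rule tendsto_const)

text \<open>The limit is the member of the family at \<open>E0 = 1/2\<close>, so the required values
  of its pairings are its own Rankine--Hugoniot conditions with zero pressure ahead of the
  shock.\<close>

theorem shock_sol_converges_high_Mach:
  assumes "\<gamma> > 1"
  shows "msol_conv (at_right (1/2))
    (\<lambda>E0. induced \<gamma> (\<lambda>z. fst (shock_sol \<gamma> E0 z)) (\<lambda>z. fst (snd (shock_sol \<gamma> E0 z)))
      (\<lambda>z. snd (snd (shock_sol \<gamma> E0 z))) (\<lambda>_. p1 \<gamma> E0))
    (induced \<gamma> (\<lambda>z. fst (shock_sol \<gamma> (1/2) z)) (\<lambda>z. fst (snd (shock_sol \<gamma> (1/2) z)))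
      (\<lambda>z. snd (snd (shock_sol \<gamma> (1/2) z))) (\<lambda>_. p1 \<gamma> (1/2)))"
proof -
  interpret shock \<gamma> "1/2" using assms by unfold_locales auto
  have state: "eventually (\<lambda>E0. shock \<gamma> E0) (at_right (1/2))"
    using assms by (auto simp: eventually_at_right_field shock_def intro!: exI[of _ 1])
  have q0: "((\<lambda>E0. p0 \<gamma> E0) \<longlongrightarrow> p0 \<gamma> (1/2)) (at_right (1/2))"
    unfolding p0_def by (intro tendsto_intros)
  have rh: "(r1 - 1) * - s = 1" "(r1 * e1 - 1/2) * - s = 1/2 + q0" "q1 = q0 + 1 - s"
    by (simp_all only: mult_minus_right rankine_hugoniot) (simp_all add: p1_def sigma_def)
  have wall: "pair (lmeas (two_state s 0 (1 - s))) \<phi> = - ((1 - s) * s * layer_mean \<phi> (- s))"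
    if "cc_on UNIV \<phi>" for \<phi>
    using pair_two_state_layer_mean[OF that order_refl _ sigma_neg, of "1 - s"] sigma_neg by simp
  have "q0 = 0" by (simp add: p0_def)
  note pair = pair_two_state_layer_mean[OF _ _ _ sigma_neg]
  show ?thesis
    unfolding induced_shock_sol
    by (rule msol_conv_two_state[OF state tendsto_ident_at q0 tendsto_shock_sigma[OF assms]])
       (simp_all only: msol.simps pair state_pos rh zero_le_one order_refl, simp_all add: \<open>q0 = 0\<close> wall)
qed

text \<open>With \<open>s0 = 0\<close> and \<open>q = 0\<close> every layer term carries a vanishing
  factor except those of mass and energy, whose coefficients are 1 and \<open>E0\<close>. Their
  \<open>layer_mean\<close> at 0 is the pairing with the weighted Dirac measure on the
  piston.\<close>

theorem shock_sol_converges_delta: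
  assumes "E0 > 1/2"
  shows "msol_conv (at_right 1)
    (\<lambda>\<gamma>. induced \<gamma> (\<lambda>z. fst (shock_sol \<gamma> E0 z)) (\<lambda>z. fst (snd (shock_sol \<gamma> E0 z)))
      (\<lambda>z. snd (snd (shock_sol \<gamma> E0 z))) (\<lambda>_. p1 \<gamma> E0)) (delta_lim E0)"
proof -
  have state: "eventually (\<lambda>\<gamma>. shock \<gamma> E0) (at_right 1)"
    using assms by (auto simp: eventually_at_right_field shock_def intro!: exI[of _ 2])
  have "((\<lambda>\<gamma>. p0 \<gamma> E0) \<longlongrightarrow> (1 - 1) * (E0 - 1/2)) (at_right 1)"
    unfolding p0_def by (intro tendsto_intros)
  then have q0: "((\<lambda>\<gamma>. p0 \<gamma> E0) \<longlongrightarrow> 0) (at_right 1)" by simp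
  show ?thesis
    using assms
    by (intro msol_conv_two_state[OF state tendsto_const q0 tendsto_sigma_0[OF assms]])
       (simp_all add: delta_lim_layer pair_layer_measure pair_lmeas_const layer_mean_0)
qed

theorem mainTheorem1:
  shows
  "(\<forall>\<gamma> E0. \<gamma> > 1 \<and> E0 > 1/2 \<longrightarrow>
      iws \<gamma> 1 1 E0 (\<lambda>z. fst (shock_sol \<gamma> E0 z)) (\<lambda>z. fst (snd (shock_sol \<gamma> E0 z)))
                    (\<lambda>z. snd (snd (shock_sol \<gamma> E0 z))) \<and>
      measure_solution \<gamma> 1 1 E0
        (induced \<gamma> (\<lambda>z. fst (shock_sol \<gamma> E0 z)) (\<lambda>z. fst (snd (shock_sol \<gamma> E0 z)))
                  (\<lambda>z. snd (snd (shock_sol \<gamma> E0 z))) (\<lambda>_. p1 \<gamma> E0))) \<and>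
   (\<forall>\<gamma>. \<gamma> > 1 \<longrightarrow>
      iws \<gamma> 1 1 (1/2) (\<lambda>z. fst (lim_sol \<gamma> z)) (\<lambda>z. fst (snd (lim_sol \<gamma> z)))
                      (\<lambda>z. snd (snd (lim_sol \<gamma> z))) \<and>
      measure_solution \<gamma> 1 1 (1/2)
        (induced \<gamma> (\<lambda>z. fst (lim_sol \<gamma> z)) (\<lambda>z. fst (snd (lim_sol \<gamma> z)))
                  (\<lambda>z. snd (snd (lim_sol \<gamma> z))) (\<lambda>_. (\<gamma> + 1) / 2)) \<and>
      msol_conv (at_right (1/2))
        (\<lambda>E0. induced \<gamma> (\<lambda>z. fst (shock_sol \<gamma> E0 z)) (\<lambda>z. fst (snd (shock_sol \<gamma> E0 z)))
                  (\<lambda>z. snd (snd (shock_sol \<gamma> E0 z))) (\<lambda>_. p1 \<gamma> E0))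
        (induced \<gamma> (\<lambda>z. fst (lim_sol \<gamma> z)) (\<lambda>z. fst (snd (lim_sol \<gamma> z)))
                  (\<lambda>z. snd (snd (lim_sol \<gamma> z))) (\<lambda>_. (\<gamma> + 1) / 2))) \<and>
   (\<forall>E0. E0 > 1/2 \<longrightarrow>
      msol_conv (at_right 1)
        (\<lambda>\<gamma>. induced \<gamma> (\<lambda>z. fst (shock_sol \<gamma> E0 z)) (\<lambda>z. fst (snd (shock_sol \<gamma> E0 z)))
                  (\<lambda>z. snd (snd (shock_sol \<gamma> E0 z))) (\<lambda>_. p1 \<gamma> E0))
        (delta_lim E0) \<and>
      measure_solution 1 1 1 E0 (delta_lim E0))"
proof (intro conjI allI impI)
  fix \<gamma> E0 :: real assume "\<gamma> > 1 \<and> E0 > 1/2"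
  then interpret shock \<gamma> E0 by unfold_locales auto
  show "iws \<gamma> 1 1 E0 (\<lambda>z. fst (shock_sol \<gamma> E0 z)) (\<lambda>z. fst (snd (shock_sol \<gamma> E0 z)))
      (\<lambda>z. snd (snd (shock_sol \<gamma> E0 z)))"
    by (rule iws_shock_sol)
  show "measure_solution \<gamma> 1 1 E0 (induced \<gamma> (\<lambda>z. fst (shock_sol \<gamma> E0 z))
      (\<lambda>z. fst (snd (shock_sol \<gamma> E0 z))) (\<lambda>z. snd (snd (shock_sol \<gamma> E0 z))) (\<lambda>_. p1 \<gamma> E0))"
    by (rule measure_solution_shock_sol)
next
  fix \<gamma> :: real assume \<gamma>: "\<gamma> > 1"
  then interpret shock \<gamma> "1/2" by unfold_locales auto
  show "iws \<gamma> 1 1 (1/2) (\<lambda>z. fst (lim_sol \<gamma> z)) (\<lambda>z. fst (snd (lim_sol \<gamma> z))) (\<lambda>z. snd (snd (lim_sol \<gamma> z)))"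
    unfolding lim_sol_eq[OF \<gamma>] by (rule iws_shock_sol)
  show "measure_solution \<gamma> 1 1 (1/2) (induced \<gamma> (\<lambda>z. fst (lim_sol \<gamma> z)) (\<lambda>z. fst (snd (lim_sol \<gamma> z)))
      (\<lambda>z. snd (snd (lim_sol \<gamma> z))) (\<lambda>_. (\<gamma> + 1) / 2))"
    using measure_solution_shock_sol unfolding lim_sol_eq[OF \<gamma>] shock_state_pressureless(4)[OF \<gamma>] .
  show "msol_conv (at_right (1/2))
      (\<lambda>E0. induced \<gamma> (\<lambda>z. fst (shock_sol \<gamma> E0 z)) (\<lambda>z. fst (snd (shock_sol \<gamma> E0 z)))
        (\<lambda>z. snd (snd (shock_sol \<gamma> E0 z))) (\<lambda>_. p1 \<gamma> E0))
      (induced \<gamma> (\<lambda>z. fst (lim_sol \<gamma> z)) (\<lambda>z. fst (snd (lim_sol \<gamma> z)))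
        (\<lambda>z. snd (snd (lim_sol \<gamma> z))) (\<lambda>_. (\<gamma> + 1) / 2))"
    using shock_sol_converges_high_Mach[OF \<gamma>] unfolding lim_sol_eq[OF \<gamma>] shock_state_pressureless(4)[OF \<gamma>] .
next
  fix E0 :: real assume E0: "E0 > 1/2"
  show "msol_conv (at_right 1)
      (\<lambda>\<gamma>. induced \<gamma> (\<lambda>z. fst (shock_sol \<gamma> E0 z)) (\<lambda>z. fst (snd (shock_sol \<gamma> E0 z)))
        (\<lambda>z. snd (snd (shock_sol \<gamma> E0 z))) (\<lambda>_. p1 \<gamma> E0)) (delta_lim E0)"
    by (rule shock_sol_converges_delta[OF E0])
  show "measure_solution 1 1 1 E0 (delta_lim E0)"
    using E0 by (intro measure_solution_delta_lim) simp
qed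

end
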